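(* Let $A$ and $B$ be rings, let $M$ be an $(A,B)$-bimodule, and let $R=\begin{pmatrix}A & M\\ 0 & B\end{pmatrix}$ be the triangular matrix ring. Let $\sigma:\begin{pmatrix}A\\ 0\end{pmatrix}\to\begin{pmatrix}M\\ B\end{pmatrix}$ be a morphism of left $R$-modules, let $p\in M$ be the element with $\sigma\begin{pmatrix}1\\ 0\end{pmatrix}=\begin{pmatrix}p\\ 0\end{pmatrix}$, and let $T=T(M,p)$, so that $\sigma^{-1}R=M_2(T)$. For any left $R$-module $N=(N_A,N_B,f)$, the left $\sigma^{-1}R$-module $\sigma^{-1}N=\sigma^{-1}R\otimes_R N$ is isomorphic to $\begin{pmatrix}L\\ L\end{pmatrix}$, with $M_2(T)$ acting on the left of $\begin{pmatrix}L\\ L\end{pmatrix}$ by matrix multiplication, where $L$ is the left $T$-module $$L=\begin{pmatrix}T & T\end{pmatrix}\otimes_R N\;\cong\;\mathrm{coker}\left(\begin{pmatrix}1\otimes f\\ g\otimes 1\end{pmatrix}:T\otimes_A M\otimes_B N_B\to(T\otimes_A N_A)\oplus(T\otimes_B N_B)\right)$$ (isomorphism of left $T$-modules), with $g$ the $(T,B)$-bimodule morphism $$g:T\otimes_A M\to T,\qquad t\otimes m\mapsto -t\,x_m.$$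
   Context: All rings are associative with $1$ and ring morphisms preserve $1$. Triangular matrix ring: for rings $A,B$ and an $(A,B)$-bimodule $M$, the ring $R=\begin{pmatrix}A & M\\ 0 & B\end{pmatrix}$ has entrywise addition and multiplication $\begin{pmatrix}a & m\\ 0 & b\end{pmatrix}\begin{pmatrix}a' & m'\\ 0 & b'\end{pmatrix}=\begin{pmatrix}aa' & am'+mb'\\ 0 & bb'\end{pmatrix}$. Its columns $P=\begin{pmatrix}A\\ 0\end{pmatrix}$ and $Q=\begin{pmatrix}M\\ B\end{pmatrix}$ are finitely generated projective left $R$-modules. Every left $R$-module morphism $\sigma:P\to Q$ satisfies $\sigma\begin{pmatrix}1\\ 0\end{pmatrix}=\begin{pmatrix}p\\ 0\end{pmatrix}$ for some $p\in M$. Universal localization: a ring morphism $R\to R'$ is $\sigma$-inverting if $\mathrm{id}\otimes\sigma:R'\otimes_R P\to R'\otimes_R Q$ is an isomorphism; the universal localization $R\to\sigma^{-1}R$ is the initial object in the category of $\sigma$-inverting ring morphisms $R\to R'$. The ring $T=T(M,p)$ is generated by elements $x_m$, one for each $m\in M$, with relations $x_m+x_{m'}=x_{m+m'}$, $x_{ap}x_m=x_{am}$, $x_mx_{pb}=x_{mb}$, $x_p=1$ for all $m,m'\in M$, $a\in A$, $b\in B$. There are ring morphisms $\rho_A:A\to T$, $a\mapsto x_{ap}$, and $\rho_B:B\to T$, $b\mapsto x_{pb}$, and an $(A,B)$-bimodule morphism $\rho_M:M\to T$, $m\mapsto x_m$; $T$ is regarded as a right $A$-module via $\rho_A$ and a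 right $B$-module via $\rho_B$. (Equivalently, $T$ is initial among rings $S$ equipped with ring morphisms $f_A:A\to S$, $f_B:B\to S$ and an $(A,B)$-bimodule morphism $f_M:M\to S$ with $f_M(p)=1$.) The universal localization $R\to\sigma^{-1}R$ is identified with the ring morphism $\begin{pmatrix}\rho_A & \rho_M\\ 0 & \rho_B\end{pmatrix}:R\to M_2(T)$. The row module $\begin{pmatrix}T & T\end{pmatrix}$ is a $(T,M_2(T))$-bimodule by matrix multiplication, and hence a $(T,R)$-bimodule via this morphism. Modules over $R$: every left $R$-module $N$ is written canonically as a triple $(N_A,N_B,f)$ with $N_A$ a left $A$-module, $N_B$ a left $B$-module and $f:M\otimes_B N_B\to N_A$ a morphism of left $A$-modules; the corresponding $R$-module is $\begin{pmatrix}N_A\\ N_B\end{pmatrix}$ with $\begin{pmatrix}a & m\\ 0 & b\end{pmatrix}\begin{pmatrix}n_A\\ n_B\end{pmatrix}=\begin{pmatrix}an_A+f(m\otimes n_B)\\ bn_B\end{pmatrix}$. *)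

theory Defs
  imports "HOL-Algebra.Free_Abelian_Groups" "HOL-Algebra.QuotRing" "HOL-Algebra.Module"
begin

section \<open>Modules over noncommutative rings\<close>

text \<open>
  The library locale \<^locale>\<open>module\<close> requires a commutative ring of scalars, so only its record is
  reused here. As there, the ring fields \<open>mult\<close> and \<open>one\<close> of a module record carry no meaning.
\<close>

locale left_module = R?: ring R + M?: abelian_group M
  for R :: "('r, 'e) ring_scheme" (structure) and M :: "('r, 'm, 'f) module_scheme" (structure) +
  assumes smult_closed [simp, intro]:
      "\<lbrakk>a \<in> carrier R; x \<in> carrier M\<rbrakk> \<Longrightarrow> a \<odot>\<^bsub>M\<^esub> x \<in> carrier M"
    and smult_l_distr:
      "\<lbrakk>a \<in> carrier R; b \<in> carrier R; x \<in> carrier M\<rbrakk> \<Longrightarrow>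
        (a \<oplus>\<^bsub>R\<^esub> b) \<odot>\<^bsub>M\<^esub> x = a \<odot>\<^bsub>M\<^esub> x \<oplus>\<^bsub>M\<^esub> b \<odot>\<^bsub>M\<^esub> x"
    and smult_r_distr:
      "\<lbrakk>a \<in> carrier R; x \<in> carrier M; y \<in> carrier M\<rbrakk> \<Longrightarrow>
        a \<odot>\<^bsub>M\<^esub> (x \<oplus>\<^bsub>M\<^esub> y) = a \<odot>\<^bsub>M\<^esub> x \<oplus>\<^bsub>M\<^esub> a \<odot>\<^bsub>M\<^esub> y"
    and smult_assoc:
      "\<lbrakk>a \<in> carrier R; b \<in> carrier R; x \<in> carrier M\<rbrakk> \<Longrightarrow>
        (a \<otimes>\<^bsub>R\<^esub> b) \<odot>\<^bsub>M\<^esub> x = a \<odot>\<^bsub>M\<^esub> (b \<odot>\<^bsub>M\<^esub> x)"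
    and smult_one [simp]:
      "x \<in> carrier M \<Longrightarrow> \<one>\<^bsub>R\<^esub> \<odot>\<^bsub>M\<^esub> x = x"

record ('r, 's, 'm) bimodule = "('r, 'm) module" +
  rsmult :: "'m \<Rightarrow> 's \<Rightarrow> 'm" (infixl \<open>\<bullet>\<index>\<close> 70)

locale right_module = S?: ring S + M?: abelian_group M
  for S :: "('s, 'e) ring_scheme" (structure) and M :: "('r, 's, 'm, 'f) bimodule_scheme" (structure) +
  assumes rsmult_closed [simp, intro]:
      "\<lbrakk>x \<in> carrier M; s \<in> carrier S\<rbrakk> \<Longrightarrow> x \<bullet>\<^bsub>M\<^esub> s \<in> carrier M"
    and rsmult_l_distr:
      "\<lbrakk>x \<in> carrier M; y \<in> carrier M; s \<in> carrier S\<rbrakk> \<Longrightarrow>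
        (x \<oplus>\<^bsub>M\<^esub> y) \<bullet>\<^bsub>M\<^esub> s = x \<bullet>\<^bsub>M\<^esub> s \<oplus>\<^bsub>M\<^esub> y \<bullet>\<^bsub>M\<^esub> s"
    and rsmult_r_distr:
      "\<lbrakk>x \<in> carrier M; s \<in> carrier S; t \<in> carrier S\<rbrakk> \<Longrightarrow>
        x \<bullet>\<^bsub>M\<^esub> (s \<oplus>\<^bsub>S\<^esub> t) = x \<bullet>\<^bsub>M\<^esub> s \<oplus>\<^bsub>M\<^esub> x \<bullet>\<^bsub>M\<^esub> t"
    and rsmult_assoc:
      "\<lbrakk>x \<in> carrier M; s \<in> carrier S; t \<in> carrier S\<rbrakk> \<Longrightarrow>
        x \<bullet>\<^bsub>M\<^esub> (s \<otimes>\<^bsub>S\<^esub> t) = (x \<bullet>\<^bsub>M\<^esub> s) \<bullet>\<^bsub>M\<^esub> t"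
    and rsmult_one [simp]:
      "x \<in> carrier M \<Longrightarrow> x \<bullet>\<^bsub>M\<^esub> \<one>\<^bsub>S\<^esub> = x"

locale bimodule = left_module R M + right_module S M
  for R :: "('r, 'e) ring_scheme" (structure) and S :: "('s, 'e') ring_scheme" (structure)
    and M :: "('r, 's, 'm, 'f) bimodule_scheme" (structure) +
  assumes smult_rsmult:
      "\<lbrakk>r \<in> carrier R; x \<in> carrier M; s \<in> carrier S\<rbrakk> \<Longrightarrow>
        (r \<odot>\<^bsub>M\<^esub> x) \<bullet>\<^bsub>M\<^esub> s = r \<odot>\<^bsub>M\<^esub> (x \<bullet>\<^bsub>M\<^esub> s)"

definition left_module_hom ::
    "('r, 'e) ring_scheme \<Rightarrow> ('r, 'm, 'f) module_scheme \<Rightarrow> ('r, 'n, 'g) module_scheme \<Rightarrow> ('m \<Rightarrow> 'n) set"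
  where "left_module_hom R M N =
    {h \<in> carrier M \<rightarrow> carrier N.
      (\<forall>x\<in>carrier M. \<forall>y\<in>carrier M. h (x \<oplus>\<^bsub>M\<^esub> y) = h x \<oplus>\<^bsub>N\<^esub> h y) \<and>
      (\<forall>r\<in>carrier R. \<forall>x\<in>carrier M. h (r \<odot>\<^bsub>M\<^esub> x) = r \<odot>\<^bsub>N\<^esub> h x)}"

definition bimodule_hom ::
    "('r, 'e) ring_scheme \<Rightarrow> ('s, 'e') ring_scheme \<Rightarrow>
      ('r, 's, 'm, 'f) bimodule_scheme \<Rightarrow> ('r, 's, 'n, 'g) bimodule_scheme \<Rightarrow> ('m \<Rightarrow> 'n) set"
  where "bimodule_hom R S M N =
    {h \<in> left_module_hom R M N. \<forall>x\<in>carrier M. \<forall>s\<in>carrier S. h (x \<bullet>\<^bsub>M\<^esub> s) = h x \<bullet>\<^bsub>N\<^esub> s}"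

definition left_module_iso ::
    "('r, 'e) ring_scheme \<Rightarrow> ('r, 'm, 'f) module_scheme \<Rightarrow> ('r, 'n, 'g) module_scheme \<Rightarrow> ('m \<Rightarrow> 'n) set"
  where "left_module_iso R M N = {h \<in> left_module_hom R M N. bij_betw h (carrier M) (carrier N)}"

definition left_modules_isomorphic ::
    "('r, 'e) ring_scheme \<Rightarrow> ('r, 'm, 'f) module_scheme \<Rightarrow> ('r, 'n, 'g) module_scheme \<Rightarrow> bool"
  where "left_modules_isomorphic R M N \<longleftrightarrow>
    left_module R M \<and> left_module R N \<and> left_module_iso R M N \<noteq> {}"

definition direct_sum_module ::
    "('r, 'm, 'f) module_scheme \<Rightarrow> ('r, 'n, 'g) module_scheme \<Rightarrow> ('r, 'm \<times> 'n) module"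
  where "direct_sum_module M N =
    \<lparr>carrier = carrier M \<times> carrier N, mult = undefined, one = undefined,
     zero = (\<zero>\<^bsub>M\<^esub>, \<zero>\<^bsub>N\<^esub>),
     add = (\<lambda>(x, y) (x', y'). (x \<oplus>\<^bsub>M\<^esub> x', y \<oplus>\<^bsub>N\<^esub> y')),
     smult = (\<lambda>r (x, y). (r \<odot>\<^bsub>M\<^esub> x, r \<odot>\<^bsub>N\<^esub> y))\<rparr>"

definition quotient_module :: "('r, 'm, 'f) module_scheme \<Rightarrow> 'm set \<Rightarrow> ('r, 'm set) module"
  where "quotient_module M K =
    \<lparr>carrier = a_rcosets\<^bsub>M\<^esub> K, mult = undefined, one = undefined,
     zero = K, add = set_add M,
     smult = (\<lambda>r C. \<Union>c\<in>C. K +>\<^bsub>M\<^esub> (r \<odot>\<^bsub>M\<^esub> c))\<rparr>"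

definition cokernel_module ::
    "('r, 'm, 'f) module_scheme \<Rightarrow> ('r, 'n, 'g) module_scheme \<Rightarrow> ('m \<Rightarrow> 'n) \<Rightarrow> ('r, 'n set) module"
  where "cokernel_module M N h = quotient_module N (h ` carrier M)"

text \<open>The ring \<open>R\<close> as an \<open>(R, S)\<close>-bimodule, for a ring morphism \<open>h\<close> from \<open>S\<close> to \<open>R\<close>.\<close>

definition ring_bimodule :: "('r, 'e) ring_scheme \<Rightarrow> ('s \<Rightarrow> 'r) \<Rightarrow> ('r, 's, 'r) bimodule"
  where "ring_bimodule R h =
    \<lparr>carrier = carrier R, mult = mult R, one = \<one>\<^bsub>R\<^esub>, zero = \<zero>\<^bsub>R\<^esub>, add = add R,
     smult = mult R, rsmult = (\<lambda>x s. x \<otimes>\<^bsub>R\<^esub> h s)\<rparr>"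


section \<open>Tensor products\<close>

text \<open>
  \<open>X \<otimes>\<^sub>S Y\<close> is the free abelian group on \<open>X \<times> Y\<close> modulo the subgroup generated by the usual
  relators. Elements of the free abelian group are finitely supported integer-valued functions,
  with basis elements \<^const>\<open>frag_of\<close>, and \<^const>\<open>frag_extend\<close> is linear extension from the basis.
\<close>

type_synonym ('x, 'y) tensor = "(('x \<times> 'y) \<Rightarrow>\<^sub>0 int) set"

definition tensor_relators ::
    "('s, 'e) ring_scheme \<Rightarrow> ('r, 's, 'x, 'f) bimodule_scheme \<Rightarrow> ('s, 'y, 'g) module_scheme
      \<Rightarrow> (('x \<times> 'y) \<Rightarrow>\<^sub>0 int) set"
  where "tensor_relators S X Y =
      {frag_of (x \<oplus>\<^bsub>X\<^esub> x', y) - frag_of (x, y) - frag_of (x', y) | x x' y.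
        x \<in> carrier X \<and> x' \<in> carrier X \<and> y \<in> carrier Y}
    \<union> {frag_of (x, y \<oplus>\<^bsub>Y\<^esub> y') - frag_of (x, y) - frag_of (x, y') | x y y'.
        x \<in> carrier X \<and> y \<in> carrier Y \<and> y' \<in> carrier Y}
    \<union> {frag_of (x \<bullet>\<^bsub>X\<^esub> s, y) - frag_of (x, s \<odot>\<^bsub>Y\<^esub> y) | x s y.
        x \<in> carrier X \<and> s \<in> carrier S \<and> y \<in> carrier Y}"

definition tensor_kernel ::
    "('s, 'e) ring_scheme \<Rightarrow> ('r, 's, 'x, 'f) bimodule_scheme \<Rightarrow> ('s, 'y, 'g) module_scheme
      \<Rightarrow> (('x \<times> 'y) \<Rightarrow>\<^sub>0 int) set"
  where "tensor_kernel S X Y =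
    generate (free_Abelian_group (carrier X \<times> carrier Y)) (tensor_relators S X Y)"

definition tensor_class ::
    "('s, 'e) ring_scheme \<Rightarrow> ('r, 's, 'x, 'f) bimodule_scheme \<Rightarrow> ('s, 'y, 'g) module_scheme
      \<Rightarrow> (('x \<times> 'y) \<Rightarrow>\<^sub>0 int) \<Rightarrow> ('x, 'y) tensor"
  where "tensor_class S X Y c =
    tensor_kernel S X Y #>\<^bsub>free_Abelian_group (carrier X \<times> carrier Y)\<^esub> c"

definition pure_tensor ::
    "('s, 'e) ring_scheme \<Rightarrow> ('r, 's, 'x, 'f) bimodule_scheme \<Rightarrow> ('s, 'y, 'g) module_scheme
      \<Rightarrow> 'x \<Rightarrow> 'y \<Rightarrow> ('x, 'y) tensor"
  where "pure_tensor S X Y x y = tensor_class S X Y (frag_of (x, y))"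

text \<open>For an \<open>(R, S)\<close>-bimodule \<open>X\<close> and a left \<open>S\<close>-module \<open>Y\<close>, the left \<open>R\<close>-module \<open>X \<otimes>\<^sub>S Y\<close>.\<close>

definition tensor ::
    "('s, 'e) ring_scheme \<Rightarrow> ('r, 's, 'x, 'f) bimodule_scheme \<Rightarrow> ('s, 'y, 'g) module_scheme
      \<Rightarrow> ('r, ('x, 'y) tensor) module"
  where "tensor S X Y =
    (let G = free_Abelian_group (carrier X \<times> carrier Y) Mod tensor_kernel S X Y in
     \<lparr>carrier = carrier G, mult = undefined, one = undefined,
      zero = \<one>\<^bsub>G\<^esub>, add = mult G,
      smult = (\<lambda>r C. \<Union>c\<in>C. tensor_class S X Y
                (frag_extend (\<lambda>(x, y). frag_of (r \<odot>\<^bsub>X\<^esub> x, y)) c))\<rparr>)"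

text \<open>If \<open>Y\<close> is moreover an \<open>(S, Q)\<close>-bimodule, the \<open>(R, Q)\<close>-bimodule \<open>X \<otimes>\<^sub>S Y\<close>.\<close>

definition bimodule_tensor ::
    "('s, 'e) ring_scheme \<Rightarrow> ('r, 's, 'x, 'f) bimodule_scheme \<Rightarrow> ('s, 'q, 'y, 'g) bimodule_scheme
      \<Rightarrow> ('r, 'q, ('x, 'y) tensor) bimodule"
  where "bimodule_tensor S X Y =
    module.extend (tensor S X Y)
      (bimodule.fields (\<lambda>C q. \<Union>c\<in>C. tensor_class S X Y
                (frag_extend (\<lambda>(x, y). frag_of (x, y \<bullet>\<^bsub>Y\<^esub> q)) c)))"

text \<open>
  The additive map \<open>X \<otimes>\<^sub>S Y \<rightarrow> G\<close> with \<open>x \<otimes> y \<mapsto> \<beta> x y\<close>, for an \<open>S\<close>-balanced biadditive \<open>\<beta>\<close>. It is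
  unique as a function only because it is required to be extensional.
\<close>

definition tensor_lift ::
    "('s, 'e) ring_scheme \<Rightarrow> ('r, 's, 'x, 'f) bimodule_scheme \<Rightarrow> ('s, 'y, 'g) module_scheme
      \<Rightarrow> ('z, 'h) ring_scheme \<Rightarrow> ('x \<Rightarrow> 'y \<Rightarrow> 'z) \<Rightarrow> ('x, 'y) tensor \<Rightarrow> 'z"
  where "tensor_lift S X Y G \<beta> =
    (THE h. h \<in> extensional (carrier (tensor S X Y)) \<and>
            h \<in> hom (add_monoid (tensor S X Y)) (add_monoid G) \<and>
            (\<forall>x\<in>carrier X. \<forall>y\<in>carrier Y. h (pure_tensor S X Y x y) = \<beta> x y))"

text \<open>\<open>h \<otimes> k : X \<otimes>\<^sub>S Y \<rightarrow> X' \<otimes>\<^sub>S Y'\<close>\<close>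

definition tensor_map ::
    "('s, 'e) ring_scheme \<Rightarrow> ('r, 's, 'x, 'f) bimodule_scheme \<Rightarrow> ('s, 'y, 'g) module_scheme
      \<Rightarrow> ('r', 's, 'x', 'f') bimodule_scheme \<Rightarrow> ('s, 'y', 'g') module_scheme
      \<Rightarrow> ('x \<Rightarrow> 'x') \<Rightarrow> ('y \<Rightarrow> 'y') \<Rightarrow> ('x, 'y) tensor \<Rightarrow> ('x', 'y') tensor"
  where "tensor_map S X Y X' Y' h k =
    tensor_lift S X Y (tensor S X' Y') (\<lambda>x y. pure_tensor S X' Y' (h x) (k y))"

text \<open>The associator \<open>(X \<otimes>\<^sub>S Y) \<otimes>\<^sub>Q Z \<rightarrow> X \<otimes>\<^sub>S (Y \<otimes>\<^sub>Q Z)\<close>, \<open>(x \<otimes> y) \<otimes> z \<mapsto> x \<otimes> (y \<otimes> z)\<close>.\<close>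

definition tensor_assoc ::
    "('s, 'e) ring_scheme \<Rightarrow> ('q, 'e') ring_scheme
      \<Rightarrow> ('r, 's, 'x, 'f) bimodule_scheme \<Rightarrow> ('s, 'q, 'y, 'g) bimodule_scheme
      \<Rightarrow> ('q, 'z, 'h) module_scheme
      \<Rightarrow> (('x, 'y) tensor, 'z) tensor \<Rightarrow> ('x, ('y, 'z) tensor) tensor"
  where "tensor_assoc S Q X Y Z =
    tensor_lift Q (bimodule_tensor S X Y) Z (tensor S X (tensor Q Y Z))
      (\<lambda>u z. tensor_lift S X Y (tensor S X (tensor Q Y Z))
        (\<lambda>x y. pure_tensor S X (tensor Q Y Z) x (pure_tensor Q Y Z y z)) u)"


section \<open>Universal localization\<close>

definition sigma_inverting ::
    "('r, 'e) ring_scheme \<Rightarrow> ('r, 'p, 'f) module_scheme \<Rightarrow> ('r, 'q, 'g) module_scheme \<Rightarrow> ('p \<Rightarrow> 'q)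
      \<Rightarrow> ('r', 'e') ring_scheme \<Rightarrow> ('r \<Rightarrow> 'r') \<Rightarrow> bool"
  where "sigma_inverting R P Q \<sigma> R' \<phi> \<longleftrightarrow>
    ring R' \<and> \<phi> \<in> ring_hom R R' \<and>
    tensor_map R (ring_bimodule R' \<phi>) P (ring_bimodule R' \<phi>) Q (\<lambda>x. x) \<sigma>
      \<in> left_module_iso R' (tensor R (ring_bimodule R' \<phi>) P) (tensor R (ring_bimodule R' \<phi>) Q)"

text \<open>
  Initiality among the \<open>\<sigma>\<close>-inverting morphisms whose target ring lives on the type \<open>'s\<close>. A theorem
  in which \<open>'s\<close> is a free type variable therefore asserts initiality without restriction.
\<close>

definition universal_localization ::
    "'s itself \<Rightarrow> ('r, 'e) ring_scheme \<Rightarrow> ('r, 'p, 'f) module_scheme \<Rightarrow> ('r, 'q, 'g) module_scheme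
      \<Rightarrow> ('p \<Rightarrow> 'q) \<Rightarrow> ('r', 'e') ring_scheme \<Rightarrow> ('r \<Rightarrow> 'r') \<Rightarrow> bool"
  where "universal_localization _ R P Q \<sigma> R' \<phi> \<longleftrightarrow>
    sigma_inverting R P Q \<sigma> R' \<phi> \<and>
    (\<forall>(S :: 's ring) \<psi>. sigma_inverting R P Q \<sigma> S \<psi> \<longrightarrow>
      (\<exists>h \<in> ring_hom R' S. (\<forall>r\<in>carrier R. h (\<phi> r) = \<psi> r) \<and>
        (\<forall>h' \<in> ring_hom R' S. (\<forall>r\<in>carrier R. h' (\<phi> r) = \<psi> r) \<longrightarrow>
          (\<forall>x\<in>carrier R'. h' x = h x))))"


section \<open>Triangular matrix rings, their modules, and full 2 by 2 matrix rings\<close>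

text \<open>The triple \<open>(a, m, b)\<close> stands for the matrix with rows \<open>(a m)\<close> and \<open>(0 b)\<close>.\<close>

definition triangular_ring ::
    "('a, 'e) ring_scheme \<Rightarrow> ('b, 'e') ring_scheme \<Rightarrow> ('a, 'b, 'm, 'f) bimodule_scheme
      \<Rightarrow> ('a \<times> 'm \<times> 'b) ring"
  where "triangular_ring A B M =
    \<lparr>carrier = carrier A \<times> carrier M \<times> carrier B,
     mult = (\<lambda>(a, m, b) (a', m', b').
        (a \<otimes>\<^bsub>A\<^esub> a', a \<odot>\<^bsub>M\<^esub> m' \<oplus>\<^bsub>M\<^esub> m \<bullet>\<^bsub>M\<^esub> b', b \<otimes>\<^bsub>B\<^esub> b')),
     one = (\<one>\<^bsub>A\<^esub>, \<zero>\<^bsub>M\<^esub>, \<one>\<^bsub>B\<^esub>),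
     zero = (\<zero>\<^bsub>A\<^esub>, \<zero>\<^bsub>M\<^esub>, \<zero>\<^bsub>B\<^esub>),
     add = (\<lambda>(a, m, b) (a', m', b'). (a \<oplus>\<^bsub>A\<^esub> a', m \<oplus>\<^bsub>M\<^esub> m', b \<oplus>\<^bsub>B\<^esub> b'))\<rparr>"

text \<open>The columns \<open>(A, 0)\<close> and \<open>(M, B)\<close>, as left modules over the triangular ring.\<close>

definition first_column ::
    "('a, 'e) ring_scheme \<Rightarrow> ('b, 'e') ring_scheme \<Rightarrow> ('a \<times> 'm \<times> 'b, 'a \<times> 'b) module"
  where "first_column A B =
    \<lparr>carrier = carrier A \<times> {\<zero>\<^bsub>B\<^esub>}, mult = undefined, one = undefined,
     zero = (\<zero>\<^bsub>A\<^esub>, \<zero>\<^bsub>B\<^esub>),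
     add = (\<lambda>(x, y) (x', y'). (x \<oplus>\<^bsub>A\<^esub> x', y \<oplus>\<^bsub>B\<^esub> y')),
     smult = (\<lambda>(a, m, b) (x, y). (a \<otimes>\<^bsub>A\<^esub> x, b \<otimes>\<^bsub>B\<^esub> y))\<rparr>"

definition second_column ::
    "('b, 'e') ring_scheme \<Rightarrow> ('a, 'b, 'm, 'f) bimodule_scheme
      \<Rightarrow> ('a \<times> 'm \<times> 'b, 'm \<times> 'b) module"
  where "second_column B M =
    \<lparr>carrier = carrier M \<times> carrier B, mult = undefined, one = undefined,
     zero = (\<zero>\<^bsub>M\<^esub>, \<zero>\<^bsub>B\<^esub>),
     add = (\<lambda>(x, y) (x', y'). (x \<oplus>\<^bsub>M\<^esub> x', y \<oplus>\<^bsub>B\<^esub> y')),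
     smult = (\<lambda>(a, m, b) (x, y). (a \<odot>\<^bsub>M\<^esub> x \<oplus>\<^bsub>M\<^esub> m \<bullet>\<^bsub>M\<^esub> y, b \<otimes>\<^bsub>B\<^esub> y))\<rparr>"

text \<open>The left module over the triangular ring given by the triple \<open>(NA, NB, f)\<close>.\<close>

definition triple_module ::
    "('b, 'e) ring_scheme \<Rightarrow> ('a, 'b, 'm, 'f) bimodule_scheme
      \<Rightarrow> ('a, 'x, 'g) module_scheme \<Rightarrow> ('b, 'y, 'h) module_scheme \<Rightarrow> (('m, 'y) tensor \<Rightarrow> 'x)
      \<Rightarrow> ('a \<times> 'm \<times> 'b, 'x \<times> 'y) module"
  where "triple_module B M NA NB f =
    \<lparr>carrier = carrier NA \<times> carrier NB, mult = undefined, one = undefined,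
     zero = (\<zero>\<^bsub>NA\<^esub>, \<zero>\<^bsub>NB\<^esub>),
     add = (\<lambda>(x, y) (x', y'). (x \<oplus>\<^bsub>NA\<^esub> x', y \<oplus>\<^bsub>NB\<^esub> y')),
     smult = (\<lambda>(a, m, b) (x, y).
        (a \<odot>\<^bsub>NA\<^esub> x \<oplus>\<^bsub>NA\<^esub> f (pure_tensor B M NB m y), b \<odot>\<^bsub>NB\<^esub> y))\<rparr>"

text \<open>A 2 by 2 matrix is the pair of its rows.\<close>

type_synonym 't mat2 = "('t \<times> 't) \<times> ('t \<times> 't)"

definition mat2_ring :: "('t, 'e) ring_scheme \<Rightarrow> 't mat2 ring"
  where "mat2_ring T =
    \<lparr>carrier = (carrier T \<times> carrier T) \<times> (carrier T \<times> carrier T),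
     mult = (\<lambda>((a, b), (c, d)) ((a', b'), (c', d')).
        ((a \<otimes>\<^bsub>T\<^esub> a' \<oplus>\<^bsub>T\<^esub> b \<otimes>\<^bsub>T\<^esub> c', a \<otimes>\<^bsub>T\<^esub> b' \<oplus>\<^bsub>T\<^esub> b \<otimes>\<^bsub>T\<^esub> d'),
         (c \<otimes>\<^bsub>T\<^esub> a' \<oplus>\<^bsub>T\<^esub> d \<otimes>\<^bsub>T\<^esub> c', c \<otimes>\<^bsub>T\<^esub> b' \<oplus>\<^bsub>T\<^esub> d \<otimes>\<^bsub>T\<^esub> d'))),
     one = ((\<one>\<^bsub>T\<^esub>, \<zero>\<^bsub>T\<^esub>), (\<zero>\<^bsub>T\<^esub>, \<one>\<^bsub>T\<^esub>)),
     zero = ((\<zero>\<^bsub>T\<^esub>, \<zero>\<^bsub>T\<^esub>), (\<zero>\<^bsub>T\<^esub>, \<zero>\<^bsub>T\<^esub>)),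
     add = (\<lambda>((a, b), (c, d)) ((a', b'), (c', d')).
        ((a \<oplus>\<^bsub>T\<^esub> a', b \<oplus>\<^bsub>T\<^esub> b'), (c \<oplus>\<^bsub>T\<^esub> c', d \<oplus>\<^bsub>T\<^esub> d')))\<rparr>"

text \<open>
  The rows \<open>(T T)\<close> as a bimodule over \<open>T\<close> and \<open>R\<close>, for a ring morphism \<open>\<phi>\<close> from \<open>R\<close> to the matrix ring.
\<close>

definition row_bimodule :: "('t, 'e) ring_scheme \<Rightarrow> ('r \<Rightarrow> 't mat2) \<Rightarrow> ('t, 'r, 't \<times> 't) bimodule"
  where "row_bimodule T \<phi> =
    \<lparr>carrier = carrier T \<times> carrier T, mult = undefined, one = undefined,
     zero = (\<zero>\<^bsub>T\<^esub>, \<zero>\<^bsub>T\<^esub>),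
     add = (\<lambda>(s, t) (s', t'). (s \<oplus>\<^bsub>T\<^esub> s', t \<oplus>\<^bsub>T\<^esub> t')),
     smult = (\<lambda>u (s, t). (u \<otimes>\<^bsub>T\<^esub> s, u \<otimes>\<^bsub>T\<^esub> t)),
     rsmult = (\<lambda>(s, t) r. case \<phi> r of ((a, b), (c, d)) \<Rightarrow>
        (s \<otimes>\<^bsub>T\<^esub> a \<oplus>\<^bsub>T\<^esub> t \<otimes>\<^bsub>T\<^esub> c, s \<otimes>\<^bsub>T\<^esub> b \<oplus>\<^bsub>T\<^esub> t \<otimes>\<^bsub>T\<^esub> d))\<rparr>"

text \<open>The columns with both entries in \<open>L\<close>, as a left module over the matrix ring.\<close>

definition mat2_column :: "('t, 'l, 'e) module_scheme \<Rightarrow> ('t mat2, 'l \<times> 'l) module"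
  where "mat2_column L =
    \<lparr>carrier = carrier L \<times> carrier L, mult = undefined, one = undefined,
     zero = (\<zero>\<^bsub>L\<^esub>, \<zero>\<^bsub>L\<^esub>),
     add = (\<lambda>(x, y) (x', y'). (x \<oplus>\<^bsub>L\<^esub> x', y \<oplus>\<^bsub>L\<^esub> y')),
     smult = (\<lambda>((a, b), (c, d)) (x, y).
        (a \<odot>\<^bsub>L\<^esub> x \<oplus>\<^bsub>L\<^esub> b \<odot>\<^bsub>L\<^esub> y, c \<odot>\<^bsub>L\<^esub> x \<oplus>\<^bsub>L\<^esub> d \<odot>\<^bsub>L\<^esub> y))\<rparr>"


section \<open>The ring \<open>T(M, p)\<close>\<close>

text \<open>
  The free (noncommutative) ring on a set \<open>S\<close>: integer linear combinations of words in \<open>S\<close>,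
  multiplied by bilinear extension of concatenation.
\<close>

definition free_ring :: "'m set \<Rightarrow> ('m list \<Rightarrow>\<^sub>0 int) ring"
  where "free_ring S =
    \<lparr>carrier = {c. Poly_Mapping.keys c \<subseteq> lists S},
     mult = (\<lambda>c d. frag_extend (\<lambda>u. frag_extend (\<lambda>v. frag_of (u @ v)) d) c),
     one = frag_of [], zero = 0, add = (+)\<rparr>"

definition T_relators ::
    "('a, 'e) ring_scheme \<Rightarrow> ('b, 'e') ring_scheme \<Rightarrow> ('a, 'b, 'm, 'f) bimodule_scheme \<Rightarrow> 'm
      \<Rightarrow> ('m list \<Rightarrow>\<^sub>0 int) set"
  where "T_relators A B M p =
      {frag_of [m] + frag_of [m'] - frag_of [m \<oplus>\<^bsub>M\<^esub> m'] | m m'. m \<in> carrier M \<and> m' \<in> carrier M}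
    \<union> {frag_of [a \<odot>\<^bsub>M\<^esub> p, m] - frag_of [a \<odot>\<^bsub>M\<^esub> m] | a m. a \<in> carrier A \<and> m \<in> carrier M}
    \<union> {frag_of [m, p \<bullet>\<^bsub>M\<^esub> b] - frag_of [m \<bullet>\<^bsub>M\<^esub> b] | m b. m \<in> carrier M \<and> b \<in> carrier B}
    \<union> {frag_of [p] - frag_of []}"

definition T_ideal ::
    "('a, 'e) ring_scheme \<Rightarrow> ('b, 'e') ring_scheme \<Rightarrow> ('a, 'b, 'm, 'f) bimodule_scheme \<Rightarrow> 'm
      \<Rightarrow> ('m list \<Rightarrow>\<^sub>0 int) set"
  where "T_ideal A B M p = genideal (free_ring (carrier M)) (T_relators A B M p)"

definition T_ring ::
    "('a, 'e) ring_scheme \<Rightarrow> ('b, 'e') ring_scheme \<Rightarrow> ('a, 'b, 'm, 'f) bimodule_scheme \<Rightarrow> 'm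
      \<Rightarrow> ('m list \<Rightarrow>\<^sub>0 int) set ring"
  where "T_ring A B M p = free_ring (carrier M) Quot T_ideal A B M p"

definition T_gen ::
    "('a, 'e) ring_scheme \<Rightarrow> ('b, 'e') ring_scheme \<Rightarrow> ('a, 'b, 'm, 'f) bimodule_scheme \<Rightarrow> 'm
      \<Rightarrow> 'm \<Rightarrow> ('m list \<Rightarrow>\<^sub>0 int) set"
  where "T_gen A B M p m = T_ideal A B M p +>\<^bsub>free_ring (carrier M)\<^esub> frag_of [m]"

definition rho_A ::
    "('a, 'e) ring_scheme \<Rightarrow> ('b, 'e') ring_scheme \<Rightarrow> ('a, 'b, 'm, 'f) bimodule_scheme \<Rightarrow> 'm
      \<Rightarrow> 'a \<Rightarrow> ('m list \<Rightarrow>\<^sub>0 int) set"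
  where "rho_A A B M p a = T_gen A B M p (a \<odot>\<^bsub>M\<^esub> p)"

definition rho_B ::
    "('a, 'e) ring_scheme \<Rightarrow> ('b, 'e') ring_scheme \<Rightarrow> ('a, 'b, 'm, 'f) bimodule_scheme \<Rightarrow> 'm
      \<Rightarrow> 'b \<Rightarrow> ('m list \<Rightarrow>\<^sub>0 int) set"
  where "rho_B A B M p b = T_gen A B M p (p \<bullet>\<^bsub>M\<^esub> b)"

definition localization_map ::
    "('a, 'e) ring_scheme \<Rightarrow> ('b, 'e') ring_scheme \<Rightarrow> ('a, 'b, 'm, 'f) bimodule_scheme \<Rightarrow> 'm
      \<Rightarrow> 'a \<times> 'm \<times> 'b \<Rightarrow> ('m list \<Rightarrow>\<^sub>0 int) set mat2"
  where "localization_map A B M p = (\<lambda>(a, m, b).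
    ((rho_A A B M p a, T_gen A B M p m), (\<zero>\<^bsub>T_ring A B M p\<^esub>, rho_B A B M p b)))"


section \<open>The cokernel presentation\<close>

text \<open>\<open>g : T \<otimes>\<^sub>A M \<rightarrow> T\<close>, \<open>t \<otimes> m \<mapsto> - t x\<^sub>m\<close>\<close>

definition g_map ::
    "('a, 'e) ring_scheme \<Rightarrow> ('b, 'e') ring_scheme \<Rightarrow> ('a, 'b, 'm, 'f) bimodule_scheme \<Rightarrow> 'm
      \<Rightarrow> (('m list \<Rightarrow>\<^sub>0 int) set, 'm) tensor \<Rightarrow> ('m list \<Rightarrow>\<^sub>0 int) set"
  where "g_map A B M p =
    (let T = T_ring A B M p in
     tensor_lift A (ring_bimodule T (rho_A A B M p)) M T
       (\<lambda>t m. \<ominus>\<^bsub>T\<^esub> (t \<otimes>\<^bsub>T\<^esub> T_gen A B M p m)))"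

text \<open>
  The two components of the map out of \<open>T \<otimes>\<^sub>A M \<otimes>\<^sub>B NB\<close>, which is bracketed to the left, so that
  \<open>1 \<otimes> f\<close> is preceded by the associator.
\<close>

definition presentation_map ::
    "('a, 'e) ring_scheme \<Rightarrow> ('b, 'e') ring_scheme \<Rightarrow> ('a, 'b, 'm, 'h) bimodule_scheme \<Rightarrow> 'm
      \<Rightarrow> ('a, 'x, 'i) module_scheme \<Rightarrow> ('b, 'y, 'j) module_scheme \<Rightarrow> (('m, 'y) tensor \<Rightarrow> 'x)
      \<Rightarrow> ((('m list \<Rightarrow>\<^sub>0 int) set, 'm) tensor, 'y) tensor
      \<Rightarrow> (('m list \<Rightarrow>\<^sub>0 int) set, 'x) tensor \<times> (('m list \<Rightarrow>\<^sub>0 int) set, 'y) tensor"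
  where "presentation_map A B M p NA NB f =
    (let T = T_ring A B M p;
         TA = ring_bimodule T (rho_A A B M p);
         TB = ring_bimodule T (rho_B A B M p);
         one_f = tensor_map A TA (tensor B M NB) TA NA (\<lambda>t. t) f \<circ> tensor_assoc A B TA M NB;
         g_one = tensor_map B (bimodule_tensor A TA M) NB TB NB (g_map A B M p) (\<lambda>y. y)
     in (\<lambda>u. (one_f u, g_one u)))"

end

(*
  A ring morphism \<psi> : R \<rightarrow> S inverts \<sigma> exactly when the image \<pi> of the matrix with single entry p has an
  inverse q between the idempotents \<psi>(e\<^sub>1\<^sub>1) and \<psi>(e\<^sub>2\<^sub>2). These four elements are then matrix units of S,
  and m \<mapsto> \<mu> m q + q \<mu> m, where \<mu> m is the image of the matrix with single entry m, satisfies the relations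
  of T(M, p) and commutes with the matrix units; hence it extends uniquely to M\<^sub>2(T) \<rightarrow> S.

  For the module L, the assignment (s t) \<otimes> (n, n') \<mapsto> (s \<otimes> n, t \<otimes> n') is balanced over R only modulo the
  image of the presentation map: balancing over the entry m identifies (0, s x\<^sub>m \<otimes> n') with
  (s \<otimes> f(m \<otimes> n'), 0). Its inverse sends (s \<otimes> n, t \<otimes> n') to (s 0) \<otimes> (n, 0) + (0 t) \<otimes> (0, n').
*)
theory Submission
  imports Defs
begin

section \<open>Additive maps and linear maps\<close>

text \<open>A ring with 2 by 2 matrix units is the matrix ring over the centralizer of those units.
  This dictates the map out of \<open>T\<close>: with units \<open>\<epsilon>1\<close>,
  \<open>\<pi>\<close>, \<open>q\<close>, \<open>\<epsilon>2\<close>, the corner element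
  \<open>\<mu> m\<close> must be z \<open>\<pi>\<close> for one z in the centralizer; then
  \<open>\<mu> m\<close> times \<open>q\<close> is z \<open>\<epsilon>1\<close>, \<open>q\<close>
  times \<open>\<mu> m\<close> is z \<open>\<epsilon>2\<close>, and their sum is z. The relations of
  \<open>T\<close> become the additivity of \<open>\<mu>\<close>, the two bimodule laws and
  \<open>\<epsilon>1\<close> + \<open>\<epsilon>2\<close> = 1. The element \<open>q\<close> can be
  found because the two columns are the left ideals of \<open>R\<close> generated by its diagonal
  idempotents: extended to \<open>S\<close> they are S \<open>\<epsilon>1\<close> and S
  \<open>\<epsilon>2\<close>, and id tensor \<open>\<sigma>\<close> becomes right multiplication by
  \<open>\<pi>\<close>. In the cokernel part the obstacle is that the inverse would have to be
  defined on cosets. It is kept as a map out of the direct sum, and bijectivity is read off from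
  what that map kills, its image and its composite with the forward map.\<close>

abbreviation additive :: "('a, 'e) ring_scheme \<Rightarrow> ('b, 'f) ring_scheme \<Rightarrow> ('a \<Rightarrow> 'b) set"
  where "additive G H \<equiv> hom (add_monoid G) (add_monoid H)"

lemma additiveI:
  assumes "\<And>x. x \<in> carrier G \<Longrightarrow> h x \<in> carrier H"
    and "\<And>x y. \<lbrakk>x \<in> carrier G; y \<in> carrier G\<rbrakk> \<Longrightarrow> h (x \<oplus>\<^bsub>G\<^esub> y) = h x \<oplus>\<^bsub>H\<^esub> h y"
  shows "h \<in> additive G H"
  using assms by (auto simp: hom_def)

lemma additive_closed: "\<lbrakk>h \<in> additive G H; x \<in> carrier G\<rbrakk> \<Longrightarrow> h x \<in> carrier H"
  by (auto simp: hom_def)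

lemma additive_add:
  "\<lbrakk>h \<in> additive G H; x \<in> carrier G; y \<in> carrier G\<rbrakk> \<Longrightarrow> h (x \<oplus>\<^bsub>G\<^esub> y) = h x \<oplus>\<^bsub>H\<^esub> h y"
  by (auto simp: hom_def)

lemma additive_comp:
  "\<lbrakk>h \<in> additive G H; k \<in> additive H J\<rbrakk> \<Longrightarrow> (\<lambda>x. k (h x)) \<in> additive G J"
  by (simp add: hom_def Pi_iff)

lemma (in abelian_group) add_idem_imp_zero:
  assumes "x \<in> carrier G" "x \<oplus> x = x" shows "x = \<zero>"
  using assms by (metis add.r_cancel_one)

lemma additive_zero:
  assumes "abelian_group G" "abelian_group H" "h \<in> additive G H"
  shows "h \<zero>\<^bsub>G\<^esub> = \<zero>\<^bsub>H\<^esub>"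
proof -
  interpret G: abelian_group G by fact
  interpret H: abelian_group H by fact
  show ?thesis
  proof (rule H.add_idem_imp_zero)
    show "h \<zero>\<^bsub>G\<^esub> \<oplus>\<^bsub>H\<^esub> h \<zero>\<^bsub>G\<^esub> = h \<zero>\<^bsub>G\<^esub>"
      using additive_add[OF assms(3), of "\<zero>\<^bsub>G\<^esub>" "\<zero>\<^bsub>G\<^esub>", symmetric] by simp
  qed (simp add: additive_closed[OF assms(3)])
qed

lemma additive_minus:
  assumes "abelian_group G" "abelian_group H" "h \<in> additive G H" "x \<in> carrier G"
  shows "h (\<ominus>\<^bsub>G\<^esub> x) = \<ominus>\<^bsub>H\<^esub> h x"
proof -
  interpret G: abelian_group G by fact
  interpret H: abelian_group H by fact
  have "h (\<ominus>\<^bsub>G\<^esub> x) \<oplus>\<^bsub>H\<^esub> h x = h (\<ominus>\<^bsub>G\<^esub> x \<oplus>\<^bsub>G\<^esub> x)"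
    using additive_add[OF assms(3), of "\<ominus>\<^bsub>G\<^esub> x" x] assms(4) by simp
  also have "\<dots> = \<zero>\<^bsub>H\<^esub>"
    using additive_zero[OF assms(1,2,3)] assms(4) by (simp add: G.l_neg)
  finally show ?thesis
    using additive_closed[OF assms(3)] assms(4) by (metis G.a_inv_closed H.minus_equality)
qed

lemma left_module_homI:
  assumes "h \<in> additive M N"
    and "\<And>r x. \<lbrakk>r \<in> carrier R; x \<in> carrier M\<rbrakk> \<Longrightarrow> h (r \<odot>\<^bsub>M\<^esub> x) = r \<odot>\<^bsub>N\<^esub> h x"
  shows "h \<in> left_module_hom R M N"
  using assms by (auto simp: left_module_hom_def hom_def)

lemma left_module_hom_additive: "h \<in> left_module_hom R M N \<Longrightarrow> h \<in> additive M N"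
  by (auto simp: left_module_hom_def hom_def)

lemma left_module_hom_smult:
  "\<lbrakk>h \<in> left_module_hom R M N; r \<in> carrier R; x \<in> carrier M\<rbrakk> \<Longrightarrow> h (r \<odot>\<^bsub>M\<^esub> x) = r \<odot>\<^bsub>N\<^esub> h x"
  by (auto simp: left_module_hom_def)

text \<open>The inverse \<open>k\<close> is only asked to be a function between the carriers. In the
  applications it is assembled from additive lifts, and linearity is checked for \<open>h\<close>
  alone.\<close>

lemma left_module_isoI:
  assumes "h \<in> left_module_hom R M N" "k \<in> carrier N \<rightarrow> carrier M"
    and "\<And>x. x \<in> carrier M \<Longrightarrow> k (h x) = x" "\<And>y. y \<in> carrier N \<Longrightarrow> h (k y) = y"
  shows "h \<in> left_module_iso R M N"
proof -
  have "h \<in> carrier M \<rightarrow> carrier N"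
    using assms(1) by (auto simp: left_module_hom_def)
  then have "bij_betw h (carrier M) (carrier N)"
    by (rule bij_betwI[OF _ assms(2-4)])
  then show ?thesis
    using assms(1) by (simp add: left_module_iso_def)
qed

lemma (in left_module) smult_zero [simp]: "a \<in> carrier R \<Longrightarrow> a \<odot>\<^bsub>M\<^esub> \<zero>\<^bsub>M\<^esub> = \<zero>\<^bsub>M\<^esub>"
  by (metis M.add_idem_imp_zero M.r_zero M.zero_closed smult_closed smult_r_distr)

lemma (in left_module) zero_smult [simp]: "x \<in> carrier M \<Longrightarrow> \<zero>\<^bsub>R\<^esub> \<odot>\<^bsub>M\<^esub> x = \<zero>\<^bsub>M\<^esub>"
  by (metis M.add_idem_imp_zero R.r_zero R.zero_closed smult_closed smult_l_distr)

lemma (in right_module) zero_rsmult [simp]: "s \<in> carrier S \<Longrightarrow> \<zero>\<^bsub>M\<^esub> \<bullet>\<^bsub>M\<^esub> s = \<zero>\<^bsub>M\<^esub>"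
  by (metis M.add_idem_imp_zero M.r_zero M.zero_closed rsmult_closed rsmult_l_distr)

lemma (in right_module) rsmult_zero [simp]: "x \<in> carrier M \<Longrightarrow> x \<bullet>\<^bsub>M\<^esub> \<zero>\<^bsub>S\<^esub> = \<zero>\<^bsub>M\<^esub>"
  by (metis M.add_idem_imp_zero S.r_zero S.zero_closed rsmult_closed rsmult_r_distr)


section \<open>Tensor products\<close>

text \<open>Exactly the hypotheses under which a map of two arguments factors through the tensor
  product. Only the carrier and the addition of \<open>G\<close> enter, so \<open>G\<close> may be a
  ring, a module or another tensor product.\<close>

definition balanced ::
    "('s, 'e) ring_scheme \<Rightarrow> ('r, 's, 'x, 'f) bimodule_scheme \<Rightarrow> ('s, 'y, 'g) module_scheme
      \<Rightarrow> ('z, 'h) ring_scheme \<Rightarrow> ('x \<Rightarrow> 'y \<Rightarrow> 'z) \<Rightarrow> bool"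
  where "balanced S X Y G \<beta> \<longleftrightarrow>
    (\<forall>x\<in>carrier X. \<forall>y\<in>carrier Y. \<beta> x y \<in> carrier G) \<and>
    (\<forall>x\<in>carrier X. \<forall>x'\<in>carrier X. \<forall>y\<in>carrier Y. \<beta> (x \<oplus>\<^bsub>X\<^esub> x') y = \<beta> x y \<oplus>\<^bsub>G\<^esub> \<beta> x' y) \<and>
    (\<forall>x\<in>carrier X. \<forall>y\<in>carrier Y. \<forall>y'\<in>carrier Y. \<beta> x (y \<oplus>\<^bsub>Y\<^esub> y') = \<beta> x y \<oplus>\<^bsub>G\<^esub> \<beta> x y') \<and>
    (\<forall>x\<in>carrier X. \<forall>s\<in>carrier S. \<forall>y\<in>carrier Y. \<beta> (x \<bullet>\<^bsub>X\<^esub> s) y = \<beta> x (s \<odot>\<^bsub>Y\<^esub> y))"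

lemma balancedI:
  assumes "\<And>x y. \<lbrakk>x \<in> carrier X; y \<in> carrier Y\<rbrakk> \<Longrightarrow> \<beta> x y \<in> carrier G"
    and "\<And>x x' y. \<lbrakk>x \<in> carrier X; x' \<in> carrier X; y \<in> carrier Y\<rbrakk>
      \<Longrightarrow> \<beta> (x \<oplus>\<^bsub>X\<^esub> x') y = \<beta> x y \<oplus>\<^bsub>G\<^esub> \<beta> x' y"
    and "\<And>x y y'. \<lbrakk>x \<in> carrier X; y \<in> carrier Y; y' \<in> carrier Y\<rbrakk>
      \<Longrightarrow> \<beta> x (y \<oplus>\<^bsub>Y\<^esub> y') = \<beta> x y \<oplus>\<^bsub>G\<^esub> \<beta> x y'"
    and "\<And>x s y. \<lbrakk>x \<in> carrier X; s \<in> carrier S; y \<in> carrier Y\<rbrakk> \<Longrightarrow> \<beta> (x \<bullet>\<^bsub>X\<^esub> s) y = \<beta> x (s \<odot>\<^bsub>Y\<^esub> y)"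
  shows "balanced S X Y G \<beta>"
  using assms by (auto simp: balanced_def)

lemma keys_diff_subset:
  "\<lbrakk>Poly_Mapping.keys a \<subseteq> S; Poly_Mapping.keys b \<subseteq> S\<rbrakk> \<Longrightarrow> Poly_Mapping.keys (a - b) \<subseteq> S"
  using keys_diff[of a b] by blast

lemma keys_add_subset:
  "\<lbrakk>Poly_Mapping.keys a \<subseteq> S; Poly_Mapping.keys b \<subseteq> S\<rbrakk> \<Longrightarrow> Poly_Mapping.keys (a + b) \<subseteq> S"
  using Poly_Mapping.keys_add[of a b] by blast

section \<open>The group underlying a tensor product, its induction rule and its universal
  property\<close>

locale tensor_product =
  fixes S :: "('s, 'e) ring_scheme" and X :: "('r, 's, 'x, 'f) bimodule_scheme"
    and Y :: "('s, 'y, 'g) module_scheme"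
  assumes right: "right_module S X" and left: "left_module S Y"
begin

sublocale X: right_module S X by (rule right)
sublocale Y: left_module S Y by (rule left)

abbreviation "F \<equiv> free_Abelian_group (carrier X \<times> carrier Y)"
abbreviation "K \<equiv> tensor_kernel S X Y"
abbreviation "cls \<equiv> tensor_class S X Y"
abbreviation "XY \<equiv> tensor S X Y"
abbreviation "pt \<equiv> pure_tensor S X Y"

sublocale F: comm_group F
  by (rule abelian_free_Abelian_group)

lemma relators_subset: "tensor_relators S X Y \<subseteq> carrier F"
  unfolding tensor_relators_def
  by (auto intro!: keys_diff_subset simp del: keys_single simp: keys_frag_of dest!: subsetD[OF keys_diff])

lemma relators_in_kernel: "r \<in> tensor_relators S X Y \<Longrightarrow> r \<in> K"
  unfolding tensor_kernel_def by (rule generate.incl)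

lemma subgroup_K: "subgroup K F"
  unfolding tensor_kernel_def by (rule F.generate_is_subgroup[OF relators_subset])

lemma normal_K: "K \<lhd> F"
  by (rule F.subgroup_imp_normal[OF subgroup_K])

lemma tensor_simps:
  "carrier XY = carrier (F Mod K)" "add XY = mult (F Mod K)" "\<zero>\<^bsub>XY\<^esub> = \<one>\<^bsub>F Mod K\<^esub>"
  by (simp_all add: tensor_def Let_def)

lemma abelian_group_tensor: "abelian_group XY"
proof -
  interpret Q: comm_group "F Mod K"
    by (rule F.abelian_FactGroup[OF subgroup_K])
  show ?thesis
    by (rule abelian_groupI; unfold tensor_simps)
       (rule Q.m_closed Q.one_closed Q.m_assoc Q.m_comm Q.l_one Q.l_inv_ex; assumption)+
qed

lemma additive_tensor: "additive XY G = hom (F Mod K) (add_monoid G)"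
  by (simp add: hom_def tensor_simps del: mult_FactGroup)

sublocale XY: abelian_group XY
  by (rule abelian_group_tensor)

lemma class_eqI:
  assumes "c \<in> carrier F" "d \<in> carrier F" "c - d \<in> K"
  shows "cls c = cls d"
proof -
  have "c = (c - d) \<otimes>\<^bsub>F\<^esub> d" by simp
  then have "c \<in> K #>\<^bsub>F\<^esub> d"
    using assms(3) unfolding r_coset_def by blast
  then show ?thesis
    unfolding tensor_class_def using F.repr_independence[OF _ assms(2) subgroup_K] by metis
qed

lemma class_closed: "c \<in> carrier F \<Longrightarrow> cls c \<in> carrier XY"
  by (auto simp: tensor_def Let_def FactGroup_def RCOSETS_def tensor_class_def)

lemma class_cases:
  assumes "u \<in> carrier XY" obtains c where "c \<in> carrier F" "u = cls c"
  using assms by (auto simp: tensor_def Let_def FactGroup_def RCOSETS_def tensor_class_def)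

lemma class_add: "\<lbrakk>c \<in> carrier F; d \<in> carrier F\<rbrakk> \<Longrightarrow> cls (c + d) = cls c \<oplus>\<^bsub>XY\<^esub> cls d"
  using normal.rcos_sum[OF normal_K, of c d]
  by (simp add: tensor_def Let_def FactGroup_def tensor_class_def)

lemma class_zero: "cls 0 = \<zero>\<^bsub>XY\<^esub>"
proof (rule XY.add_idem_imp_zero)
  show "cls 0 \<in> carrier XY"
    by (rule class_closed) simp
  show "cls 0 \<oplus>\<^bsub>XY\<^esub> cls 0 = cls 0"
    by (subst class_add[symmetric]) auto
qed

lemma class_diff:
  assumes "c \<in> carrier F" "d \<in> carrier F" shows "cls (c - d) = cls c \<ominus>\<^bsub>XY\<^esub> cls d"
proof -
  have cd: "c - d \<in> carrier F"
    using assms by (simp add: keys_diff_subset)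
  have "cls c = cls (c - d) \<oplus>\<^bsub>XY\<^esub> cls d"
    using class_add[OF cd assms(2)] by simp
  then show ?thesis
    using class_closed[OF cd] class_closed[OF assms(2)]
    by (simp add: XY.minus_eq XY.a_assoc XY.r_neg)
qed

lemma pure_closed [simp, intro]: "\<lbrakk>x \<in> carrier X; y \<in> carrier Y\<rbrakk> \<Longrightarrow> pt x y \<in> carrier XY"
  unfolding pure_tensor_def by (rule class_closed) simp

lemma balanced_pure: "balanced S X Y XY pt"
proof (rule balancedI)
  fix x x' y assume *: "x \<in> carrier X" "x' \<in> carrier X" "y \<in> carrier Y"
  have "frag_of (x \<oplus>\<^bsub>X\<^esub> x', y) - (frag_of (x, y) + frag_of (x', y)) \<in> K"
    using * by (intro relators_in_kernel) (force simp: tensor_relators_def diff_diff_eq)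
  then show "pt (x \<oplus>\<^bsub>X\<^esub> x') y = pt x y \<oplus>\<^bsub>XY\<^esub> pt x' y"
    unfolding pure_tensor_def using *
    by (subst class_add[symmetric]) (simp_all add: class_eqI keys_add_subset)
next
  fix x y y' assume *: "x \<in> carrier X" "y \<in> carrier Y" "y' \<in> carrier Y"
  have "frag_of (x, y \<oplus>\<^bsub>Y\<^esub> y') - (frag_of (x, y) + frag_of (x, y')) \<in> K"
    using * by (intro relators_in_kernel) (force simp: tensor_relators_def diff_diff_eq)
  then show "pt x (y \<oplus>\<^bsub>Y\<^esub> y') = pt x y \<oplus>\<^bsub>XY\<^esub> pt x y'"
    unfolding pure_tensor_def using *
    by (subst class_add[symmetric]) (simp_all add: class_eqI keys_add_subset)
next
  fix x s y assume *: "x \<in> carrier X" "s \<in> carrier S" "y \<in> carrier Y"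
  have "frag_of (x \<bullet>\<^bsub>X\<^esub> s, y) - frag_of (x, s \<odot>\<^bsub>Y\<^esub> y) \<in> K"
    using * by (intro relators_in_kernel) (force simp: tensor_relators_def)
  then show "pt (x \<bullet>\<^bsub>X\<^esub> s) y = pt x (s \<odot>\<^bsub>Y\<^esub> y)"
    unfolding pure_tensor_def using * by (simp add: class_eqI)
qed auto

lemma pure_add_left:
    "\<lbrakk>x \<in> carrier X; x' \<in> carrier X; y \<in> carrier Y\<rbrakk> \<Longrightarrow> pt (x \<oplus>\<^bsub>X\<^esub> x') y = pt x y \<oplus>\<^bsub>XY\<^esub> pt x' y"
  and pure_add_right:
    "\<lbrakk>x \<in> carrier X; y \<in> carrier Y; y' \<in> carrier Y\<rbrakk> \<Longrightarrow> pt x (y \<oplus>\<^bsub>Y\<^esub> y') = pt x y \<oplus>\<^bsub>XY\<^esub> pt x y'"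
  and pure_balanced:
    "\<lbrakk>x \<in> carrier X; s \<in> carrier S; y \<in> carrier Y\<rbrakk> \<Longrightarrow> pt (x \<bullet>\<^bsub>X\<^esub> s) y = pt x (s \<odot>\<^bsub>Y\<^esub> y)"
  using balanced_pure by (auto simp: balanced_def)

lemma additive_pure_left: "y \<in> carrier Y \<Longrightarrow> (\<lambda>x. pt x y) \<in> additive X XY"
  by (rule additiveI) (auto simp: pure_add_left)

lemmas pure_zero_left = additive_zero[OF X.abelian_group_axioms XY.abelian_group_axioms additive_pure_left]
lemmas pure_minus_left = additive_minus[OF X.abelian_group_axioms XY.abelian_group_axioms additive_pure_left]

text \<open>Closure under sums suffices: zero is the pure tensor of two zeros, and the negative of a
  pure tensor is again pure, because the sign can be moved into the left factor.\<close>

lemma tensor_induct [consumes 1, case_names pure add]: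
  assumes u: "u \<in> carrier XY"
    and pure: "\<And>x y. \<lbrakk>x \<in> carrier X; y \<in> carrier Y\<rbrakk> \<Longrightarrow> P (pt x y)"
    and add: "\<And>u v. \<lbrakk>u \<in> carrier XY; v \<in> carrier XY; P u; P v\<rbrakk> \<Longrightarrow> P (u \<oplus>\<^bsub>XY\<^esub> v)"
  shows "P u"
proof -
  obtain c where c: "Poly_Mapping.keys c \<subseteq> carrier X \<times> carrier Y" "u = cls c"
    using class_cases[OF u] by auto
  \<comment> \<open>The claim is strengthened to negatives because induction on the free abelian
    group proceeds by differences, whereas \<open>P\<close> is only known to pass to sums.\<close>
  have "P (cls c) \<and> P (\<ominus>\<^bsub>XY\<^esub> cls c)"
    using c(1)
  proof (induction c rule: free_Abelian_group_induct[consumes 1])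
    case 1
    have "P \<zero>\<^bsub>XY\<^esub>"
      using pure[of "\<zero>\<^bsub>X\<^esub>" "\<zero>\<^bsub>Y\<^esub>"] by (simp add: pure_zero_left)
    moreover have "\<ominus>\<^bsub>XY\<^esub> \<zero>\<^bsub>XY\<^esub> = \<zero>\<^bsub>XY\<^esub>"
      by (rule XY.minus_equality) simp_all
    ultimately show ?case
      by (simp only: class_zero simp_thms)
  next
    case (2 c d)
    then have "cls c \<in> carrier XY" "cls d \<in> carrier XY" "cls (c - d) = cls c \<ominus>\<^bsub>XY\<^esub> cls d"
      by (simp_all add: class_closed class_diff)
    then show ?case
      using 2 add[of "cls c" "\<ominus>\<^bsub>XY\<^esub> cls d"] add[of "cls d" "\<ominus>\<^bsub>XY\<^esub> cls c"]
      by (simp add: XY.minus_eq XY.minus_add XY.a_comm)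
  next
    case (3 z)
    then obtain x y where z: "z = (x, y)" "x \<in> carrier X" "y \<in> carrier Y" by auto
    then show ?case
      using pure[of x y] pure[of "\<ominus>\<^bsub>X\<^esub> x" y] by (simp add: pure_tensor_def[symmetric] pure_minus_left)
  qed
  then show ?thesis using c(2) by simp
qed

text \<open>The uniqueness half of the universal property, and the standard way below to prove an
  identity between additive maps. \<open>G\<close> may be any additive structure, since the
  induction behind it forms sums only.\<close>

lemma tensor_hom_eqI:
  assumes "h \<in> additive XY G" "h' \<in> additive XY G"
    and "\<And>x y. \<lbrakk>x \<in> carrier X; y \<in> carrier Y\<rbrakk> \<Longrightarrow> h (pt x y) = h' (pt x y)"
    and "u \<in> carrier XY"
  shows "h u = h' u"
  using assms(4) by (induction u rule: tensor_induct) (auto simp: assms additive_add[OF assms(1)] additive_add[OF assms(2)])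

text \<open>Extend \<open>\<beta>\<close> linearly to the free abelian group. The three kinds of
  relators lie in the kernel by the three identities that define balance, so the extension factors
  through the quotient by \<open>K\<close>.\<close>

lemma tensor_lift_exists:
  assumes G: "abelian_group G" and \<beta>: "balanced S X Y G \<beta>"
  obtains h where "h \<in> additive XY G" "\<And>x y. \<lbrakk>x \<in> carrier X; y \<in> carrier Y\<rbrakk> \<Longrightarrow> h (pt x y) = \<beta> x y"
proof -
  interpret G: abelian_group G by fact
  have "case_prod \<beta> ` (carrier X \<times> carrier Y) \<subseteq> carrier (add_monoid G)"
    using \<beta> by (auto simp: balanced_def)
  then obtain h where h: "h \<in> hom F (add_monoid G)"
      and h_of: "\<And>z. z \<in> carrier X \<times> carrier Y \<Longrightarrow> h (frag_of z) = case_prod \<beta> z"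
    using comm_group.free_Abelian_group_universal[OF G.a_comm_group] by metis
  interpret h: group_hom F "add_monoid G" h
    using h by unfold_locales
  have h_diff: "h (c - d) = h c \<oplus>\<^bsub>G\<^esub> \<ominus>\<^bsub>G\<^esub> h d" if "c \<in> carrier F" "d \<in> carrier F" for c d
  proof -
    have "h (c \<otimes>\<^bsub>F\<^esub> inv\<^bsub>F\<^esub> d) = h c \<oplus>\<^bsub>G\<^esub> \<ominus>\<^bsub>G\<^esub> h d"
      using that h.hom_mult[of c "inv\<^bsub>F\<^esub> d"] h.hom_inv[of d] by (simp add: a_inv_def del: carrier_free_Abelian_group_iff mult_free_Abelian_group inv_free_Abelian_group)
    then show ?thesis using that by simp
  qed
  have "tensor_relators S X Y \<subseteq> kernel F (add_monoid G) h"
  proof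
    fix r assume r: "r \<in> tensor_relators S X Y"
    have "h r = \<zero>\<^bsub>G\<^esub>"
    proof -
      consider x x' y where "x \<in> carrier X" "x' \<in> carrier X" "y \<in> carrier Y"
          "r = frag_of (x \<oplus>\<^bsub>X\<^esub> x', y) - frag_of (x, y) - frag_of (x', y)"
        | x y y' where "x \<in> carrier X" "y \<in> carrier Y" "y' \<in> carrier Y"
          "r = frag_of (x, y \<oplus>\<^bsub>Y\<^esub> y') - frag_of (x, y) - frag_of (x, y')"
        | x s y where "x \<in> carrier X" "s \<in> carrier S" "y \<in> carrier Y"
          "r = frag_of (x \<bullet>\<^bsub>X\<^esub> s, y) - frag_of (x, s \<odot>\<^bsub>Y\<^esub> y)"
        using r by (auto simp: tensor_relators_def)
      then show ?thesis
      proof cases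
        case 1
        then have "h r = (\<beta> x y \<oplus>\<^bsub>G\<^esub> \<beta> x' y) \<oplus>\<^bsub>G\<^esub> \<ominus>\<^bsub>G\<^esub> \<beta> x y \<oplus>\<^bsub>G\<^esub> \<ominus>\<^bsub>G\<^esub> \<beta> x' y"
          using \<beta> by (simp add: h_diff h_of keys_diff_subset balanced_def)
        moreover have "\<beta> x y \<in> carrier G" "\<beta> x' y \<in> carrier G"
          using 1 \<beta> by (auto simp: balanced_def)
        ultimately show ?thesis
          by (simp add: G.a_ac G.r_neg G.r_neg1 G.r_neg2)
      next
        case 2
        then have "h r = (\<beta> x y \<oplus>\<^bsub>G\<^esub> \<beta> x y') \<oplus>\<^bsub>G\<^esub> \<ominus>\<^bsub>G\<^esub> \<beta> x y \<oplus>\<^bsub>G\<^esub> \<ominus>\<^bsub>G\<^esub> \<beta> x y'"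
          using \<beta> by (simp add: h_diff h_of keys_diff_subset balanced_def)
        moreover have "\<beta> x y \<in> carrier G" "\<beta> x y' \<in> carrier G"
          using 2 \<beta> by (auto simp: balanced_def)
        ultimately show ?thesis
          by (simp add: G.a_ac G.r_neg G.r_neg1 G.r_neg2)
      next
        case 3
        then show ?thesis
          using \<beta> by (simp add: h_diff h_of balanced_def G.r_neg)
      qed
    qed
    then show "r \<in> kernel F (add_monoid G) h"
      using subsetD[OF relators_subset r] by (simp add: kernel_def)
  qed
  then have K: "K \<subseteq> kernel F (add_monoid G) h"
    unfolding tensor_kernel_def by (rule F.generate_subgroup_incl[OF _ h.subgroup_kernel])
  \<comment> \<open>Equal cosets have representatives that differ by an element of \<open>K\<close>,
    hence of the kernel; this is the condition for factoring through the quotient group.\<close>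
  have "h c = h d" if "c \<in> carrier F" "d \<in> carrier F" "K #>\<^bsub>F\<^esub> c = K #>\<^bsub>F\<^esub> d" for c d
  proof -
    have "c \<in> K #>\<^bsub>F\<^esub> d"
      using that F.rcos_self[OF that(1) subgroup_K] by simp
    then obtain k where "k \<in> K" "c = k \<otimes>\<^bsub>F\<^esub> d"
      by (auto simp: r_coset_def)
    then show ?thesis
      using K that(2) h.hom_mult[of k d] additive_closed h.hom_closed[OF that(2)] by (auto simp: kernel_def)
  qed
  then obtain g where "g \<in> hom (F Mod K) (add_monoid G)" "\<And>c. c \<in> carrier F \<Longrightarrow> g (K #>\<^bsub>F\<^esub> c) = h c"
    using FactGroup_universal[OF h normal_K] by metis
  then show thesis
    using that[of g] h_of by (simp add: additive_tensor pure_tensor_def tensor_class_def)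
qed

text \<open>The definite description denotes: an additive map exists by the previous lemma, and once
  it is restricted to the carrier it is the only extensional one, because additive maps are
  determined by pure tensors.\<close>

lemma tensor_lift_spec:
  assumes "abelian_group G" "balanced S X Y G \<beta>"
  shows tensor_lift_additive: "tensor_lift S X Y G \<beta> \<in> additive XY G"
    and tensor_lift_pure: "\<lbrakk>x \<in> carrier X; y \<in> carrier Y\<rbrakk> \<Longrightarrow> tensor_lift S X Y G \<beta> (pt x y) = \<beta> x y"
proof -
  let ?P = "\<lambda>h. h \<in> extensional (carrier XY) \<and> h \<in> additive XY G \<and>
            (\<forall>x\<in>carrier X. \<forall>y\<in>carrier Y. h (pt x y) = \<beta> x y)"
  obtain h where h: "h \<in> additive XY G" "\<And>x y. \<lbrakk>x \<in> carrier X; y \<in> carrier Y\<rbrakk> \<Longrightarrow> h (pt x y) = \<beta> x y"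
    using tensor_lift_exists[OF assms] by metis
  have P: "?P (restrict h (carrier XY))"
    using h by (auto simp: hom_def)
  have "k = k'" if "?P k" "?P k'" for k k'
    using that tensor_hom_eqI[of k G k'] by (intro extensionalityI[of k "carrier XY"]) auto
  then have "?P (THE h. ?P h)"
    using P by (intro theI[of ?P, OF P]) blast
  then show "tensor_lift S X Y G \<beta> \<in> additive XY G"
    "\<lbrakk>x \<in> carrier X; y \<in> carrier Y\<rbrakk> \<Longrightarrow> tensor_lift S X Y G \<beta> (pt x y) = \<beta> x y"
    unfolding tensor_lift_def by auto
qed

text \<open>Scalars act on a coset through the union over all its representatives. If the linear
  extension of \<open>\<gamma>\<close> sends relators into \<open>K\<close>, all representatives
  yield one and the same coset, and the union collapses to it. Left and right actions are both
  instances.\<close>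

lemma class_map:
  assumes G: "\<And>z. z \<in> carrier X \<times> carrier Y \<Longrightarrow> \<gamma> z \<in> carrier F"
    and rel: "\<And>r. r \<in> tensor_relators S X Y \<Longrightarrow> frag_extend \<gamma> r \<in> K"
    and c: "c \<in> carrier F"
  shows "(\<Union>d\<in>cls c. cls (frag_extend \<gamma> d)) = cls (frag_extend \<gamma> c)"
proof -
  have closed: "frag_extend \<gamma> d \<in> carrier F" if "d \<in> carrier F" for d
  proof -
    have "Poly_Mapping.keys (\<gamma> z) \<subseteq> carrier X \<times> carrier Y" if "z \<in> Poly_Mapping.keys d" for z
      using G[of z] that \<open>d \<in> carrier F\<close> by auto
    then show ?thesis
      using keys_frag_extend[of \<gamma> d] unfolding carrier_free_Abelian_group_iff by (meson UN_least order_trans)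
  qed
  have ker: "frag_extend \<gamma> k \<in> K" if "k \<in> K" for k
    using that unfolding tensor_kernel_def
  proof (induction rule: generate.induct)
    case (inv r)
    then have "r \<in> carrier F" "frag_extend \<gamma> r \<in> K"
      using relators_subset rel by blast+
    then show ?case
      using subgroup.m_inv_closed[OF subgroup_K, of "frag_extend \<gamma> r"] closed[of r]
      by (simp add: frag_extend_minus tensor_kernel_def)
  next
    case (eng k k')
    then show ?case
      using subgroup.m_closed[OF subgroup_K, of "frag_extend \<gamma> k" "frag_extend \<gamma> k'"]
      by (simp add: frag_extend_add tensor_kernel_def)
  qed (use rel subgroup.one_closed[OF subgroup_K] in \<open>auto simp: tensor_kernel_def\<close>)
  have "cls (frag_extend \<gamma> d) = cls (frag_extend \<gamma> c)" if d: "d \<in> cls c" for d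
  proof -
    obtain k where k: "k \<in> K" "d = k + c"
      using d by (auto simp: tensor_class_def r_coset_def)
    then have "frag_extend \<gamma> d - frag_extend \<gamma> c \<in> K"
      using ker by (simp add: frag_extend_add)
    moreover have "d \<in> carrier F"
      using F.m_closed[OF subsetD[OF subgroup.subset[OF subgroup_K] k(1)] c] k(2) by simp
    ultimately show ?thesis
      using c by (intro class_eqI closed)
  qed
  moreover have "c \<in> cls c"
    unfolding tensor_class_def by (rule F.rcos_self[OF c subgroup_K])
  ultimately show ?thesis by blast
qed

end

section \<open>The left module structure on a tensor product\<close>

locale bimodule_tensor_product = tensor_product S X Y
  for S :: "('s, 'e) ring_scheme" and X :: "('r, 's, 'x, 'f) bimodule_scheme"
    and Y :: "('s, 'y, 'g) module_scheme" +
  fixes R :: "('r, 'e2) ring_scheme"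
  assumes bimod: "bimodule R S X"
begin

sublocale X: bimodule R S X by (rule bimod)

text \<open>Acting on the left factor turns each relator into a relator of the same kind; for the
  third kind this is the commutation of the two actions on \<open>X\<close>.\<close>

lemma tensor_smult_class:
  assumes "r \<in> carrier R" "c \<in> carrier F"
  shows "r \<odot>\<^bsub>XY\<^esub> cls c = cls (frag_extend (\<lambda>(x, y). frag_of (r \<odot>\<^bsub>X\<^esub> x, y)) c)"
proof -
  have rel: "frag_extend (\<lambda>(x, y). frag_of (r \<odot>\<^bsub>X\<^esub> x, y)) d \<in> tensor_relators S X Y"
    if d: "d \<in> tensor_relators S X Y" for d
  proof -
    consider x x' y where "x \<in> carrier X" "x' \<in> carrier X" "y \<in> carrier Y"
        "d = frag_of (x \<oplus>\<^bsub>X\<^esub> x', y) - frag_of (x, y) - frag_of (x', y)"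
      | x y y' where "x \<in> carrier X" "y \<in> carrier Y" "y' \<in> carrier Y"
        "d = frag_of (x, y \<oplus>\<^bsub>Y\<^esub> y') - frag_of (x, y) - frag_of (x, y')"
      | x s y where "x \<in> carrier X" "s \<in> carrier S" "y \<in> carrier Y"
        "d = frag_of (x \<bullet>\<^bsub>X\<^esub> s, y) - frag_of (x, s \<odot>\<^bsub>Y\<^esub> y)"
      using d by (auto simp: tensor_relators_def)
    then show ?thesis
    proof cases
      case 1
      then have "r \<odot>\<^bsub>X\<^esub> x \<in> carrier X" "r \<odot>\<^bsub>X\<^esub> x' \<in> carrier X"
        using assms(1) by auto
      then show ?thesis
        using 1 assms(1) unfolding tensor_relators_def
        by (simp add: frag_extend_diff X.smult_r_distr) blast
    next
      case 2
      then have "r \<odot>\<^bsub>X\<^esub> x \<in> carrier X"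
        using assms(1) by auto
      then show ?thesis
        using 2 unfolding tensor_relators_def by (simp add: frag_extend_diff) blast
    next
      case 3
      then have "r \<odot>\<^bsub>X\<^esub> x \<in> carrier X" "r \<odot>\<^bsub>X\<^esub> (x \<bullet>\<^bsub>X\<^esub> s) = (r \<odot>\<^bsub>X\<^esub> x) \<bullet>\<^bsub>X\<^esub> s"
        using assms(1) by (auto simp: X.smult_rsmult)
      then show ?thesis
        using 3 unfolding tensor_relators_def by (simp add: frag_extend_diff) blast
    qed
  qed
  have "r \<odot>\<^bsub>XY\<^esub> cls c = (\<Union>d\<in>cls c. cls (frag_extend (\<lambda>(x, y). frag_of (r \<odot>\<^bsub>X\<^esub> x, y)) d))"
    by (simp add: tensor_def Let_def)
  also have "\<dots> = cls (frag_extend (\<lambda>(x, y). frag_of (r \<odot>\<^bsub>X\<^esub> x, y)) c)"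
    by (rule class_map) (use assms rel relators_in_kernel in auto)
  finally show ?thesis .
qed

lemma tensor_smult_additive:
  assumes "r \<in> carrier R" shows "(\<lambda>u. r \<odot>\<^bsub>XY\<^esub> u) \<in> additive XY XY"
proof -
  let ?\<gamma> = "frag_extend (\<lambda>(x, y). frag_of (r \<odot>\<^bsub>X\<^esub> x, y))"
  have closed: "?\<gamma> c \<in> carrier F" if "c \<in> carrier F" for c
  proof -
    have "Poly_Mapping.keys ((\<lambda>(x, y). frag_of (r \<odot>\<^bsub>X\<^esub> x, y)) z) \<subseteq> carrier X \<times> carrier Y"
      if "z \<in> Poly_Mapping.keys c" for z
      using that \<open>c \<in> carrier F\<close> assms by (auto split: prod.splits)
    then show ?thesis
      unfolding carrier_free_Abelian_group_iff by (intro order_trans[OF keys_frag_extend] UN_least)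
  qed
  show ?thesis
  proof (rule additiveI)
    fix u assume "u \<in> carrier XY"
    then obtain c where "c \<in> carrier F" "u = cls c" by (rule class_cases)
    then show "r \<odot>\<^bsub>XY\<^esub> u \<in> carrier XY"
      using class_closed[OF closed] by (simp add: tensor_smult_class[OF assms] del: carrier_free_Abelian_group_iff)
  next
    fix u v assume "u \<in> carrier XY" "v \<in> carrier XY"
    then obtain c d where cd: "c \<in> carrier F" "u = cls c" "d \<in> carrier F" "v = cls d"
      by (metis class_cases)
    then have "r \<odot>\<^bsub>XY\<^esub> cls (c + d) = r \<odot>\<^bsub>XY\<^esub> cls c \<oplus>\<^bsub>XY\<^esub> r \<odot>\<^bsub>XY\<^esub> cls d"
      using F.m_closed[of c d] unfolding tensor_smult_class[OF assms cd(1)] tensor_smult_class[OF assms cd(3)]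
      by (subst tensor_smult_class[OF assms]) (simp_all only: mult_free_Abelian_group frag_extend_add class_add closed)
    then show "r \<odot>\<^bsub>XY\<^esub> (u \<oplus>\<^bsub>XY\<^esub> v) = r \<odot>\<^bsub>XY\<^esub> u \<oplus>\<^bsub>XY\<^esub> r \<odot>\<^bsub>XY\<^esub> v"
      using cd by (simp add: class_add del: carrier_free_Abelian_group_iff)
  qed
qed

lemma tensor_smult_pure:
  "\<lbrakk>r \<in> carrier R; x \<in> carrier X; y \<in> carrier Y\<rbrakk> \<Longrightarrow> r \<odot>\<^bsub>XY\<^esub> pt x y = pt (r \<odot>\<^bsub>X\<^esub> x) y"
  unfolding pure_tensor_def by (subst tensor_smult_class) auto

text \<open>Closure and additivity in \<open>u\<close> hold because each scalar acts by an additive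
  map. In the other laws both sides are additive in \<open>u\<close>, so pure tensors suffice, where
  the law is the corresponding one in \<open>X\<close>.\<close>

lemma left_module_tensor: "left_module R XY"
proof (intro left_module.intro left_module_axioms.intro)
  fix a u assume "a \<in> carrier R" "u \<in> carrier XY"
  then show "a \<odot>\<^bsub>XY\<^esub> u \<in> carrier XY"
    by (rule additive_closed[OF tensor_smult_additive])
next
  fix a u v assume "a \<in> carrier R" "u \<in> carrier XY" "v \<in> carrier XY"
  then show "a \<odot>\<^bsub>XY\<^esub> (u \<oplus>\<^bsub>XY\<^esub> v) = a \<odot>\<^bsub>XY\<^esub> u \<oplus>\<^bsub>XY\<^esub> a \<odot>\<^bsub>XY\<^esub> v"
    by (rule additive_add[OF tensor_smult_additive])
next
  fix a b u assume ab: "a \<in> carrier R" "b \<in> carrier R" and u: "u \<in> carrier XY"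
  have "(\<lambda>u. a \<odot>\<^bsub>XY\<^esub> u \<oplus>\<^bsub>XY\<^esub> b \<odot>\<^bsub>XY\<^esub> u) \<in> additive XY XY"
    using ab by (intro additiveI)
      (simp_all add: additive_closed[OF tensor_smult_additive] additive_add[OF tensor_smult_additive] XY.a_ac)
  from tensor_hom_eqI[OF tensor_smult_additive this _ u]
  show "(a \<oplus>\<^bsub>R\<^esub> b) \<odot>\<^bsub>XY\<^esub> u = a \<odot>\<^bsub>XY\<^esub> u \<oplus>\<^bsub>XY\<^esub> b \<odot>\<^bsub>XY\<^esub> u"
    using ab by (simp add: tensor_smult_pure X.smult_l_distr pure_add_left)
  from tensor_hom_eqI[OF tensor_smult_additive additive_comp[OF tensor_smult_additive tensor_smult_additive] _ u]
  show "(a \<otimes>\<^bsub>R\<^esub> b) \<odot>\<^bsub>XY\<^esub> u = a \<odot>\<^bsub>XY\<^esub> (b \<odot>\<^bsub>XY\<^esub> u)"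
    using ab by (simp add: tensor_smult_pure X.smult_assoc)
next
  fix u assume u: "u \<in> carrier XY"
  have "(\<lambda>u. u) \<in> additive XY XY" by (rule additiveI) auto
  from tensor_hom_eqI[OF tensor_smult_additive this _ u]
  show "\<one>\<^bsub>R\<^esub> \<odot>\<^bsub>XY\<^esub> u = u"
    by (simp add: tensor_smult_pure)
qed (rule X.R.ring_axioms XY.abelian_group_axioms)+

sublocale XY: left_module R XY
  by (rule left_module_tensor)

lemma tensor_lift_linear:
  assumes G: "left_module R G" and \<beta>: "balanced S X Y G \<beta>"
    and lin: "\<And>r x y. \<lbrakk>r \<in> carrier R; x \<in> carrier X; y \<in> carrier Y\<rbrakk> \<Longrightarrow> \<beta> (r \<odot>\<^bsub>X\<^esub> x) y = r \<odot>\<^bsub>G\<^esub> \<beta> x y"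
  shows "tensor_lift S X Y G \<beta> \<in> left_module_hom R XY G"
proof (rule left_module_homI)
  interpret G: left_module R G by fact
  note add = tensor_lift_additive[OF G.M.abelian_group_axioms \<beta>]
  show "tensor_lift S X Y G \<beta> \<in> additive XY G" by (rule add)
  fix r u assume r: "r \<in> carrier R" and u: "u \<in> carrier XY"
  have "(\<lambda>v. r \<odot>\<^bsub>G\<^esub> tensor_lift S X Y G \<beta> v) \<in> additive XY G"
    using r by (intro additiveI) (simp_all add: additive_closed[OF add] additive_add[OF add] G.smult_r_distr)
  from tensor_hom_eqI[OF additive_comp[OF tensor_smult_additive[OF r] add] this _ u]
  show "tensor_lift S X Y G \<beta> (r \<odot>\<^bsub>XY\<^esub> u) = r \<odot>\<^bsub>G\<^esub> tensor_lift S X Y G \<beta> u"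
    using r by (simp add: tensor_smult_pure tensor_lift_pure[OF G.M.abelian_group_axioms \<beta>] lin)
qed

end

section \<open>The right action on a tensor product with a bimodule\<close>

locale bitensor_product = bimodule_tensor_product S X Y R
  for S :: "('s, 'e) ring_scheme" and X :: "('r, 's, 'x, 'f) bimodule_scheme"
    and Y :: "('s, 'q, 'y, 'g) bimodule_scheme" and R :: "('r, 'e2) ring_scheme" +
  fixes Q :: "('q, 'e3) ring_scheme"
  assumes bimod_Y: "bimodule S Q Y"
begin

sublocale Y: bimodule S Q Y by (rule bimod_Y)

abbreviation "XYQ \<equiv> bimodule_tensor S X Y"

lemma bitensor_simps [simp]:
  "carrier XYQ = carrier XY" "add XYQ = add XY" "zero XYQ = zero XY" "smult XYQ = smult XY"
  by (simp_all add: bimodule_tensor_def module.defs bimodule.defs)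

text \<open>Relators are again sent to relators of the same kind, now because the right action on
  \<open>Y\<close> is additive and commutes with the left action of \<open>S\<close>.\<close>

lemma bitensor_rsmult_class:
  assumes "q \<in> carrier Q" "c \<in> carrier F"
  shows "cls c \<bullet>\<^bsub>XYQ\<^esub> q = cls (frag_extend (\<lambda>(x, y). frag_of (x, y \<bullet>\<^bsub>Y\<^esub> q)) c)"
proof -
  have rel: "frag_extend (\<lambda>(x, y). frag_of (x, y \<bullet>\<^bsub>Y\<^esub> q)) d \<in> tensor_relators S X Y"
    if d: "d \<in> tensor_relators S X Y" for d
  proof -
    consider x x' y where "x \<in> carrier X" "x' \<in> carrier X" "y \<in> carrier Y"
        "d = frag_of (x \<oplus>\<^bsub>X\<^esub> x', y) - frag_of (x, y) - frag_of (x', y)"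
      | x y y' where "x \<in> carrier X" "y \<in> carrier Y" "y' \<in> carrier Y"
        "d = frag_of (x, y \<oplus>\<^bsub>Y\<^esub> y') - frag_of (x, y) - frag_of (x, y')"
      | x s y where "x \<in> carrier X" "s \<in> carrier S" "y \<in> carrier Y"
        "d = frag_of (x \<bullet>\<^bsub>X\<^esub> s, y) - frag_of (x, s \<odot>\<^bsub>Y\<^esub> y)"
      using d by (auto simp: tensor_relators_def)
    then show ?thesis
    proof cases
      case 1
      then have "y \<bullet>\<^bsub>Y\<^esub> q \<in> carrier Y"
        using assms(1) by auto
      then show ?thesis
        using 1 unfolding tensor_relators_def by (simp add: frag_extend_diff) blast
    next
      case 2
      then have "y \<bullet>\<^bsub>Y\<^esub> q \<in> carrier Y" "y' \<bullet>\<^bsub>Y\<^esub> q \<in> carrier Y"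
        using assms(1) by auto
      then show ?thesis
        using 2 assms(1) unfolding tensor_relators_def
        by (simp add: frag_extend_diff Y.rsmult_l_distr) blast
    next
      case 3
      then have "y \<bullet>\<^bsub>Y\<^esub> q \<in> carrier Y" "(s \<odot>\<^bsub>Y\<^esub> y) \<bullet>\<^bsub>Y\<^esub> q = s \<odot>\<^bsub>Y\<^esub> (y \<bullet>\<^bsub>Y\<^esub> q)"
        using assms(1) by (auto simp: Y.smult_rsmult)
      then show ?thesis
        using 3 unfolding tensor_relators_def by (simp add: frag_extend_diff) blast
    qed
  qed
  have "cls c \<bullet>\<^bsub>XYQ\<^esub> q = (\<Union>d\<in>cls c. cls (frag_extend (\<lambda>(x, y). frag_of (x, y \<bullet>\<^bsub>Y\<^esub> q)) d))"
    by (simp add: bimodule_tensor_def module.defs bimodule.defs)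
  also have "\<dots> = cls (frag_extend (\<lambda>(x, y). frag_of (x, y \<bullet>\<^bsub>Y\<^esub> q)) c)"
    by (rule class_map) (use assms rel relators_in_kernel in auto)
  finally show ?thesis .
qed

lemma bitensor_rsmult_additive:
  assumes "q \<in> carrier Q" shows "(\<lambda>u. u \<bullet>\<^bsub>XYQ\<^esub> q) \<in> additive XY XY"
proof -
  let ?\<gamma> = "frag_extend (\<lambda>(x, y). frag_of (x, y \<bullet>\<^bsub>Y\<^esub> q))"
  have closed: "?\<gamma> c \<in> carrier F" if "c \<in> carrier F" for c
  proof -
    have "Poly_Mapping.keys ((\<lambda>(x, y). frag_of (x, y \<bullet>\<^bsub>Y\<^esub> q)) z) \<subseteq> carrier X \<times> carrier Y"
      if "z \<in> Poly_Mapping.keys c" for z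
      using that \<open>c \<in> carrier F\<close> assms by (auto split: prod.splits)
    then show ?thesis
      unfolding carrier_free_Abelian_group_iff by (intro order_trans[OF keys_frag_extend] UN_least)
  qed
  show ?thesis
  proof (rule additiveI)
    fix u assume "u \<in> carrier XY"
    then obtain c where "c \<in> carrier F" "u = cls c" by (rule class_cases)
    then show "u \<bullet>\<^bsub>XYQ\<^esub> q \<in> carrier XY"
      using class_closed[OF closed] by (simp add: bitensor_rsmult_class[OF assms] del: carrier_free_Abelian_group_iff)
  next
    fix u v assume "u \<in> carrier XY" "v \<in> carrier XY"
    then obtain c d where cd: "c \<in> carrier F" "u = cls c" "d \<in> carrier F" "v = cls d"
      by (metis class_cases)
    then have "cls (c + d) \<bullet>\<^bsub>XYQ\<^esub> q = cls c \<bullet>\<^bsub>XYQ\<^esub> q \<oplus>\<^bsub>XY\<^esub> cls d \<bullet>\<^bsub>XYQ\<^esub> q"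
      using F.m_closed[of c d] unfolding bitensor_rsmult_class[OF assms cd(1)] bitensor_rsmult_class[OF assms cd(3)]
      by (subst bitensor_rsmult_class[OF assms]) (simp_all only: mult_free_Abelian_group frag_extend_add class_add closed)
    then show "(u \<oplus>\<^bsub>XY\<^esub> v) \<bullet>\<^bsub>XYQ\<^esub> q = u \<bullet>\<^bsub>XYQ\<^esub> q \<oplus>\<^bsub>XY\<^esub> v \<bullet>\<^bsub>XYQ\<^esub> q"
      using cd by (simp add: class_add del: carrier_free_Abelian_group_iff)
  qed
qed

lemma bitensor_rsmult_pure:
  "\<lbrakk>x \<in> carrier X; y \<in> carrier Y; q \<in> carrier Q\<rbrakk> \<Longrightarrow> pt x y \<bullet>\<^bsub>XYQ\<^esub> q = pt x (y \<bullet>\<^bsub>Y\<^esub> q)"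
  unfolding pure_tensor_def by (subst bitensor_rsmult_class) auto

lemma bimodule_bitensor: "bimodule R Q XYQ"
proof -
  \<comment> \<open>\<open>XYQ\<close> is a different record from \<open>XY\<close>, so the group
    laws have to be carried over through the equality of the fields.\<close>
  have grp: "abelian_group XYQ"
    by (rule abelian_groupI) (use XY.l_neg XY.a_inv_closed in \<open>auto simp: XY.a_ac\<close>)
  have "left_module R XYQ"
    by (intro left_module.intro left_module_axioms.intro grp X.R.ring_axioms)
       (simp_all add: XY.smult_l_distr XY.smult_r_distr XY.smult_assoc)
  moreover have "right_module Q XYQ"
  proof (intro right_module.intro right_module_axioms.intro grp Y.S.ring_axioms; simp only: bitensor_simps)
    fix u s assume "u \<in> carrier XY" "s \<in> carrier Q"
    then show "u \<bullet>\<^bsub>XYQ\<^esub> s \<in> carrier XY"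
      using additive_closed[OF bitensor_rsmult_additive] by blast
  next
    fix u v s assume "u \<in> carrier XY" "v \<in> carrier XY" "s \<in> carrier Q"
    then show "(u \<oplus>\<^bsub>XY\<^esub> v) \<bullet>\<^bsub>XYQ\<^esub> s = u \<bullet>\<^bsub>XYQ\<^esub> s \<oplus>\<^bsub>XY\<^esub> v \<bullet>\<^bsub>XYQ\<^esub> s"
      using additive_add[OF bitensor_rsmult_additive] by blast
  next
    fix u a b assume u: "u \<in> carrier XY" and ab: "a \<in> carrier Q" "b \<in> carrier Q"
    have "(\<lambda>u. u \<bullet>\<^bsub>XYQ\<^esub> a \<oplus>\<^bsub>XY\<^esub> u \<bullet>\<^bsub>XYQ\<^esub> b) \<in> additive XY XY"
      using ab by (intro additiveI)
        (simp_all add: additive_closed[OF bitensor_rsmult_additive] additive_add[OF bitensor_rsmult_additive] XY.a_ac)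
    from tensor_hom_eqI[OF bitensor_rsmult_additive this _ u]
    show "u \<bullet>\<^bsub>XYQ\<^esub> (a \<oplus>\<^bsub>Q\<^esub> b) = u \<bullet>\<^bsub>XYQ\<^esub> a \<oplus>\<^bsub>XY\<^esub> u \<bullet>\<^bsub>XYQ\<^esub> b"
      using ab by (simp add: bitensor_rsmult_pure Y.rsmult_r_distr pure_add_right)
    from tensor_hom_eqI[OF bitensor_rsmult_additive additive_comp[OF bitensor_rsmult_additive bitensor_rsmult_additive] _ u]
    show "u \<bullet>\<^bsub>XYQ\<^esub> (a \<otimes>\<^bsub>Q\<^esub> b) = u \<bullet>\<^bsub>XYQ\<^esub> a \<bullet>\<^bsub>XYQ\<^esub> b"
      using ab by (simp add: bitensor_rsmult_pure Y.rsmult_assoc)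
  next
    fix u assume u: "u \<in> carrier XY"
    have "(\<lambda>u. u) \<in> additive XY XY" by (rule additiveI) auto
    from tensor_hom_eqI[OF bitensor_rsmult_additive this _ u]
    show "u \<bullet>\<^bsub>XYQ\<^esub> \<one>\<^bsub>Q\<^esub> = u"
      by (simp add: bitensor_rsmult_pure)
  qed
  moreover have "(r \<odot>\<^bsub>XYQ\<^esub> u) \<bullet>\<^bsub>XYQ\<^esub> q = r \<odot>\<^bsub>XYQ\<^esub> (u \<bullet>\<^bsub>XYQ\<^esub> q)"
    if r: "r \<in> carrier R" and u: "u \<in> carrier XY" and q: "q \<in> carrier Q" for r u q
  proof -
    from tensor_hom_eqI[OF additive_comp[OF tensor_smult_additive bitensor_rsmult_additive]
        additive_comp[OF bitensor_rsmult_additive tensor_smult_additive] _ u]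
    show ?thesis
      using r q by (simp add: tensor_smult_pure bitensor_rsmult_pure)
  qed
  ultimately show ?thesis
    by (intro bimodule.intro bimodule_axioms.intro) auto
qed

end

section \<open>Functoriality of the tensor product\<close>

lemma tensor_map_lemmas:
  fixes X :: "('r, 's, 'x, 'f) bimodule_scheme" and X' :: "('r, 's, 'x2, 'f2) bimodule_scheme"
  assumes XY: "bimodule_tensor_product S X Y R" and XY': "bimodule_tensor_product S X' Y' R"
    and h: "h \<in> bimodule_hom R S X X'" and k: "k \<in> left_module_hom S Y Y'"
  shows tensor_map_hom: "tensor_map S X Y X' Y' h k \<in> left_module_hom R (tensor S X Y) (tensor S X' Y')"
    and tensor_map_pure: "\<lbrakk>x \<in> carrier X; y \<in> carrier Y\<rbrakk>
      \<Longrightarrow> tensor_map S X Y X' Y' h k (pure_tensor S X Y x y) = pure_tensor S X' Y' (h x) (k y)"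
proof -
  interpret XY: bimodule_tensor_product S X Y R by fact
  interpret XY': bimodule_tensor_product S X' Y' R by fact
  have h': "h \<in> left_module_hom R X X'" "\<And>x s. \<lbrakk>x \<in> carrier X; s \<in> carrier S\<rbrakk> \<Longrightarrow> h (x \<bullet>\<^bsub>X\<^esub> s) = h x \<bullet>\<^bsub>X'\<^esub> s"
    using h by (auto simp: bimodule_hom_def)
  note h_add = left_module_hom_additive[OF h'(1)] and k_add = left_module_hom_additive[OF k]
  note closed = additive_closed[OF h_add] additive_closed[OF k_add]
  have bal: "balanced S X Y (tensor S X' Y') (\<lambda>x y. pure_tensor S X' Y' (h x) (k y))"
    by (rule balancedI)
       (simp_all add: closed additive_add[OF h_add] additive_add[OF k_add] XY'.pure_add_left XY'.pure_add_right
          XY'.pure_balanced[symmetric] h'(2) left_module_hom_smult[OF k])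
  show "tensor_map S X Y X' Y' h k \<in> left_module_hom R (tensor S X Y) (tensor S X' Y')"
    unfolding tensor_map_def
    by (rule XY.tensor_lift_linear[OF XY'.left_module_tensor bal])
       (simp add: closed XY'.tensor_smult_pure left_module_hom_smult[OF h'(1)])
  show "\<lbrakk>x \<in> carrier X; y \<in> carrier Y\<rbrakk>
      \<Longrightarrow> tensor_map S X Y X' Y' h k (pure_tensor S X Y x y) = pure_tensor S X' Y' (h x) (k y)"
    unfolding tensor_map_def by (rule XY.tensor_lift_pure[OF XY'.XY.abelian_group_axioms bal])
qed

lemma bimodule_hom_id: "(\<lambda>x. x) \<in> bimodule_hom R S X X"
  by (auto simp: bimodule_hom_def left_module_hom_def)

section \<open>Quotient modules\<close>

context left_module
begin

lemma quotient_module_lemmas: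
  assumes K: "subgroup K (add_monoid M)" and K_smult: "\<And>r k. \<lbrakk>r \<in> carrier R; k \<in> K\<rbrakk> \<Longrightarrow> r \<odot>\<^bsub>M\<^esub> k \<in> K"
  shows left_module_quotient: "left_module R (quotient_module M K)"
    and quotient_proj_hom: "(\<lambda>x. K +>\<^bsub>M\<^esub> x) \<in> left_module_hom R M (quotient_module M K)"
    and quotient_cases: "\<And>C. C \<in> carrier (quotient_module M K) \<Longrightarrow> \<exists>x\<in>carrier M. C = K +>\<^bsub>M\<^esub> x"
    and quotient_eq_iff: "\<And>x y. \<lbrakk>x \<in> carrier M; y \<in> carrier M\<rbrakk>
      \<Longrightarrow> K +>\<^bsub>M\<^esub> x = K +>\<^bsub>M\<^esub> y \<longleftrightarrow> x \<ominus>\<^bsub>M\<^esub> y \<in> K"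
proof -
  let ?Q = "quotient_module M K"
  interpret K: abelian_subgroup K M
    by (rule abelian_subgroupI3) (simp_all add: additive_subgroup_def K M.abelian_group_axioms)
  have cases: "\<exists>x\<in>carrier M. C = K +>\<^bsub>M\<^esub> x" if "C \<in> carrier ?Q" for C
    using that by (auto simp: quotient_module_def A_RCOSETS_def RCOSETS_def a_r_coset_def)
  have closed: "K +>\<^bsub>M\<^esub> x \<in> carrier ?Q" if "x \<in> carrier M" for x
    using that by (simp add: quotient_module_def M.a_rcosetsI K.a_subset)
  have add: "K +>\<^bsub>M\<^esub> (x \<oplus>\<^bsub>M\<^esub> y) = (K +>\<^bsub>M\<^esub> x) \<oplus>\<^bsub>?Q\<^esub> (K +>\<^bsub>M\<^esub> y)"
    if "x \<in> carrier M" "y \<in> carrier M" for x y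
    using that by (simp add: quotient_module_def K.a_rcos_sum)
  have eq: "K +>\<^bsub>M\<^esub> x = K +>\<^bsub>M\<^esub> y \<longleftrightarrow> x \<ominus>\<^bsub>M\<^esub> y \<in> K" if xy: "x \<in> carrier M" "y \<in> carrier M" for x y
  proof
    assume "K +>\<^bsub>M\<^esub> x = K +>\<^bsub>M\<^esub> y"
    then have "x \<in> K +>\<^bsub>M\<^esub> y"
      using K.a_rcos_self[OF xy(1)] by simp
    then obtain k where "k \<in> K" "x = k \<oplus>\<^bsub>M\<^esub> y"
      by (auto simp: a_r_coset_def')
    then show "x \<ominus>\<^bsub>M\<^esub> y \<in> K"
      using xy K.a_Hcarr by (simp add: M.minus_eq M.a_assoc M.r_neg)
  next
    assume *: "x \<ominus>\<^bsub>M\<^esub> y \<in> K"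
    have "x = (x \<ominus>\<^bsub>M\<^esub> y) \<oplus>\<^bsub>M\<^esub> y"
      using xy by (simp add: M.minus_eq M.a_assoc M.l_neg)
    then have "x \<in> K +>\<^bsub>M\<^esub> y"
      using * by (force simp: a_r_coset_def')
    then show "K +>\<^bsub>M\<^esub> x = K +>\<^bsub>M\<^esub> y"
      using M.a_repr_independence[OF _ xy(2) K] by simp
  qed
  have zero: "\<zero>\<^bsub>?Q\<^esub> = K +>\<^bsub>M\<^esub> \<zero>\<^bsub>M\<^esub>"
    using M.a_coset_add_zero[OF K.a_subset] by (simp add: quotient_module_def)
  have smult: "r \<odot>\<^bsub>?Q\<^esub> (K +>\<^bsub>M\<^esub> x) = K +>\<^bsub>M\<^esub> (r \<odot>\<^bsub>M\<^esub> x)" if rx: "r \<in> carrier R" "x \<in> carrier M" for r x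
  proof -
    \<comment> \<open>Two representatives of a coset differ by some \<open>k\<close> in
      \<open>K\<close>, and their multiples differ by \<open>r\<close> times \<open>k\<close>, which
      is still in \<open>K\<close>. Hence the union that defines the action is a single
      coset.\<close>
    have "K +>\<^bsub>M\<^esub> (r \<odot>\<^bsub>M\<^esub> c) = K +>\<^bsub>M\<^esub> (r \<odot>\<^bsub>M\<^esub> x)" if cx: "c \<in> K +>\<^bsub>M\<^esub> x" for c
    proof -
      obtain k where k: "k \<in> K" "c = k \<oplus>\<^bsub>M\<^esub> x"
        using cx by (auto simp: a_r_coset_def')
      have c: "k \<in> carrier M" "c \<in> carrier M"
        using k rx by (auto simp: K.a_Hcarr)
      have "r \<odot>\<^bsub>M\<^esub> c \<ominus>\<^bsub>M\<^esub> r \<odot>\<^bsub>M\<^esub> x = r \<odot>\<^bsub>M\<^esub> k"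
        using c rx k(2) by (simp add: smult_r_distr M.minus_eq M.a_assoc M.r_neg)
      then show ?thesis
        using K_smult[OF rx(1) k(1)] c rx by (simp add: eq)
    qed
    moreover have "x \<in> K +>\<^bsub>M\<^esub> x"
      using rx by (simp add: K.a_rcos_self)
    ultimately have "(\<Union>c\<in>K +>\<^bsub>M\<^esub> x. K +>\<^bsub>M\<^esub> (r \<odot>\<^bsub>M\<^esub> c)) = K +>\<^bsub>M\<^esub> (r \<odot>\<^bsub>M\<^esub> x)"
      by blast
    then show ?thesis by (simp add: quotient_module_def)
  qed
  show "left_module R ?Q"
  proof (intro left_module.intro left_module_axioms.intro abelian_groupI R.ring_axioms)
    fix C assume "C \<in> carrier ?Q"
    then obtain x where x: "x \<in> carrier M" "C = K +>\<^bsub>M\<^esub> x" using cases by blast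
    then have "(K +>\<^bsub>M\<^esub> (\<ominus>\<^bsub>M\<^esub> x)) \<oplus>\<^bsub>?Q\<^esub> C = \<zero>\<^bsub>?Q\<^esub>"
      by (simp add: zero add[symmetric] M.l_neg)
    then show "\<exists>D\<in>carrier ?Q. D \<oplus>\<^bsub>?Q\<^esub> C = \<zero>\<^bsub>?Q\<^esub>"
      using closed[of "\<ominus>\<^bsub>M\<^esub> x"] x by blast
  qed (auto dest!: cases simp: zero closed add[symmetric] smult smult_assoc M.a_ac smult_l_distr smult_r_distr)
  show "(\<lambda>x. K +>\<^bsub>M\<^esub> x) \<in> left_module_hom R M ?Q"
    by (intro left_module_homI additiveI) (simp_all add: closed add smult)
  show "\<And>C. C \<in> carrier ?Q \<Longrightarrow> \<exists>x\<in>carrier M. C = K +>\<^bsub>M\<^esub> x" by (rule cases)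
  show "\<And>x y. \<lbrakk>x \<in> carrier M; y \<in> carrier M\<rbrakk> \<Longrightarrow> K +>\<^bsub>M\<^esub> x = K +>\<^bsub>M\<^esub> y \<longleftrightarrow> x \<ominus>\<^bsub>M\<^esub> y \<in> K"
    by (rule eq)
qed

end

lemma image_submodule:
  assumes U: "left_module R U" and V: "left_module R V" and h: "h \<in> left_module_hom R U V"
  shows "subgroup (h ` carrier U) (add_monoid V)"
    and "\<lbrakk>r \<in> carrier R; k \<in> h ` carrier U\<rbrakk> \<Longrightarrow> r \<odot>\<^bsub>V\<^esub> k \<in> h ` carrier U"
proof -
  interpret U: left_module R U by fact
  interpret V: left_module R V by fact
  have "group_hom (add_monoid U) (add_monoid V) h"
    using left_module_hom_additive[OF h] U.M.a_group V.M.a_group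
    by (simp add: group_hom_def group_hom_axioms_def)
  then show "subgroup (h ` carrier U) (add_monoid V)"
    using group_hom.img_is_subgroup by fastforce
  show "r \<odot>\<^bsub>V\<^esub> k \<in> h ` carrier U" if "r \<in> carrier R" "k \<in> h ` carrier U"
    using that left_module_hom_smult[OF h, symmetric] by auto
qed

section \<open>Products\<close>

text \<open>The product structure is given by equations on the fields instead of a fixed record, so
  that one lemma covers direct sums, rows, columns, matrices, the triangular ring and triple
  modules.\<close>

lemma abelian_group_product:
  assumes G: "abelian_group G" and H: "abelian_group H"
    and carrier: "carrier P = carrier G \<times> carrier H" and zero: "\<zero>\<^bsub>P\<^esub> = (\<zero>\<^bsub>G\<^esub>, \<zero>\<^bsub>H\<^esub>)"
    and add: "\<And>x y x' y'. (x, y) \<oplus>\<^bsub>P\<^esub> (x', y') = (x \<oplus>\<^bsub>G\<^esub> x', y \<oplus>\<^bsub>H\<^esub> y')"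
  shows "abelian_group P"
proof -
  interpret G: abelian_group G by fact
  interpret H: abelian_group H by fact
  show ?thesis
  proof (rule abelian_groupI)
    fix z assume "z \<in> carrier P"
    then obtain x y where "z = (x, y)" "x \<in> carrier G" "y \<in> carrier H" by (auto simp: carrier)
    then show "\<exists>w\<in>carrier P. w \<oplus>\<^bsub>P\<^esub> z = \<zero>\<^bsub>P\<^esub>"
      by (intro bexI[of _ "(\<ominus>\<^bsub>G\<^esub> x, \<ominus>\<^bsub>H\<^esub> y)"]) (auto simp: carrier add zero G.l_neg H.l_neg)
  qed (auto simp: carrier add zero G.a_ac H.a_ac)
qed

lemma left_module_direct_sum:
  assumes "left_module R X" "left_module R Y"
  shows "left_module R (direct_sum_module X Y)"
proof -
  interpret X: left_module R X by fact
  interpret Y: left_module R Y by fact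
  have "abelian_group (direct_sum_module X Y)"
    by (rule abelian_group_product[OF X.M.abelian_group_axioms Y.M.abelian_group_axioms])
       (simp_all add: direct_sum_module_def)
  then show ?thesis
    by (intro left_module.intro left_module_axioms.intro X.R.ring_axioms)
       (auto simp: direct_sum_module_def X.smult_l_distr Y.smult_l_distr X.smult_r_distr Y.smult_r_distr
          X.smult_assoc Y.smult_assoc)
qed

section \<open>The concrete rings, bimodules and modules\<close>

lemma bimodule_ring_bimodule:
  assumes "ring R" "ring S" "h \<in> ring_hom S R"
  shows "bimodule R S (ring_bimodule R h)"
proof -
  interpret R: ring R by fact
  interpret S: ring S by fact
  note h = ring_hom_memE[OF assms(3)]
  have "abelian_group (ring_bimodule R h)"
    by (rule abelian_groupI) (use R.l_neg R.a_inv_closed in \<open>auto simp: ring_bimodule_def R.a_ac\<close>)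
  then show ?thesis
    by (intro bimodule.intro bimodule_axioms.intro left_module.intro left_module_axioms.intro
        right_module.intro right_module_axioms.intro R.ring_axioms S.ring_axioms)
       (auto simp: ring_bimodule_def h R.l_distr R.r_distr R.m_assoc)
qed

lemma ring_mat2_ring:
  assumes "ring T" shows "ring (mat2_ring T)"
proof -
  interpret T: ring T by fact
  \<comment> \<open>A matrix is a pair of rows and a row a pair of entries, so the additive group is
    a product of products. Viewing \<open>T\<close> as a module over itself lets the direct sum
    supply the group of rows.\<close>
  let ?row = "direct_sum_module (ring_bimodule T id) (ring_bimodule T id)"
  have "bimodule T T (ring_bimodule T id)"
    by (rule bimodule_ring_bimodule) (auto simp: T.ring_axioms ring_hom_def)
  then have "left_module T ?row"
    by (intro left_module_direct_sum) (simp_all add: bimodule_def)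
  then have row: "abelian_group ?row"
    by (simp add: left_module_def)
  show ?thesis
  proof (rule ringI)
    show "abelian_group (mat2_ring T)"
      by (rule abelian_group_product[OF row row])
         (auto simp: mat2_ring_def direct_sum_module_def ring_bimodule_def)
    show "monoid (mat2_ring T)"
      by (rule monoidI) (auto simp: mat2_ring_def T.l_distr T.r_distr T.m_assoc T.a_ac)
  qed (auto simp: mat2_ring_def T.l_distr T.r_distr T.a_ac)
qed

lemma bimodule_row_bimodule:
  assumes "ring T" "ring R" "\<phi> \<in> ring_hom R (mat2_ring T)"
  shows "bimodule T R (row_bimodule T \<phi>)"
proof -
  interpret T: ring T by fact
  interpret R: ring R by fact
  note \<phi> = ring_hom_memE[OF assms(3)]
  \<comment> \<open>Right multiplication on rows is defined by a case split on the matrix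
    \<open>\<phi> r\<close>, so each law needs the four entries first.\<close>
  have \<phi>_cases: "\<exists>a b c d. \<phi> r = ((a, b), (c, d)) \<and> a \<in> carrier T \<and> b \<in> carrier T \<and> c \<in> carrier T \<and> d \<in> carrier T"
    if "r \<in> carrier R" for r
    using \<phi>(1)[OF that] by (auto simp: mat2_ring_def)
  have *: "bimodule T T (ring_bimodule T id)"
    by (rule bimodule_ring_bimodule) (auto simp: T.ring_axioms ring_hom_def)
  then have grp: "abelian_group (ring_bimodule T id)"
    by (simp add: bimodule_def left_module_def)
  have "abelian_group (row_bimodule T \<phi>)"
    by (rule abelian_group_product[OF grp grp]) (simp_all add: row_bimodule_def ring_bimodule_def)
  then show ?thesis
  proof (intro bimodule.intro bimodule_axioms.intro left_module.intro left_module_axioms.intro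
        right_module.intro right_module_axioms.intro T.ring_axioms R.ring_axioms)
    fix x s assume "x \<in> carrier (row_bimodule T \<phi>)" "s \<in> carrier R"
    then show "x \<bullet>\<^bsub>row_bimodule T \<phi>\<^esub> s \<in> carrier (row_bimodule T \<phi>)"
      using \<phi>_cases[of s] by (auto simp: row_bimodule_def)
  next
    fix x y s assume "x \<in> carrier (row_bimodule T \<phi>)" "y \<in> carrier (row_bimodule T \<phi>)" "s \<in> carrier R"
    then show "(x \<oplus>\<^bsub>row_bimodule T \<phi>\<^esub> y) \<bullet>\<^bsub>row_bimodule T \<phi>\<^esub> s
        = x \<bullet>\<^bsub>row_bimodule T \<phi>\<^esub> s \<oplus>\<^bsub>row_bimodule T \<phi>\<^esub> y \<bullet>\<^bsub>row_bimodule T \<phi>\<^esub> s"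
      using \<phi>_cases[of s] by (auto simp: row_bimodule_def T.l_distr T.a_ac)
  next
    fix x s t assume "x \<in> carrier (row_bimodule T \<phi>)" "s \<in> carrier R" "t \<in> carrier R"
    then show "x \<bullet>\<^bsub>row_bimodule T \<phi>\<^esub> (s \<oplus>\<^bsub>R\<^esub> t)
        = x \<bullet>\<^bsub>row_bimodule T \<phi>\<^esub> s \<oplus>\<^bsub>row_bimodule T \<phi>\<^esub> x \<bullet>\<^bsub>row_bimodule T \<phi>\<^esub> t"
      using \<phi>_cases[of s] \<phi>_cases[of t] by (auto simp: row_bimodule_def \<phi>(3) mat2_ring_def T.r_distr T.a_ac)
  next
    fix x s t assume "x \<in> carrier (row_bimodule T \<phi>)" "s \<in> carrier R" "t \<in> carrier R"
    then show "x \<bullet>\<^bsub>row_bimodule T \<phi>\<^esub> (s \<otimes>\<^bsub>R\<^esub> t) = x \<bullet>\<^bsub>row_bimodule T \<phi>\<^esub> s \<bullet>\<^bsub>row_bimodule T \<phi>\<^esub> t"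
      using \<phi>_cases[of s] \<phi>_cases[of t]
      by (auto simp: row_bimodule_def \<phi>(2) mat2_ring_def T.l_distr T.r_distr T.m_assoc T.a_ac)
  next
    fix r x s assume "r \<in> carrier T" "x \<in> carrier (row_bimodule T \<phi>)" "s \<in> carrier R"
    then show "(r \<odot>\<^bsub>row_bimodule T \<phi>\<^esub> x) \<bullet>\<^bsub>row_bimodule T \<phi>\<^esub> s = r \<odot>\<^bsub>row_bimodule T \<phi>\<^esub> (x \<bullet>\<^bsub>row_bimodule T \<phi>\<^esub> s)"
      using \<phi>_cases[of s] by (auto simp: row_bimodule_def T.r_distr T.m_assoc)
  qed (auto simp: row_bimodule_def \<phi>(4) mat2_ring_def T.l_distr T.r_distr T.m_assoc)
qed

lemma left_module_mat2_column:
  assumes "left_module T L" shows "left_module (mat2_ring T) (mat2_column L)"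
proof -
  interpret L: left_module T L by fact
  have "abelian_group (mat2_column L)"
    by (rule abelian_group_product[OF L.M.abelian_group_axioms L.M.abelian_group_axioms])
       (simp_all add: mat2_column_def)
  then show ?thesis
    by (intro left_module.intro left_module_axioms.intro ring_mat2_ring L.R.ring_axioms)
       (auto simp: mat2_column_def mat2_ring_def L.smult_l_distr L.smult_r_distr L.smult_assoc L.M.a_ac)
qed

lemma ring_triangular_ring:
  assumes "ring A" "ring B" "bimodule A B M"
  shows "ring (triangular_ring A B M)"
proof -
  interpret A: ring A by fact
  interpret B: ring B by fact
  interpret M: bimodule A B M by fact
  \<comment> \<open>A triple (a, m, b) is a pair of \<open>a\<close> with (m, b), so the group of
    the triangular ring is the product of \<open>A\<close> with the second column.\<close>
  have "abelian_group (second_column B M)"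
    by (rule abelian_group_product[OF M.M.abelian_group_axioms B.abelian_group_axioms])
       (simp_all add: second_column_def)
  note grp = abelian_group_product[OF A.abelian_group_axioms this]
  show ?thesis
  proof (rule ringI)
    show "abelian_group (triangular_ring A B M)"
      by (rule grp) (auto simp: triangular_ring_def second_column_def)
    show "monoid (triangular_ring A B M)"
      by (rule monoidI) (auto simp: triangular_ring_def A.m_assoc B.m_assoc M.smult_assoc M.rsmult_assoc
          M.smult_rsmult M.smult_r_distr M.rsmult_l_distr M.M.a_ac)
  qed (auto simp: triangular_ring_def A.l_distr A.r_distr B.l_distr B.r_distr M.smult_l_distr M.smult_r_distr
      M.rsmult_l_distr M.rsmult_r_distr M.M.a_ac)
qed

lemma left_module_first_column:
  assumes "ring A" "ring B" "bimodule A B M"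
  shows "left_module (triangular_ring A B M) (first_column A B)"
proof -
  interpret A: ring A by fact
  interpret B: ring B by fact
  \<comment> \<open>The second entry ranges over the zero of \<open>B\<close> only, so the carrier
    is not the product of the two carriers and the group laws are verified directly.\<close>
  have "abelian_group (first_column A B)"
  proof (rule abelian_groupI)
    fix x assume "x \<in> carrier (first_column A B)"
    then show "\<exists>y\<in>carrier (first_column A B). y \<oplus>\<^bsub>first_column A B\<^esub> x = \<zero>\<^bsub>first_column A B\<^esub>"
      by (intro bexI[of _ "(\<ominus>\<^bsub>A\<^esub> fst x, \<zero>\<^bsub>B\<^esub>)"]) (auto simp: first_column_def A.l_neg)
  qed (auto simp: first_column_def A.a_ac)
  then show ?thesis
    by (intro left_module.intro left_module_axioms.intro ring_triangular_ring assms)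
       (auto simp: first_column_def triangular_ring_def A.l_distr A.r_distr A.m_assoc)
qed

lemma left_module_second_column:
  assumes "ring A" "ring B" "bimodule A B M"
  shows "left_module (triangular_ring A B M) (second_column B M)"
proof -
  interpret A: ring A by fact
  interpret B: ring B by fact
  interpret M: bimodule A B M by fact
  have "abelian_group (second_column B M)"
    by (rule abelian_group_product[OF M.M.abelian_group_axioms B.abelian_group_axioms])
       (simp_all add: second_column_def)
  then show ?thesis
    by (intro left_module.intro left_module_axioms.intro ring_triangular_ring assms)
       (auto simp: second_column_def triangular_ring_def B.l_distr B.r_distr B.m_assoc
          M.smult_assoc M.rsmult_assoc M.smult_rsmult M.smult_l_distr M.smult_r_distr M.rsmult_l_distr
          M.rsmult_r_distr M.M.a_ac)
qed

text \<open>Associativity of the action is where the tensor product over \<open>B\<close> and the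
  linearity of \<open>f\<close> enter: the term from \<open>m\<close> and \<open>b'\<close> needs
  the balance over \<open>B\<close>, the term from \<open>a\<close> and \<open>m'\<close> needs that
  \<open>f\<close> commutes with \<open>a\<close>.\<close>

lemma left_module_triple_module:
  assumes "ring A" "ring B" "bimodule A B M" and NA: "left_module A NA" and NB: "left_module B NB"
    and f: "f \<in> left_module_hom A (tensor B M NB) NA"
  shows "left_module (triangular_ring A B M) (triple_module B M NA NB f)"
proof -
  interpret A: ring A by fact
  interpret B: ring B by fact
  interpret M: bimodule A B M by fact
  interpret NA: left_module A NA by fact
  interpret NB: left_module B NB by fact
  interpret MN: bimodule_tensor_product B M NB A
    by (intro bimodule_tensor_product.intro tensor_product.intro bimodule_tensor_product_axioms.intro
        assms M.right_module_axioms)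
  note f_add = left_module_hom_additive[OF f]
  have f_closed [simp]: "f (MN.pt m y) \<in> carrier NA" if "m \<in> carrier M" "y \<in> carrier NB" for m y
    using that by (simp add: additive_closed[OF f_add])
  have f_add_left: "f (MN.pt (m \<oplus>\<^bsub>M\<^esub> m') y) = f (MN.pt m y) \<oplus>\<^bsub>NA\<^esub> f (MN.pt m' y)"
    if "m \<in> carrier M" "m' \<in> carrier M" "y \<in> carrier NB" for m m' y
    using that by (simp add: MN.pure_add_left additive_add[OF f_add])
  have f_add_right: "f (MN.pt m (y \<oplus>\<^bsub>NB\<^esub> y')) = f (MN.pt m y) \<oplus>\<^bsub>NA\<^esub> f (MN.pt m y')"
    if "m \<in> carrier M" "y \<in> carrier NB" "y' \<in> carrier NB" for m y y'
    using that by (simp add: MN.pure_add_right additive_add[OF f_add])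
  have f_smult: "f (MN.pt (a \<odot>\<^bsub>M\<^esub> m) y) = a \<odot>\<^bsub>NA\<^esub> f (MN.pt m y)"
    if "a \<in> carrier A" "m \<in> carrier M" "y \<in> carrier NB" for a m y
    using that by (simp add: MN.tensor_smult_pure[symmetric] left_module_hom_smult[OF f])
  have f_zero: "f (MN.pt \<zero>\<^bsub>M\<^esub> y) = \<zero>\<^bsub>NA\<^esub>" if "y \<in> carrier NB" for y
    using that by (simp add: MN.pure_zero_left additive_zero[OF MN.XY.abelian_group_axioms NA.M.abelian_group_axioms f_add])
  have "abelian_group (triple_module B M NA NB f)"
    by (rule abelian_group_product[OF NA.M.abelian_group_axioms NB.M.abelian_group_axioms])
       (simp_all add: triple_module_def)
  then show ?thesis
    by (intro left_module.intro left_module_axioms.intro ring_triangular_ring assms)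
       (auto simp: triple_module_def triangular_ring_def f_add_left f_add_right f_smult f_zero
          MN.pure_balanced NA.smult_assoc NB.smult_assoc
          NA.smult_l_distr NA.smult_r_distr NB.smult_l_distr NB.smult_r_distr NA.M.a_ac)
qed

section \<open>Free rings\<close>

text \<open>Additivity in the function, not in the argument: the product of \<open>free_ring\<close>
  is a linear extension of a linear extension, and its second factor enters through the inner
  function.\<close>

lemma frag_extend_fun_add:
  "frag_extend (\<lambda>u. f u + g u) c = frag_extend f c + frag_extend g c"
  by (simp add: frag_extend_def frag_cmul_distrib2 sum.distrib)

lemma frag_extend_fun_diff:
  "frag_extend (\<lambda>u. f u - g u) c = frag_extend f c - frag_extend g c"
  using frag_extend_fun_add[of "\<lambda>u. f u - g u" g c] by (simp add: algebra_simps)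

lemma free_ring_simps:
  "c \<in> carrier (free_ring S) \<longleftrightarrow> Poly_Mapping.keys c \<subseteq> lists S"
  "\<one>\<^bsub>free_ring S\<^esub> = frag_of []" "\<zero>\<^bsub>free_ring S\<^esub> = 0" "c \<oplus>\<^bsub>free_ring S\<^esub> d = c + d"
  by (simp_all add: free_ring_def)

lemma free_ring_mult_of: "frag_of u \<otimes>\<^bsub>free_ring S\<^esub> frag_of v = frag_of (u @ v)"
  by (simp add: free_ring_def)

lemma free_ring_mult_diff:
  "(c - c') \<otimes>\<^bsub>free_ring S\<^esub> d = c \<otimes>\<^bsub>free_ring S\<^esub> d - c' \<otimes>\<^bsub>free_ring S\<^esub> d"
  "c \<otimes>\<^bsub>free_ring S\<^esub> (d - d') = c \<otimes>\<^bsub>free_ring S\<^esub> d - c \<otimes>\<^bsub>free_ring S\<^esub> d'"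
  by (simp_all add: free_ring_def frag_extend_diff frag_extend_fun_diff)

lemma free_ring_mult_zero:
  "0 \<otimes>\<^bsub>free_ring S\<^esub> d = 0" "c \<otimes>\<^bsub>free_ring S\<^esub> 0 = 0"
  by (simp_all add: free_ring_def frag_extend_eq_0)

text \<open>Products are additive in each factor, so inductions on the right, the middle and the
  left factor in turn reduce the claim to words, where it is associativity of append.\<close>

lemma free_ring_mult_assoc:
  "c \<otimes>\<^bsub>free_ring S\<^esub> d \<otimes>\<^bsub>free_ring S\<^esub> e = c \<otimes>\<^bsub>free_ring S\<^esub> (d \<otimes>\<^bsub>free_ring S\<^esub> e)"
proof -
  have 1: "frag_of u \<otimes>\<^bsub>free_ring S\<^esub> frag_of v \<otimes>\<^bsub>free_ring S\<^esub> e
      = frag_of u \<otimes>\<^bsub>free_ring S\<^esub> (frag_of v \<otimes>\<^bsub>free_ring S\<^esub> e)" for u v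
    by (induction e rule: frag_induction[OF subset_UNIV])
       (simp_all add: free_ring_mult_zero free_ring_mult_diff free_ring_mult_of)
  have 2: "frag_of u \<otimes>\<^bsub>free_ring S\<^esub> d \<otimes>\<^bsub>free_ring S\<^esub> e
      = frag_of u \<otimes>\<^bsub>free_ring S\<^esub> (d \<otimes>\<^bsub>free_ring S\<^esub> e)" for u
    by (induction d rule: frag_induction[OF subset_UNIV])
       (simp_all add: free_ring_mult_zero free_ring_mult_diff 1)
  show ?thesis
    by (induction c rule: frag_induction[OF subset_UNIV])
       (simp_all add: free_ring_mult_zero free_ring_mult_diff 2)
qed

lemma free_ring_mult_closed:
  assumes "c \<in> carrier (free_ring S)" "d \<in> carrier (free_ring S)"
  shows "c \<otimes>\<^bsub>free_ring S\<^esub> d \<in> carrier (free_ring S)"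
proof -
  have "Poly_Mapping.keys (frag_extend (\<lambda>v. frag_of (u @ v)) d) \<subseteq> lists S" if "u \<in> lists S" for u
  proof (intro order_trans[OF keys_frag_extend] UN_least)
    fix v assume "v \<in> Poly_Mapping.keys d"
    then have "v \<in> lists S"
      using assms(2) by (auto simp only: free_ring_simps)
    then show "Poly_Mapping.keys (frag_of (u @ v)) \<subseteq> lists S"
      using that by simp
  qed
  moreover have "Poly_Mapping.keys c \<subseteq> lists S"
    using assms(1) by (simp only: free_ring_simps)
  ultimately have "Poly_Mapping.keys (frag_extend (\<lambda>u. frag_extend (\<lambda>v. frag_of (u @ v)) d) c) \<subseteq> lists S"
    using order_trans[OF keys_frag_extend UN_least] by (metis (no_types, lifting) subsetD)
  then show ?thesis by (simp add: free_ring_def)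
qed

lemma ring_free_ring: "ring (free_ring S)"
proof (rule ringI)
  show "abelian_group (free_ring S)"
  proof (rule abelian_groupI)
    fix c assume "c \<in> carrier (free_ring S)"
    then show "\<exists>d\<in>carrier (free_ring S). d \<oplus>\<^bsub>free_ring S\<^esub> c = \<zero>\<^bsub>free_ring S\<^esub>"
      by (intro bexI[of _ "-c"]) (auto simp: free_ring_simps)
  qed (simp_all only: free_ring_simps keys_add_subset add_ac add_0 add_0_right keys_zero empty_subsetI)
  show "monoid (free_ring S)"
  proof (rule monoidI)
    show "\<one>\<^bsub>free_ring S\<^esub> \<otimes>\<^bsub>free_ring S\<^esub> c = c" "c \<otimes>\<^bsub>free_ring S\<^esub> \<one>\<^bsub>free_ring S\<^esub> = c" for c
      by (simp_all add: free_ring_def frag_expansion[symmetric])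
  qed (simp_all add: free_ring_mult_closed free_ring_mult_assoc, simp add: free_ring_simps)
qed (simp_all add: free_ring_def frag_extend_add frag_extend_fun_add)

text \<open>Words are built letter by letter from the empty word, and linear combinations of words
  arise from words by differences. Zero is the difference of the empty word with itself.\<close>

lemma free_ring_induct [consumes 1, case_names diff one mult]:
  assumes c: "c \<in> carrier (free_ring S)"
    and diff: "\<And>c d. \<lbrakk>c \<in> carrier (free_ring S); d \<in> carrier (free_ring S); P c; P d\<rbrakk> \<Longrightarrow> P (c - d)"
    and one: "P (frag_of [])"
    and mult: "\<And>s w. \<lbrakk>s \<in> S; w \<in> lists S; P (frag_of w)\<rbrakk> \<Longrightarrow> P (frag_of [s] \<otimes>\<^bsub>free_ring S\<^esub> frag_of w)"
  shows "P c"
proof -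
  have word: "P (frag_of w)" if "w \<in> lists S" for w
    using that by (induction w) (use one mult in \<open>auto simp: free_ring_mult_of\<close>)
  have "Poly_Mapping.keys c \<subseteq> lists S"
    using c by (simp add: free_ring_simps)
  then show ?thesis
  proof (induction c rule: free_Abelian_group_induct[consumes 1])
    case 1
    then show ?case using diff[OF _ _ one one] by (simp add: free_ring_simps)
  qed (auto simp: free_ring_simps intro: diff word)
qed

text \<open>\<open>h\<close> is the linear extension of the map that sends a word to the product of
  the values of its letters. Multiplicativity is shown for a word times an arbitrary element first,
  and an induction on the left factor then gives the general case.\<close>

lemma free_ring_universal:
  assumes R: "ring R" and y: "\<And>s. s \<in> S \<Longrightarrow> y s \<in> carrier R"
  obtains h where "h \<in> ring_hom (free_ring S) R" "\<And>s. s \<in> S \<Longrightarrow> h (frag_of [s]) = y s"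
proof -
  interpret R: ring R by fact
  define w where "w = (\<lambda>u. foldr (\<lambda>s r. y s \<otimes>\<^bsub>R\<^esub> r) u \<one>\<^bsub>R\<^esub>)"
  have w_simps: "w [] = \<one>\<^bsub>R\<^esub>" "w (s # u) = y s \<otimes>\<^bsub>R\<^esub> w u" for s u
    by (simp_all add: w_def)
  have w_closed: "w u \<in> carrier R" if "u \<in> lists S" for u
    using that by induction (auto simp: w_simps y)
  have w_append: "w (u @ v) = w u \<otimes>\<^bsub>R\<^esub> w v" if "u \<in> lists S" "v \<in> lists S" for u v
    using that by induction (auto simp: w_simps w_closed y R.m_assoc)
  obtain h where h: "h \<in> hom (free_Abelian_group (lists S)) (add_monoid R)"
      and h_of: "\<And>u. u \<in> lists S \<Longrightarrow> h (frag_of u) = w u"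
  proof -
    have "w ` lists S \<subseteq> carrier (add_monoid R)"
      using w_closed by auto
    from comm_group.free_Abelian_group_universal[OF R.a_comm_group this] that show thesis
      by blast
  qed
  have h_add: "h \<in> additive (free_ring S) R"
    using h by (auto simp: hom_def free_ring_simps)
  have F: "abelian_group (free_ring S)"
    by (rule ring.axioms(1)[OF ring_free_ring])
  interpret F: ring "free_ring S" by (rule ring_free_ring)
  have h_diff: "h (c - d) = h c \<ominus>\<^bsub>R\<^esub> h d" if "c \<in> carrier (free_ring S)" "d \<in> carrier (free_ring S)" for c d
  proof -
    have "\<ominus>\<^bsub>free_ring S\<^esub> d = - d"
      using that by (intro F.minus_equality) (auto simp: free_ring_simps)
    then show ?thesis
      using additive_add[OF h_add, of c "\<ominus>\<^bsub>free_ring S\<^esub> d"] additive_minus[OF F R.abelian_group_axioms h_add, of d] that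
      by (simp add: free_ring_simps R.minus_eq)
  qed
  note h_closed = additive_closed[OF h_add]
  have mult_of: "h (frag_of u \<otimes>\<^bsub>free_ring S\<^esub> d) = h (frag_of u) \<otimes>\<^bsub>R\<^esub> h d"
    if u: "u \<in> lists S" and d: "d \<in> carrier (free_ring S)" for u d
  proof -
    have fu: "frag_of u \<in> carrier (free_ring S)"
      using u by (auto simp: free_ring_simps)
    have "Poly_Mapping.keys d \<subseteq> lists S" using d by (simp add: free_ring_simps)
    then show ?thesis
    proof (induction d rule: free_Abelian_group_induct[consumes 1])
      case 1
      then show ?case
        using additive_zero[OF F R.abelian_group_axioms h_add] h_closed[OF fu] by (simp add: free_ring_mult_zero free_ring_simps)
    next
      case (2 c d)
      then have "c \<in> carrier (free_ring S)" "d \<in> carrier (free_ring S)"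
        by (auto simp: free_ring_simps)
      then show ?case
        using 2 fu by (simp add: free_ring_mult_diff h_diff free_ring_mult_closed h_closed R.minus_eq R.r_distr R.r_minus)
    next
      case (3 v)
      then show ?case
        using u by (simp add: free_ring_mult_of h_of w_append)
    qed
  qed
  have "h (c \<otimes>\<^bsub>free_ring S\<^esub> d) = h c \<otimes>\<^bsub>R\<^esub> h d"
    if c: "c \<in> carrier (free_ring S)" and d: "d \<in> carrier (free_ring S)" for c d
  proof -
    have "Poly_Mapping.keys c \<subseteq> lists S" using c by (simp add: free_ring_simps)
    then show ?thesis
    proof (induction c rule: free_Abelian_group_induct[consumes 1])
      case 1
      then show ?case
        using additive_zero[OF F R.abelian_group_axioms h_add] h_closed[OF d] by (simp add: free_ring_mult_zero free_ring_simps)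
    next
      case (2 c c')
      then have "c \<in> carrier (free_ring S)" "c' \<in> carrier (free_ring S)"
        by (auto simp: free_ring_simps)
      then show ?case
        using 2 d by (simp add: free_ring_mult_diff h_diff free_ring_mult_closed h_closed R.minus_eq R.l_distr R.l_minus)
    next
      case (3 u)
      then show ?case using d by (simp add: mult_of)
    qed
  qed
  then have "h \<in> ring_hom (free_ring S) R"
    by (intro ring_hom_memI) (simp_all add: h_closed additive_add[OF h_add], simp add: free_ring_simps h_of w_simps)
  moreover have "h (frag_of [s]) = y s" if "s \<in> S" for s
    using that by (simp add: h_of w_simps y)
  ultimately show thesis by (rule that)
qed

lemma (in ideal) quotient_universal:
  assumes S: "ring S" and h: "h \<in> ring_hom R S" and ker: "\<And>i. i \<in> I \<Longrightarrow> h i = \<zero>\<^bsub>S\<^esub>"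
  obtains k where "k \<in> ring_hom (R Quot I) S" "\<And>r. r \<in> carrier R \<Longrightarrow> k (I +> r) = h r"
proof -
  interpret S: ring S by fact
  note h = ring_hom_memE[OF h]
  \<comment> \<open>Any representative will do: two of them differ by an element of
    \<open>I\<close>, which \<open>h\<close> sends to zero.\<close>
  define k where "k = (\<lambda>C. h (SOME c. c \<in> C))"
  have k: "k (I +> r) = h r" if r: "r \<in> carrier R" for r
  proof -
    have "(SOME c. c \<in> I +> r) \<in> I +> r"
      using a_rcos_self[OF r] by (rule someI)
    then obtain i where "i \<in> I" "(SOME c. c \<in> I +> r) = i \<oplus> r"
      by (auto simp: a_r_coset_def')
    then show ?thesis
      using r ker h by (simp add: k_def a_Hcarr)
  qed
  have cases: "\<exists>r\<in>carrier R. C = I +> r" if "C \<in> carrier (R Quot I)" for C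
    using that by (auto simp: FactRing_simps)
  note hom = ring_hom_memE[OF rcos_ring_hom]
  have "k \<in> ring_hom (R Quot I) S"
  proof (rule ring_hom_memI)
    fix C assume "C \<in> carrier (R Quot I)"
    then show "k C \<in> carrier S"
      using cases[of C] h(1) k by auto
  next
    fix C D assume "C \<in> carrier (R Quot I)" "D \<in> carrier (R Quot I)"
    then obtain r s where rs: "r \<in> carrier R" "C = I +> r" "s \<in> carrier R" "D = I +> s"
      using cases by metis
    then show "k (C \<otimes>\<^bsub>R Quot I\<^esub> D) = k C \<otimes>\<^bsub>S\<^esub> k D"
      by (simp add: k h hom(2)[symmetric] del: hom)
    from rs show "k (C \<oplus>\<^bsub>R Quot I\<^esub> D) = k C \<oplus>\<^bsub>S\<^esub> k D"
      by (simp add: k h hom(3)[symmetric] del: hom)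
  next
    show "k \<one>\<^bsub>R Quot I\<^esub> = \<one>\<^bsub>S\<^esub>"
      by (simp add: k h hom(4)[symmetric])
  qed
  then show thesis using k by (rule that)
qed


section \<open>The ring \<open>T(M, p)\<close>\<close>

locale T_data =
  fixes A :: "('a, 'e) ring_scheme" and B :: "('b, 'e2) ring_scheme"
    and M :: "('a, 'b, 'm, 'f) bimodule_scheme" and p :: 'm
  assumes ring_A: "ring A" and ring_B: "ring B" and bimod_M: "bimodule A B M" and p [simp]: "p \<in> carrier M"
begin

sublocale A: ring A by (rule ring_A)
sublocale B: ring B by (rule ring_B)
sublocale M: bimodule A B M by (rule bimod_M)
sublocale free: ring "free_ring (carrier M)" by (rule ring_free_ring)

abbreviation "T \<equiv> T_ring A B M p"
abbreviation "x \<equiv> T_gen A B M p"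

lemma T_relators_closed: "T_relators A B M p \<subseteq> carrier (free_ring (carrier M))"
  unfolding T_relators_def free_ring_simps subset_iff
  by (auto simp del: keys_single lists_def simp: keys_frag_of dest!: subsetD[OF keys_diff] subsetD[OF Poly_Mapping.keys_add])

sublocale I: ideal "T_ideal A B M p" "free_ring (carrier M)"
  unfolding T_ideal_def by (rule free.genideal_ideal[OF T_relators_closed])

sublocale T: ring T
  unfolding T_ring_def by (rule I.quotient_is_ring)

abbreviation "T_class c \<equiv> T_ideal A B M p +>\<^bsub>free_ring (carrier M)\<^esub> c"

lemmas T_class_hom = ring_hom_memE[OF I.rcos_ring_hom, folded T_ring_def]

lemma T_class_diff:
  assumes "c \<in> carrier (free_ring (carrier M))" "d \<in> carrier (free_ring (carrier M))"
  shows "T_class (c - d) = T_class c \<ominus>\<^bsub>T\<^esub> T_class d"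
proof -
  have cd: "c - d \<in> carrier (free_ring (carrier M))"
    using assms by (simp add: free_ring_simps keys_diff_subset)
  have "T_class c = T_class (c - d) \<oplus>\<^bsub>T\<^esub> T_class d"
    using T_class_hom(3)[OF cd assms(2)] by (simp add: free_ring_simps)
  then show ?thesis
    using T_class_hom(1)[OF cd] T_class_hom(1)[OF assms(2)]
    by (simp add: T.minus_eq T.a_assoc T.r_neg)
qed

lemma frag_in_free: "set w \<subseteq> carrier M \<Longrightarrow> frag_of w \<in> carrier (free_ring (carrier M))"
  by (auto simp: free_ring_simps)

lemma gen_closed [simp, intro]: "m \<in> carrier M \<Longrightarrow> x m \<in> carrier T"
  unfolding T_gen_def by (rule T_class_hom(1)[OF frag_in_free]) simp

lemma T_class_relator:
  assumes "c - d \<in> T_relators A B M p"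
    "c \<in> carrier (free_ring (carrier M))" "d \<in> carrier (free_ring (carrier M))"
  shows "T_class c = T_class d"
proof -
  have "c - d \<in> T_ideal A B M p"
    using assms(1) free.genideal_self[OF T_relators_closed] by (auto simp: T_ideal_def)
  then have "c \<in> T_class d"
    by (force simp: a_r_coset_def' free_ring_simps)
  then show ?thesis
    using free.a_repr_independence[OF _ assms(3) I.a_subgroup] by simp
qed

lemma gen_add:
  assumes m: "m \<in> carrier M" "m' \<in> carrier M" shows "x (m \<oplus>\<^bsub>M\<^esub> m') = x m \<oplus>\<^bsub>T\<^esub> x m'"
proof -
  have "T_class (frag_of [m] + frag_of [m']) = T_class (frag_of [m \<oplus>\<^bsub>M\<^esub> m'])"
  proof (rule T_class_relator)
    show "frag_of [m] + frag_of [m'] - frag_of [m \<oplus>\<^bsub>M\<^esub> m'] \<in> T_relators A B M p"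
      unfolding T_relators_def using m by blast
    show "frag_of [m] + frag_of [m'] \<in> carrier (free_ring (carrier M))"
      using m free.a_closed[OF frag_in_free frag_in_free, of "[m]" "[m']"] by (simp add: free_ring_simps(4))
  qed (use m in \<open>simp add: frag_in_free\<close>)
  then show ?thesis
    using m T_class_hom(3)[OF frag_in_free frag_in_free, of "[m]" "[m']"]
    by (simp add: T_gen_def free_ring_simps(4))
qed

lemma gen_mult: "\<lbrakk>m \<in> carrier M; m' \<in> carrier M\<rbrakk> \<Longrightarrow> x m \<otimes>\<^bsub>T\<^esub> x m' = T_class (frag_of [m, m'])"
  using T_class_hom(2)[OF frag_in_free frag_in_free, of "[m]" "[m']"]
  by (simp add: T_gen_def free_ring_mult_of)

lemma gen_smult:
  assumes "a \<in> carrier A" "m \<in> carrier M" shows "x (a \<odot>\<^bsub>M\<^esub> p) \<otimes>\<^bsub>T\<^esub> x m = x (a \<odot>\<^bsub>M\<^esub> m)"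
proof -
  have "frag_of [a \<odot>\<^bsub>M\<^esub> p, m] - frag_of [a \<odot>\<^bsub>M\<^esub> m] \<in> T_relators A B M p"
    unfolding T_relators_def using assms by blast
  then show ?thesis
    using T_class_relator assms by (simp add: gen_mult frag_in_free) (simp add: T_gen_def frag_in_free)
qed

lemma gen_rsmult:
  assumes "m \<in> carrier M" "b \<in> carrier B" shows "x m \<otimes>\<^bsub>T\<^esub> x (p \<bullet>\<^bsub>M\<^esub> b) = x (m \<bullet>\<^bsub>M\<^esub> b)"
proof -
  have "frag_of [m, p \<bullet>\<^bsub>M\<^esub> b] - frag_of [m \<bullet>\<^bsub>M\<^esub> b] \<in> T_relators A B M p"
    unfolding T_relators_def using assms by blast
  then show ?thesis
    using T_class_relator assms by (simp add: gen_mult frag_in_free) (simp add: T_gen_def frag_in_free)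
qed

lemma gen_one: "x p = \<one>\<^bsub>T\<^esub>"
proof -
  have "frag_of [p] - frag_of [] \<in> T_relators A B M p"
    unfolding T_relators_def by blast
  from T_class_relator[OF this]
  show ?thesis
    using T_class_hom(4) by (simp add: T_gen_def frag_in_free free_ring_simps(2))
qed

text \<open>The \<open>x m\<close> generate \<open>T\<close> as a ring, so a property that is stable
  under differences and products and holds for them and for 1 holds on all of
  \<open>T\<close>.\<close>

lemma T_induct [consumes 1, case_names gen one diff mult]:
  assumes t: "t \<in> carrier T"
    and gen: "\<And>m. m \<in> carrier M \<Longrightarrow> P (x m)" and one: "P \<one>\<^bsub>T\<^esub>"
    and diff: "\<And>s t. \<lbrakk>s \<in> carrier T; t \<in> carrier T; P s; P t\<rbrakk> \<Longrightarrow> P (s \<ominus>\<^bsub>T\<^esub> t)"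
    and mult: "\<And>s t. \<lbrakk>s \<in> carrier T; t \<in> carrier T; P s; P t\<rbrakk> \<Longrightarrow> P (s \<otimes>\<^bsub>T\<^esub> t)"
  shows "P t"
proof -
  obtain c where c: "c \<in> carrier (free_ring (carrier M))" "t = T_class c"
    using t by (auto simp: T_ring_def FactRing_def A_RCOSETS_def')
  have "P (T_class c)"
    using c(1)
  proof (induction c rule: free_ring_induct)
    case (diff c d)
    then show ?case by (simp add: T_class_diff assms(4) T_class_hom(1))
  next
    case one
    then show ?case using T_class_hom(4) assms(3) by (simp add: free_ring_simps(2))
  next
    case (mult m w)
    then have "frag_of [m] \<in> carrier (free_ring (carrier M))" "frag_of w \<in> carrier (free_ring (carrier M))"
      by (auto intro: frag_in_free)
    then show ?case
      using mult assms(5)[of "x m" "T_class (frag_of w)"] gen[of m]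
      by (simp add: T_class_hom(1,2)) (simp add: T_gen_def)
  qed
  then show ?thesis using c(2) by simp
qed

text \<open>The evaluation morphism from the free ring kills the relators, by the four hypotheses on
  \<open>y\<close>, hence the ideal they generate, and so it descends to \<open>T\<close>.\<close>

lemma T_universal:
  assumes S: "ring S" and y: "\<And>m. m \<in> carrier M \<Longrightarrow> y m \<in> carrier S"
    and add: "\<And>m m'. \<lbrakk>m \<in> carrier M; m' \<in> carrier M\<rbrakk> \<Longrightarrow> y (m \<oplus>\<^bsub>M\<^esub> m') = y m \<oplus>\<^bsub>S\<^esub> y m'"
    and smult: "\<And>a m. \<lbrakk>a \<in> carrier A; m \<in> carrier M\<rbrakk> \<Longrightarrow> y (a \<odot>\<^bsub>M\<^esub> p) \<otimes>\<^bsub>S\<^esub> y m = y (a \<odot>\<^bsub>M\<^esub> m)"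
    and rsmult: "\<And>m b. \<lbrakk>m \<in> carrier M; b \<in> carrier B\<rbrakk> \<Longrightarrow> y m \<otimes>\<^bsub>S\<^esub> y (p \<bullet>\<^bsub>M\<^esub> b) = y (m \<bullet>\<^bsub>M\<^esub> b)"
    and one: "y p = \<one>\<^bsub>S\<^esub>"
  obtains k where "k \<in> ring_hom T S" "\<And>m. m \<in> carrier M \<Longrightarrow> k (x m) = y m"
proof -
  interpret S: ring S by fact
  let ?F = "free_ring (carrier M)"
  obtain h where h: "h \<in> ring_hom ?F S" and h_gen: "\<And>m. m \<in> carrier M \<Longrightarrow> h (frag_of [m]) = y m"
    using free_ring_universal[OF S, of "carrier M" y] y by metis
  interpret h: ring_hom_ring ?F S h
    by (rule ring_hom_ringI2[OF ring_free_ring S h])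
  \<comment> \<open>Each relator is a difference of the two sides of a relation, so membership in
    the kernel reduces to equal values on the two sides.\<close>
  have h_relator: "c - d \<in> a_kernel ?F S h" if "c \<in> carrier ?F" "d \<in> carrier ?F" "h c = h d" for c d
  proof -
    have cd: "c - d \<in> carrier ?F"
      using that by (simp add: free_ring_simps keys_diff_subset)
    then have "h d = h (c - d) \<oplus>\<^bsub>S\<^esub> h d"
      using h.hom_add[OF cd that(2)] that(3) by (simp add: free_ring_simps(4))
    then have "h (c - d) = \<zero>\<^bsub>S\<^esub>"
      using h.hom_closed[OF cd] h.hom_closed[OF that(2)] by (metis S.add.r_cancel_one' )
    then show ?thesis
      unfolding a_kernel_def kernel_def using cd by simp
  qed
  have h_word2: "h (frag_of [m, m']) = y m \<otimes>\<^bsub>S\<^esub> y m'" if "m \<in> carrier M" "m' \<in> carrier M" for m m'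
    using that h.hom_mult[OF frag_in_free frag_in_free, of "[m]" "[m']"] by (simp add: free_ring_mult_of h_gen)
  have h_plus: "h (frag_of [m] + frag_of [m']) = y m \<oplus>\<^bsub>S\<^esub> y m'" "frag_of [m] + frag_of [m'] \<in> carrier ?F"
    if "m \<in> carrier M" "m' \<in> carrier M" for m m'
    using that h.hom_add[OF frag_in_free frag_in_free, of "[m]" "[m']"]
      free.a_closed[OF frag_in_free frag_in_free, of "[m]" "[m']"] by (simp_all add: free_ring_simps(4) h_gen)
  have h_one: "h (frag_of []) = \<one>\<^bsub>S\<^esub>"
    using h.hom_one by (simp add: free_ring_simps)
  have "T_relators A B M p \<subseteq> a_kernel ?F S h"
    unfolding T_relators_def
    by (auto intro!: h_relator frag_in_free simp: h_word2 h_plus h_gen h_one add smult rsmult one)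
  then have "T_ideal A B M p \<subseteq> a_kernel ?F S h"
    unfolding T_ideal_def by (rule free.genideal_minimal[OF h.kernel_is_ideal])
  then have "h i = \<zero>\<^bsub>S\<^esub>" if "i \<in> T_ideal A B M p" for i
    using that unfolding a_kernel_def kernel_def by auto
  from I.quotient_universal[OF S h this]
  obtain k where "k \<in> ring_hom (?F Quot T_ideal A B M p) S" "\<And>r. r \<in> carrier ?F \<Longrightarrow> k (T_class r) = h r"
    by metis
  then show thesis
    using that[of k] by (simp add: T_ring_def T_gen_def frag_in_free h_gen)
qed

text \<open>Multiplicativity is the relation for \<open>a\<close> and \<open>m\<close> read at
  \<open>m\<close> = a' \<open>p\<close>; the unit goes to \<open>x p\<close> = 1. The map
  \<open>rho_B\<close> is treated in the same way with the relation for \<open>b\<close>.\<close>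

lemma rho_A_hom: "rho_A A B M p \<in> ring_hom A T"
  by (rule ring_hom_memI)
     (simp_all add: rho_A_def gen_smult M.smult_assoc M.smult_l_distr gen_add gen_one)

lemma rho_B_hom: "rho_B A B M p \<in> ring_hom B T"
  by (rule ring_hom_memI)
     (simp_all add: rho_B_def gen_rsmult M.rsmult_assoc M.rsmult_r_distr gen_add gen_one)

lemma gen_zero: "x \<zero>\<^bsub>M\<^esub> = \<zero>\<^bsub>T\<^esub>"
  by (rule additive_zero[OF M.M.abelian_group_axioms T.abelian_group_axioms]) (rule additiveI; simp add: gen_add)

lemma rho_A_gen: "\<lbrakk>a \<in> carrier A; m \<in> carrier M\<rbrakk> \<Longrightarrow> rho_A A B M p a \<otimes>\<^bsub>T\<^esub> x m = x (a \<odot>\<^bsub>M\<^esub> m)"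
  by (simp add: rho_A_def gen_smult)

lemma gen_rho_B: "\<lbrakk>m \<in> carrier M; b \<in> carrier B\<rbrakk> \<Longrightarrow> x m \<otimes>\<^bsub>T\<^esub> rho_B A B M p b = x (m \<bullet>\<^bsub>M\<^esub> b)"
  by (simp add: rho_B_def gen_rsmult)

text \<open>The upper right entry of a product is where \<open>gen_add\<close>,
  \<open>rho_A_gen\<close> and \<open>gen_rho_B\<close> meet: together they identify
  \<open>x\<close> of a m' + m b' with the matrix entry on the other side.\<close>

lemma localization_map_hom: "localization_map A B M p \<in> ring_hom (triangular_ring A B M) (mat2_ring T)"
  by (rule ring_hom_memI)
     (auto simp: localization_map_def triangular_ring_def mat2_ring_def gen_add rho_A_gen gen_rho_B gen_zero
       ring_hom_memE[OF rho_A_hom] ring_hom_memE[OF rho_B_hom])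

end

section \<open>Universal localization\<close>

locale localization_data = T_data A B M p
  for A :: "('a, 'e) ring_scheme" and B :: "('b, 'e2) ring_scheme"
    and M :: "('a, 'b, 'm, 'f) bimodule_scheme" and p +
  fixes \<sigma> :: "'a \<times> 'b \<Rightarrow> 'm \<times> 'b"
  assumes \<sigma>_hom: "\<sigma> \<in> left_module_hom (triangular_ring A B M) (first_column A B) (second_column B M)"
    and \<sigma>_one: "\<sigma> (\<one>\<^bsub>A\<^esub>, \<zero>\<^bsub>B\<^esub>) = (p, \<zero>\<^bsub>B\<^esub>)"
begin

abbreviation "R \<equiv> triangular_ring A B M"
abbreviation "P \<equiv> first_column A B"
abbreviation "Q \<equiv> second_column B M"
abbreviation "\<phi> \<equiv> localization_map A B M p"

sublocale R: ring R by (rule ring_triangular_ring[OF ring_A ring_B bimod_M])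
sublocale P: left_module R P by (rule left_module_first_column[OF ring_A ring_B bimod_M])
sublocale Q: left_module R Q by (rule left_module_second_column[OF ring_A ring_B bimod_M])

lemma R_carrier [simp]: "(a, m, b) \<in> carrier R \<longleftrightarrow> a \<in> carrier A \<and> m \<in> carrier M \<and> b \<in> carrier B"
  by (simp add: triangular_ring_def)

lemma R_mult: "(a, m, b) \<otimes>\<^bsub>R\<^esub> (a', m', b') = (a \<otimes>\<^bsub>A\<^esub> a', a \<odot>\<^bsub>M\<^esub> m' \<oplus>\<^bsub>M\<^esub> m \<bullet>\<^bsub>M\<^esub> b', b \<otimes>\<^bsub>B\<^esub> b')"
  by (simp add: triangular_ring_def)

lemma R_add: "(a, m, b) \<oplus>\<^bsub>R\<^esub> (a', m', b') = (a \<oplus>\<^bsub>A\<^esub> a', m \<oplus>\<^bsub>M\<^esub> m', b \<oplus>\<^bsub>B\<^esub> b')"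
  by (simp add: triangular_ring_def)

lemma R_one: "\<one>\<^bsub>R\<^esub> = (\<one>\<^bsub>A\<^esub>, \<zero>\<^bsub>M\<^esub>, \<one>\<^bsub>B\<^esub>)"
  and R_zero: "\<zero>\<^bsub>R\<^esub> = (\<zero>\<^bsub>A\<^esub>, \<zero>\<^bsub>M\<^esub>, \<zero>\<^bsub>B\<^esub>)"
  by (simp_all add: triangular_ring_def)

lemma \<sigma>_eq: assumes "a \<in> carrier A" shows "\<sigma> (a, \<zero>\<^bsub>B\<^esub>) = (a \<odot>\<^bsub>M\<^esub> p, \<zero>\<^bsub>B\<^esub>)"
proof -
  have "(a, \<zero>\<^bsub>M\<^esub>, \<zero>\<^bsub>B\<^esub>) \<in> carrier R" "(\<one>\<^bsub>A\<^esub>, \<zero>\<^bsub>B\<^esub>) \<in> carrier P"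
    using assms by (auto simp: first_column_def)
  from left_module_hom_smult[OF \<sigma>_hom this] show ?thesis
    using assms by (simp add: \<sigma>_one first_column_def second_column_def)
qed

end

section \<open>When a ring morphism out of the triangular ring inverts
  \<open>\<sigma>\<close>\<close>

locale ring_morphism_data = localization_data A B M p \<sigma>
  for A :: "('a, 'e) ring_scheme" and B :: "('b, 'e2) ring_scheme"
    and M :: "('a, 'b, 'm, 'f) bimodule_scheme" and p \<sigma> +
  fixes S :: "('s, 'e3) ring_scheme" and \<psi> :: "'a \<times> 'm \<times> 'b \<Rightarrow> 's"
  assumes ring_S: "ring S" and \<psi>_hom: "\<psi> \<in> ring_hom R S"
begin

abbreviation "S\<psi> \<equiv> ring_bimodule S \<psi>"
text \<open>The Peirce components of \<open>\<psi>\<close>: \<open>\<epsilon>1\<close> and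
  \<open>\<epsilon>2\<close> are orthogonal idempotents with sum 1, and \<open>\<alpha>\<close>,
  \<open>\<mu>\<close>, \<open>\<beta>\<close> take values in the corners (1,1), (1,2), (2,2) of
  \<open>S\<close> that they cut out.\<close>

abbreviation "\<alpha> a \<equiv> \<psi> (a, \<zero>\<^bsub>M\<^esub>, \<zero>\<^bsub>B\<^esub>)"
abbreviation "\<mu> m \<equiv> \<psi> (\<zero>\<^bsub>A\<^esub>, m, \<zero>\<^bsub>B\<^esub>)"
abbreviation "\<beta> b \<equiv> \<psi> (\<zero>\<^bsub>A\<^esub>, \<zero>\<^bsub>M\<^esub>, b)"
abbreviation "\<epsilon>1 \<equiv> \<alpha> \<one>\<^bsub>A\<^esub>"
abbreviation "\<epsilon>2 \<equiv> \<beta> \<one>\<^bsub>B\<^esub>"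
abbreviation "\<pi> \<equiv> \<mu> p"

sublocale S: ring S by (rule ring_S)

lemmas \<psi> = ring_hom_memE[OF \<psi>_hom]

lemma \<psi>_closed [simp]:
  "\<lbrakk>a \<in> carrier A; m \<in> carrier M; b \<in> carrier B\<rbrakk> \<Longrightarrow> \<psi> (a, m, b) \<in> carrier S"
  by (rule \<psi>(1)) simp

lemma \<psi>_mult: "\<lbrakk>a \<in> carrier A; m \<in> carrier M; b \<in> carrier B; a' \<in> carrier A; m' \<in> carrier M; b' \<in> carrier B\<rbrakk>
   \<Longrightarrow> \<psi> (a, m, b) \<otimes>\<^bsub>S\<^esub> \<psi> (a', m', b') = \<psi> (a \<otimes>\<^bsub>A\<^esub> a', a \<odot>\<^bsub>M\<^esub> m' \<oplus>\<^bsub>M\<^esub> m \<bullet>\<^bsub>M\<^esub> b', b \<otimes>\<^bsub>B\<^esub> b')"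
  by (simp add: \<psi>(2)[symmetric] R_mult)

lemma \<psi>_add: "\<lbrakk>a \<in> carrier A; m \<in> carrier M; b \<in> carrier B; a' \<in> carrier A; m' \<in> carrier M; b' \<in> carrier B\<rbrakk>
   \<Longrightarrow> \<psi> (a \<oplus>\<^bsub>A\<^esub> a', m \<oplus>\<^bsub>M\<^esub> m', b \<oplus>\<^bsub>B\<^esub> b') = \<psi> (a, m, b) \<oplus>\<^bsub>S\<^esub> \<psi> (a', m', b')"
  by (simp add: \<psi>(3)[symmetric] R_add)

lemma \<psi>_zero: "\<psi> (\<zero>\<^bsub>A\<^esub>, \<zero>\<^bsub>M\<^esub>, \<zero>\<^bsub>B\<^esub>) = \<zero>\<^bsub>S\<^esub>"
  using ring_hom_zero[OF \<psi>_hom R.ring_axioms ring_S] by (simp add: R_zero)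

lemma \<psi>_one: "\<epsilon>1 \<oplus>\<^bsub>S\<^esub> \<epsilon>2 = \<one>\<^bsub>S\<^esub>"
  using \<psi>(4) by (simp add: R_one \<psi>_add[symmetric])

lemma \<psi>_split: "\<lbrakk>a \<in> carrier A; m \<in> carrier M; b \<in> carrier B\<rbrakk> \<Longrightarrow> \<psi> (a, m, b) = \<alpha> a \<oplus>\<^bsub>S\<^esub> \<mu> m \<oplus>\<^bsub>S\<^esub> \<beta> b"
  by (simp add: \<psi>_add[symmetric])

lemma \<mu>_add: "\<lbrakk>m \<in> carrier M; m' \<in> carrier M\<rbrakk> \<Longrightarrow> \<mu> (m \<oplus>\<^bsub>M\<^esub> m') = \<mu> m \<oplus>\<^bsub>S\<^esub> \<mu> m'"
  by (simp add: \<psi>_add[symmetric])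

sublocale S\<psi>: bimodule S R S\<psi>
  by (rule bimodule_ring_bimodule[OF ring_S R.ring_axioms \<psi>_hom])

lemma S\<psi>_simps [simp]:
  "carrier S\<psi> = carrier S" "s \<oplus>\<^bsub>S\<psi>\<^esub> t = s \<oplus>\<^bsub>S\<^esub> t" "s \<odot>\<^bsub>S\<psi>\<^esub> t = s \<otimes>\<^bsub>S\<^esub> t" "s \<bullet>\<^bsub>S\<psi>\<^esub> r = s \<otimes>\<^bsub>S\<^esub> \<psi> r"
  by (simp_all add: ring_bimodule_def)

sublocale SP: bimodule_tensor_product R S\<psi> P S
  by (intro bimodule_tensor_product.intro tensor_product.intro bimodule_tensor_product_axioms.intro
      S\<psi>.right_module_axioms P.left_module_axioms S\<psi>.bimodule_axioms)

sublocale SQ: bimodule_tensor_product R S\<psi> Q S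
  by (intro bimodule_tensor_product.intro tensor_product.intro bimodule_tensor_product_axioms.intro
      S\<psi>.right_module_axioms Q.left_module_axioms S\<psi>.bimodule_axioms)

abbreviation "id_\<sigma> \<equiv> tensor_map R S\<psi> P S\<psi> Q (\<lambda>x. x) \<sigma>"

lemmas id_\<sigma>_hom = tensor_map_hom[OF SP.bimodule_tensor_product_axioms SQ.bimodule_tensor_product_axioms
    bimodule_hom_id \<sigma>_hom]

lemma P_carrier: "y \<in> carrier P \<longleftrightarrow> (\<exists>a\<in>carrier A. y = (a, \<zero>\<^bsub>B\<^esub>))"
  by (auto simp: first_column_def)

lemma Q_carrier: "y \<in> carrier Q \<longleftrightarrow> (\<exists>m\<in>carrier M. \<exists>b\<in>carrier B. y = (m, b))"
  by (auto simp: second_column_def)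

text \<open>The column \<open>P\<close> is generated by (1, 0), so every pure tensor can be moved
  onto that generator. This realizes \<open>S\<close> tensor \<open>P\<close> as the left ideal S
  \<open>\<epsilon>1\<close>; the next lemma does the same for \<open>Q\<close>, with generator (0,
  1) and left ideal S \<open>\<epsilon>2\<close>.\<close>

lemma SP_pure:
  assumes "s \<in> carrier S" "a \<in> carrier A"
  shows "SP.pt s (a, \<zero>\<^bsub>B\<^esub>) = SP.pt (s \<otimes>\<^bsub>S\<^esub> \<alpha> a) (\<one>\<^bsub>A\<^esub>, \<zero>\<^bsub>B\<^esub>)"
  using SP.pure_balanced[of s "(a, \<zero>\<^bsub>M\<^esub>, \<zero>\<^bsub>B\<^esub>)" "(\<one>\<^bsub>A\<^esub>, \<zero>\<^bsub>B\<^esub>)"] assms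
  by (simp add: P_carrier) (simp add: first_column_def)

lemma SQ_pure:
  assumes "s \<in> carrier S" "m \<in> carrier M" "b \<in> carrier B"
  shows "SQ.pt s (m, b) = SQ.pt (s \<otimes>\<^bsub>S\<^esub> \<psi> (\<zero>\<^bsub>A\<^esub>, m, b)) (\<zero>\<^bsub>M\<^esub>, \<one>\<^bsub>B\<^esub>)"
  using SQ.pure_balanced[of s "(\<zero>\<^bsub>A\<^esub>, m, b)" "(\<zero>\<^bsub>M\<^esub>, \<one>\<^bsub>B\<^esub>)"] assms
  by (simp add: Q_carrier) (simp add: second_column_def)

text \<open>Since \<open>\<mu>\<close> of \<open>a\<close> times \<open>p\<close> is
  \<open>\<alpha> a\<close> times \<open>\<pi>\<close>, this exhibits id tensor
  \<open>\<sigma>\<close> as right multiplication by \<open>\<pi>\<close> from S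
  \<open>\<epsilon>1\<close> to S \<open>\<epsilon>2\<close>.\<close>

lemma id_\<sigma>_pure:
  assumes "s \<in> carrier S" "a \<in> carrier A"
  shows "id_\<sigma> (SP.pt s (a, \<zero>\<^bsub>B\<^esub>)) = SQ.pt (s \<otimes>\<^bsub>S\<^esub> \<mu> (a \<odot>\<^bsub>M\<^esub> p)) (\<zero>\<^bsub>M\<^esub>, \<one>\<^bsub>B\<^esub>)"
  using tensor_map_pure[OF SP.bimodule_tensor_product_axioms SQ.bimodule_tensor_product_axioms
    bimodule_hom_id \<sigma>_hom, of s "(a, \<zero>\<^bsub>B\<^esub>)"] assms
  by (simp add: P_carrier \<sigma>_eq SQ_pure[of s "a \<odot>\<^bsub>M\<^esub> p"])

text \<open>Right multiplication by \<open>q\<close> undoes right multiplication by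
  \<open>\<pi>\<close>, because \<open>\<epsilon>1\<close> and \<open>\<epsilon>2\<close> act as
  right identities on the two left ideals.\<close>

lemma sigma_inverting_if:
  assumes q: "q \<in> carrier S" "\<pi> \<otimes>\<^bsub>S\<^esub> q = \<epsilon>1" "q \<otimes>\<^bsub>S\<^esub> \<pi> = \<epsilon>2"
  shows "sigma_inverting R P Q \<sigma> S \<psi>"
proof -
  \<comment> \<open>The pair (m, b) is read as the element (0, m, b) of \<open>R\<close>; its image
    is multiplied by \<open>q\<close> and the result placed on the generator (1, 0) of
    \<open>P\<close>.\<close>
  define \<gamma> where "\<gamma> = (\<lambda>s (m, b). SP.pt (s \<otimes>\<^bsub>S\<^esub> \<psi> (\<zero>\<^bsub>A\<^esub>, m, b) \<otimes>\<^bsub>S\<^esub> q) (\<one>\<^bsub>A\<^esub>, \<zero>\<^bsub>B\<^esub>))"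
  have one: "(\<one>\<^bsub>A\<^esub>, \<zero>\<^bsub>B\<^esub>) \<in> carrier P" by (simp add: P_carrier)
  have bal: "balanced R S\<psi> Q SP.XY \<gamma>"
  proof (rule balancedI)
    fix s y assume "s \<in> carrier S\<psi>" "y \<in> carrier Q"
    then show "\<gamma> s y \<in> carrier SP.XY"
      using q(1) by (auto simp: \<gamma>_def Q_carrier one)
  next
    fix s s' y assume "s \<in> carrier S\<psi>" "s' \<in> carrier S\<psi>" "y \<in> carrier Q"
    then show "\<gamma> (s \<oplus>\<^bsub>S\<psi>\<^esub> s') y = \<gamma> s y \<oplus>\<^bsub>SP.XY\<^esub> \<gamma> s' y"
      using q(1) SP.pure_add_left[OF _ _ one] by (auto simp: \<gamma>_def Q_carrier S.l_distr)
  next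
    fix s y y' assume "s \<in> carrier S\<psi>" "y \<in> carrier Q" "y' \<in> carrier Q"
    then obtain m b m' b' where *: "s \<in> carrier S" "m \<in> carrier M" "b \<in> carrier B" "m' \<in> carrier M" "b' \<in> carrier B"
        "y = (m, b)" "y' = (m', b')"
      by (auto simp: Q_carrier)
    then have "\<psi> (\<zero>\<^bsub>A\<^esub>, m \<oplus>\<^bsub>M\<^esub> m', b \<oplus>\<^bsub>B\<^esub> b') = \<psi> (\<zero>\<^bsub>A\<^esub>, m, b) \<oplus>\<^bsub>S\<^esub> \<psi> (\<zero>\<^bsub>A\<^esub>, m', b')"
      by (simp add: \<psi>_add[symmetric])
    then show "\<gamma> s (y \<oplus>\<^bsub>Q\<^esub> y') = \<gamma> s y \<oplus>\<^bsub>SP.XY\<^esub> \<gamma> s y'"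
      using q(1) * SP.pure_add_left[OF _ _ one] by (simp add: \<gamma>_def second_column_def S.l_distr S.r_distr)
  next
    fix s r y assume "s \<in> carrier S\<psi>" "r \<in> carrier R" "y \<in> carrier Q"
    then obtain m b a' m' b' where *: "s \<in> carrier S" "m \<in> carrier M" "b \<in> carrier B"
        "a' \<in> carrier A" "m' \<in> carrier M" "b' \<in> carrier B" "y = (m, b)" "r = (a', m', b')"
      by (cases r) (auto simp: Q_carrier)
    then show "\<gamma> (s \<bullet>\<^bsub>S\<psi>\<^esub> r) y = \<gamma> s (r \<odot>\<^bsub>Q\<^esub> y)"
      using q(1) by (simp add: \<gamma>_def second_column_def S.m_assoc) (simp add: \<psi>_mult S.m_assoc[symmetric])
  qed
  let ?k = "tensor_lift R S\<psi> Q SP.XY \<gamma>"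
  note k_add = SQ.tensor_lift_additive[OF SP.XY.abelian_group_axioms bal]
    and k_pure = SQ.tensor_lift_pure[OF SP.XY.abelian_group_axioms bal]
  have id_add: "id_\<sigma> \<in> additive SP.XY SQ.XY"
    by (rule left_module_hom_additive[OF id_\<sigma>_hom])
  have "id_\<sigma> \<in> left_module_iso S SP.XY SQ.XY"
  proof (rule left_module_isoI[OF id_\<sigma>_hom])
    show "?k \<in> carrier SQ.XY \<rightarrow> carrier SP.XY"
      using additive_closed[OF k_add] by blast
  next
    fix u assume u: "u \<in> carrier SP.XY"
    show "?k (id_\<sigma> u) = u"
    proof (rule SP.tensor_hom_eqI[OF additive_comp[OF id_add k_add] _ _ u])
      show "(\<lambda>u. u) \<in> additive SP.XY SP.XY" by (rule additiveI) auto
      fix s y assume "s \<in> carrier S\<psi>" "y \<in> carrier P"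
      then obtain a where a: "s \<in> carrier S" "a \<in> carrier A" "y = (a, \<zero>\<^bsub>B\<^esub>)"
        by (auto simp: P_carrier)
      \<comment> \<open>The factor \<open>\<epsilon>2\<close> is the ring element that
        \<open>\<gamma>\<close> attaches to the generator (0, 1) of \<open>Q\<close>.\<close>
      have "\<mu> (a \<odot>\<^bsub>M\<^esub> p) \<otimes>\<^bsub>S\<^esub> \<epsilon>2 \<otimes>\<^bsub>S\<^esub> q = (\<alpha> a \<otimes>\<^bsub>S\<^esub> \<pi>) \<otimes>\<^bsub>S\<^esub> q"
        using a by (simp add: \<psi>_mult)
      also have "\<dots> = \<alpha> a"
        using a q(1) by (simp add: S.m_assoc q(2)) (simp add: \<psi>_mult)
      finally have "\<mu> (a \<odot>\<^bsub>M\<^esub> p) \<otimes>\<^bsub>S\<^esub> \<epsilon>2 \<otimes>\<^bsub>S\<^esub> q = \<alpha> a" .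
      then show "?k (id_\<sigma> (SP.pt s y)) = SP.pt s y"
        using a q(1) by (simp add: id_\<sigma>_pure k_pure Q_carrier) (simp add: \<gamma>_def S.m_assoc SP_pure[of s a])
    qed
  next
    fix u assume u: "u \<in> carrier SQ.XY"
    show "id_\<sigma> (?k u) = u"
    proof (rule SQ.tensor_hom_eqI[OF additive_comp[OF k_add id_add] _ _ u])
      show "(\<lambda>u. u) \<in> additive SQ.XY SQ.XY" by (rule additiveI) auto
      fix s y assume "s \<in> carrier S\<psi>" "y \<in> carrier Q"
      then obtain m b where a: "s \<in> carrier S" "m \<in> carrier M" "b \<in> carrier B" "y = (m, b)"
        by (auto simp: Q_carrier)
      then have "\<psi> (\<zero>\<^bsub>A\<^esub>, m, b) \<otimes>\<^bsub>S\<^esub> q \<otimes>\<^bsub>S\<^esub> \<pi> = \<psi> (\<zero>\<^bsub>A\<^esub>, m, b)"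
        using q by (simp add: S.m_assoc) (simp add: \<psi>_mult)
      then show "id_\<sigma> (?k (SQ.pt s y)) = SQ.pt s y"
        using a q(1) by (simp add: k_pure Q_carrier) (simp add: \<gamma>_def id_\<sigma>_pure S.m_assoc SQ_pure[of s m b])
    qed
  qed
  then show ?thesis
    by (simp add: sigma_inverting_def ring_S \<psi>_hom)
qed

text \<open>Surjectivity of id tensor \<open>\<sigma>\<close> yields a left inverse t of
  \<open>\<pi>\<close>, injectivity shows that t is also a right inverse on the corner, and cutting
  t down by the two idempotents gives \<open>q\<close>.\<close>

lemma sigma_inverting_imp:
  assumes "sigma_inverting R P Q \<sigma> S \<psi>"
  obtains q where "q \<in> carrier S" "\<pi> \<otimes>\<^bsub>S\<^esub> q = \<epsilon>1" "q \<otimes>\<^bsub>S\<^esub> \<pi> = \<epsilon>2" "\<epsilon>2 \<otimes>\<^bsub>S\<^esub> q = q" "q \<otimes>\<^bsub>S\<^esub> \<epsilon>1 = q"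
proof -
  have bij: "bij_betw id_\<sigma> (carrier SP.XY) (carrier SQ.XY)"
    using assms by (simp add: sigma_inverting_def left_module_iso_def)
  \<comment> \<open>\<open>\<gamma>\<close> and \<open>\<delta>\<close> read a column as an element
    of \<open>R\<close> and multiply in \<open>S\<close>; their lifts evaluate the two tensor
    products inside \<open>S\<close>, where equations between tensors become equations between
    elements.\<close>
  define \<gamma> where "\<gamma> = (\<lambda>s (a, b :: 'b). s \<otimes>\<^bsub>S\<^esub> \<alpha> a)"
  define \<delta> where "\<delta> = (\<lambda>s (m, b). s \<otimes>\<^bsub>S\<^esub> \<psi> (\<zero>\<^bsub>A\<^esub>, m, b))"
  have bal_\<gamma>: "balanced R S\<psi> P S \<gamma>"
    by (rule balancedI) (auto simp: \<gamma>_def first_column_def S.l_distr S.m_assoc \<psi>_mult S.r_distr[symmetric] \<psi>_add[symmetric])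
  have bal_\<delta>: "balanced R S\<psi> Q S \<delta>"
    by (rule balancedI) (auto simp: \<delta>_def second_column_def S.l_distr S.m_assoc \<psi>_mult S.r_distr[symmetric] \<psi>_add[symmetric])
  let ?e = "tensor_lift R S\<psi> P S \<gamma>" and ?d = "tensor_lift R S\<psi> Q S \<delta>"
  note e_add = SP.tensor_lift_additive[OF S.abelian_group_axioms bal_\<gamma>]
    and e_pure = SP.tensor_lift_pure[OF S.abelian_group_axioms bal_\<gamma>]
    and d_add = SQ.tensor_lift_additive[OF S.abelian_group_axioms bal_\<delta>]
    and d_pure = SQ.tensor_lift_pure[OF S.abelian_group_axioms bal_\<delta>]
  have id_add: "id_\<sigma> \<in> additive SP.XY SQ.XY"
    by (rule left_module_hom_additive[OF id_\<sigma>_hom])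
  have de: "?d (id_\<sigma> u) = ?e u \<otimes>\<^bsub>S\<^esub> \<pi>" if u: "u \<in> carrier SP.XY" for u
  proof (rule SP.tensor_hom_eqI[OF additive_comp[OF id_add d_add] _ _ u])
    show "(\<lambda>u. ?e u \<otimes>\<^bsub>S\<^esub> \<pi>) \<in> additive SP.XY S"
      by (rule additiveI) (simp_all add: additive_closed[OF e_add] additive_add[OF e_add] S.l_distr)
    fix s y assume "s \<in> carrier S\<psi>" "y \<in> carrier P"
    then obtain a where a: "s \<in> carrier S" "a \<in> carrier A" "y = (a, \<zero>\<^bsub>B\<^esub>)"
      by (auto simp: P_carrier)
    then show "?d (id_\<sigma> (SP.pt s y)) = ?e (SP.pt s y) \<otimes>\<^bsub>S\<^esub> \<pi>"
      by (simp add: id_\<sigma>_pure d_pure e_pure P_carrier Q_carrier)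
         (simp add: \<gamma>_def \<delta>_def S.m_assoc \<psi>_mult)
  qed
  have one_Q: "SQ.pt \<one>\<^bsub>S\<^esub> (\<zero>\<^bsub>M\<^esub>, \<one>\<^bsub>B\<^esub>) \<in> carrier SQ.XY"
    by (simp add: Q_carrier)
  \<comment> \<open>A preimage of the generator 1 tensor (0, 1), whose value in \<open>S\<close> is
    \<open>\<epsilon>2\<close>, evaluates to a left inverse of \<open>\<pi>\<close>.\<close>
  then have "SQ.pt \<one>\<^bsub>S\<^esub> (\<zero>\<^bsub>M\<^esub>, \<one>\<^bsub>B\<^esub>) \<in> id_\<sigma> ` carrier SP.XY"
    by (simp only: bij_betw_imp_surj_on[OF bij])
  then obtain u where u: "u \<in> carrier SP.XY" "id_\<sigma> u = SQ.pt \<one>\<^bsub>S\<^esub> (\<zero>\<^bsub>M\<^esub>, \<one>\<^bsub>B\<^esub>)"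
    by (elim imageE) (rule that, simp_all only:)
  define t where "t = ?e u"
  have t: "t \<in> carrier S"
    using additive_closed[OF e_add u(1)] by (simp add: t_def)
  have t\<pi>: "t \<otimes>\<^bsub>S\<^esub> \<pi> = \<epsilon>2"
    using de[OF u(1)] by (simp add: u(2) d_pure Q_carrier t_def) (simp add: \<delta>_def)
  \<comment> \<open>Both tensors are sent to \<open>\<pi>\<close> tensor (0, 1): on the left t
    \<open>\<pi>\<close> = \<open>\<epsilon>2\<close> and \<open>\<pi>\<close> absorbs
    \<open>\<epsilon>2\<close>, on the right \<open>\<epsilon>1\<close> is absorbed by
    \<open>\<pi>\<close>.\<close>
  have "id_\<sigma> (SP.pt (\<pi> \<otimes>\<^bsub>S\<^esub> t) (\<one>\<^bsub>A\<^esub>, \<zero>\<^bsub>B\<^esub>)) = id_\<sigma> (SP.pt \<epsilon>1 (\<one>\<^bsub>A\<^esub>, \<zero>\<^bsub>B\<^esub>))"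
    using t by (simp add: id_\<sigma>_pure S.m_assoc t\<pi>) (simp add: \<psi>_mult)
  then have "SP.pt (\<pi> \<otimes>\<^bsub>S\<^esub> t) (\<one>\<^bsub>A\<^esub>, \<zero>\<^bsub>B\<^esub>) = SP.pt \<epsilon>1 (\<one>\<^bsub>A\<^esub>, \<zero>\<^bsub>B\<^esub>)"
    using t by (intro inj_onD[OF bij_betw_imp_inj_on[OF bij]]) (auto simp: P_carrier)
  then have "?e (SP.pt (\<pi> \<otimes>\<^bsub>S\<^esub> t) (\<one>\<^bsub>A\<^esub>, \<zero>\<^bsub>B\<^esub>)) = ?e (SP.pt \<epsilon>1 (\<one>\<^bsub>A\<^esub>, \<zero>\<^bsub>B\<^esub>))"
    by simp
  then have \<pi>t: "\<pi> \<otimes>\<^bsub>S\<^esub> t \<otimes>\<^bsub>S\<^esub> \<epsilon>1 = \<epsilon>1"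
    using t by (simp add: e_pure P_carrier) (simp add: \<gamma>_def \<psi>_mult)
  have idem: "\<epsilon>1 \<otimes>\<^bsub>S\<^esub> \<epsilon>1 = \<epsilon>1" "\<epsilon>2 \<otimes>\<^bsub>S\<^esub> \<epsilon>2 = \<epsilon>2" "\<epsilon>1 \<otimes>\<^bsub>S\<^esub> \<pi> = \<pi>" "\<pi> \<otimes>\<^bsub>S\<^esub> \<epsilon>2 = \<pi>"
    by (simp_all add: \<psi>_mult)
  show thesis
  proof (rule that)
    \<comment> \<open>Compressing t to the corner (2,1) preserves both inverse equations and adds
      the two absorption laws that matrix units require.\<close>
    let ?q = "\<epsilon>2 \<otimes>\<^bsub>S\<^esub> t \<otimes>\<^bsub>S\<^esub> \<epsilon>1"
    show "?q \<in> carrier S" using t by simp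
    have "\<pi> \<otimes>\<^bsub>S\<^esub> ?q = (\<pi> \<otimes>\<^bsub>S\<^esub> \<epsilon>2) \<otimes>\<^bsub>S\<^esub> t \<otimes>\<^bsub>S\<^esub> \<epsilon>1"
      using t by (simp add: S.m_assoc)
    then show "\<pi> \<otimes>\<^bsub>S\<^esub> ?q = \<epsilon>1" by (simp only: idem \<pi>t)
    show "?q \<otimes>\<^bsub>S\<^esub> \<pi> = \<epsilon>2" using t by (simp add: S.m_assoc idem t\<pi>)
    have "\<epsilon>2 \<otimes>\<^bsub>S\<^esub> ?q = (\<epsilon>2 \<otimes>\<^bsub>S\<^esub> \<epsilon>2) \<otimes>\<^bsub>S\<^esub> t \<otimes>\<^bsub>S\<^esub> \<epsilon>1"
      using t by (simp add: S.m_assoc)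
    then show "\<epsilon>2 \<otimes>\<^bsub>S\<^esub> ?q = ?q" by (simp only: idem)
    show "?q \<otimes>\<^bsub>S\<^esub> \<epsilon>1 = ?q" using t by (simp add: S.m_assoc idem)
  qed
qed

end

section \<open>Matrix units and morphisms out of the full matrix ring\<close>

lemma mat2_ring_hom_matrix_units:
  assumes T: "ring T" and S: "ring S" and k: "k \<in> ring_hom T S"
    and closed: "e11 \<in> carrier S" "e12 \<in> carrier S" "e21 \<in> carrier S" "e22 \<in> carrier S"
    and one: "e11 \<oplus>\<^bsub>S\<^esub> e22 = \<one>\<^bsub>S\<^esub>"
    and units: "e11 \<otimes>\<^bsub>S\<^esub> e11 = e11" "e11 \<otimes>\<^bsub>S\<^esub> e12 = e12" "e11 \<otimes>\<^bsub>S\<^esub> e21 = \<zero>\<^bsub>S\<^esub>" "e11 \<otimes>\<^bsub>S\<^esub> e22 = \<zero>\<^bsub>S\<^esub>"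
      "e12 \<otimes>\<^bsub>S\<^esub> e11 = \<zero>\<^bsub>S\<^esub>" "e12 \<otimes>\<^bsub>S\<^esub> e12 = \<zero>\<^bsub>S\<^esub>" "e12 \<otimes>\<^bsub>S\<^esub> e21 = e11" "e12 \<otimes>\<^bsub>S\<^esub> e22 = e12"
      "e21 \<otimes>\<^bsub>S\<^esub> e11 = e21" "e21 \<otimes>\<^bsub>S\<^esub> e12 = e22" "e21 \<otimes>\<^bsub>S\<^esub> e21 = \<zero>\<^bsub>S\<^esub>" "e21 \<otimes>\<^bsub>S\<^esub> e22 = \<zero>\<^bsub>S\<^esub>"
      "e22 \<otimes>\<^bsub>S\<^esub> e11 = \<zero>\<^bsub>S\<^esub>" "e22 \<otimes>\<^bsub>S\<^esub> e12 = \<zero>\<^bsub>S\<^esub>" "e22 \<otimes>\<^bsub>S\<^esub> e21 = e21" "e22 \<otimes>\<^bsub>S\<^esub> e22 = e22"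
    and commute: "\<And>t e. \<lbrakk>t \<in> carrier T; e \<in> {e11, e12, e21, e22}\<rbrakk> \<Longrightarrow> e \<otimes>\<^bsub>S\<^esub> k t = k t \<otimes>\<^bsub>S\<^esub> e"
  shows "(\<lambda>((a, b), (c, d)). k a \<otimes>\<^bsub>S\<^esub> e11 \<oplus>\<^bsub>S\<^esub> k b \<otimes>\<^bsub>S\<^esub> e12 \<oplus>\<^bsub>S\<^esub> k c \<otimes>\<^bsub>S\<^esub> e21 \<oplus>\<^bsub>S\<^esub> k d \<otimes>\<^bsub>S\<^esub> e22)
    \<in> ring_hom (mat2_ring T) S" (is "?F \<in> _")
proof -
  interpret T: ring T by fact
  interpret S: ring S by fact
  note k' = ring_hom_memE[OF k] and k_zero = ring_hom_zero[OF k T S]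
  \<comment> \<open>Since the units commute with the image of \<open>k\<close>, coefficients and
    units multiply separately. Multiplicativity of \<open>?F\<close> is then the expansion into
    sixteen products, eight of which vanish by the multiplication table.\<close>
  have prod: "k u \<otimes>\<^bsub>S\<^esub> e \<otimes>\<^bsub>S\<^esub> (k v \<otimes>\<^bsub>S\<^esub> e') = k (u \<otimes>\<^bsub>T\<^esub> v) \<otimes>\<^bsub>S\<^esub> (e \<otimes>\<^bsub>S\<^esub> e')"
    if uv: "u \<in> carrier T" "v \<in> carrier T" and e: "e \<in> {e11, e12, e21, e22}" "e' \<in> {e11, e12, e21, e22}" for u v e e'
  proof -
    have c: "e \<in> carrier S" "e' \<in> carrier S" "k u \<in> carrier S" "k v \<in> carrier S"
      using e closed uv k'(1) by auto
    have "k u \<otimes>\<^bsub>S\<^esub> e \<otimes>\<^bsub>S\<^esub> (k v \<otimes>\<^bsub>S\<^esub> e') = k u \<otimes>\<^bsub>S\<^esub> (e \<otimes>\<^bsub>S\<^esub> k v) \<otimes>\<^bsub>S\<^esub> e'"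
      using c by (simp add: S.m_assoc)
    also have "\<dots> = k u \<otimes>\<^bsub>S\<^esub> k v \<otimes>\<^bsub>S\<^esub> (e \<otimes>\<^bsub>S\<^esub> e')"
      using c by (simp only: commute[OF uv(2) e(1)]) (simp add: S.m_assoc)
    finally show ?thesis using uv by (simp add: k'(2))
  qed
  show ?thesis
  proof (rule ring_hom_memI)
    fix X Y assume "X \<in> carrier (mat2_ring T)" "Y \<in> carrier (mat2_ring T)"
    then obtain a b c d a' b' c' d' where
      XY: "X = ((a, b), (c, d))" "Y = ((a', b'), (c', d'))"
      and in_T: "a \<in> carrier T" "b \<in> carrier T" "c \<in> carrier T" "d \<in> carrier T"
        "a' \<in> carrier T" "b' \<in> carrier T" "c' \<in> carrier T" "d' \<in> carrier T"
      by (auto simp: mat2_ring_def)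
    show "?F (X \<otimes>\<^bsub>mat2_ring T\<^esub> Y) = ?F X \<otimes>\<^bsub>S\<^esub> ?F Y"
      using in_T closed
      by (simp add: XY mat2_ring_def S.l_distr S.r_distr k'(1) prod units)
         (simp add: k'(1,3) S.l_distr S.a_ac)
    show "?F (X \<oplus>\<^bsub>mat2_ring T\<^esub> Y) = ?F X \<oplus>\<^bsub>S\<^esub> ?F Y"
      using in_T closed by (simp add: XY mat2_ring_def k'(1,3) S.l_distr S.a_ac)
  qed (use closed in \<open>auto simp: mat2_ring_def k'(1,4) k_zero one\<close>)
qed

context ring_morphism_data
begin

text \<open>Existence combines the universal property of \<open>T\<close> with the extension along
  matrix units. Uniqueness holds because the images of E11, E12 and E22 are prescribed by
  \<open>\<psi>\<close>, the image of E21 is forced as an inverse, and the image of a scalar matrix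
  is forced by that of the generators of \<open>T\<close>.\<close>

lemma localization_factor:
  assumes q: "q \<in> carrier S" "\<pi> \<otimes>\<^bsub>S\<^esub> q = \<epsilon>1" "q \<otimes>\<^bsub>S\<^esub> \<pi> = \<epsilon>2" "\<epsilon>2 \<otimes>\<^bsub>S\<^esub> q = q" "q \<otimes>\<^bsub>S\<^esub> \<epsilon>1 = q"
  shows "\<exists>h \<in> ring_hom (mat2_ring T) S. (\<forall>r\<in>carrier R. h (\<phi> r) = \<psi> r) \<and>
    (\<forall>h' \<in> ring_hom (mat2_ring T) S. (\<forall>r\<in>carrier R. h' (\<phi> r) = \<psi> r) \<longrightarrow>
      (\<forall>X\<in>carrier (mat2_ring T). h' X = h X))"
proof -
  have q\<epsilon>2: "q \<otimes>\<^bsub>S\<^esub> \<epsilon>2 = \<zero>\<^bsub>S\<^esub>"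
  proof -
    have "q \<otimes>\<^bsub>S\<^esub> \<epsilon>2 = q \<otimes>\<^bsub>S\<^esub> (\<epsilon>1 \<otimes>\<^bsub>S\<^esub> \<epsilon>2)"
      using q(1,5) by (simp add: S.m_assoc[symmetric])
    then show ?thesis using q(1) by (simp add: \<psi>_mult \<psi>_zero)
  qed
  have \<epsilon>1q: "\<epsilon>1 \<otimes>\<^bsub>S\<^esub> q = \<zero>\<^bsub>S\<^esub>"
  proof -
    have "\<epsilon>1 \<otimes>\<^bsub>S\<^esub> q = \<epsilon>1 \<otimes>\<^bsub>S\<^esub> \<epsilon>2 \<otimes>\<^bsub>S\<^esub> q"
      using q(1,4) by (simp add: S.m_assoc)
    then show ?thesis using q(1) by (simp add: \<psi>_mult \<psi>_zero)
  qed
  have qq: "q \<otimes>\<^bsub>S\<^esub> q = \<zero>\<^bsub>S\<^esub>"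
  proof -
    have "q \<otimes>\<^bsub>S\<^esub> q = q \<otimes>\<^bsub>S\<^esub> \<epsilon>1 \<otimes>\<^bsub>S\<^esub> q"
      using q(5) by simp
    then show ?thesis using q(1) by (simp add: S.m_assoc \<epsilon>1q)
  qed
  have unit_products: "\<epsilon>1 \<otimes>\<^bsub>S\<^esub> \<epsilon>1 = \<epsilon>1" "\<epsilon>2 \<otimes>\<^bsub>S\<^esub> \<epsilon>2 = \<epsilon>2" "\<epsilon>1 \<otimes>\<^bsub>S\<^esub> \<epsilon>2 = \<zero>\<^bsub>S\<^esub>" "\<epsilon>2 \<otimes>\<^bsub>S\<^esub> \<epsilon>1 = \<zero>\<^bsub>S\<^esub>"
    by (simp_all add: \<psi>_mult \<psi>_zero)
  have \<mu>_products: "\<epsilon>1 \<otimes>\<^bsub>S\<^esub> \<mu> m = \<mu> m" "\<mu> m \<otimes>\<^bsub>S\<^esub> \<epsilon>2 = \<mu> m" "\<epsilon>2 \<otimes>\<^bsub>S\<^esub> \<mu> m = \<zero>\<^bsub>S\<^esub>" "\<mu> m \<otimes>\<^bsub>S\<^esub> \<epsilon>1 = \<zero>\<^bsub>S\<^esub>"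
    if "m \<in> carrier M" for m
    using that by (simp_all add: \<psi>_mult \<psi>_zero)
  have \<mu>\<mu>: "\<mu> m \<otimes>\<^bsub>S\<^esub> \<mu> m' = \<zero>\<^bsub>S\<^esub>" if "m \<in> carrier M" "m' \<in> carrier M" for m m'
    using that by (simp add: \<psi>_mult \<psi>_zero)
  note cancel = q(2-5) q\<epsilon>2 \<epsilon>1q qq unit_products \<mu>_products \<mu>\<mu>
  \<comment> \<open>With products bracketed to the right, two factors that cancel are usually
    followed by a third. Every cancellation rule is therefore also given with a trailing factor
    \<open>w\<close>.\<close>
  have cancel_assoc: "u \<otimes>\<^bsub>S\<^esub> (v \<otimes>\<^bsub>S\<^esub> w) = z \<otimes>\<^bsub>S\<^esub> w"
    if "u \<otimes>\<^bsub>S\<^esub> v = z" "u \<in> carrier S" "v \<in> carrier S" "w \<in> carrier S" for u v w z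
    using that by (simp add: S.m_assoc[symmetric])
  have \<pi>qw: "\<pi> \<otimes>\<^bsub>S\<^esub> (q \<otimes>\<^bsub>S\<^esub> w) = \<epsilon>1 \<otimes>\<^bsub>S\<^esub> w" and q\<pi>w: "q \<otimes>\<^bsub>S\<^esub> (\<pi> \<otimes>\<^bsub>S\<^esub> w) = \<epsilon>2 \<otimes>\<^bsub>S\<^esub> w"
    and \<epsilon>2qw: "\<epsilon>2 \<otimes>\<^bsub>S\<^esub> (q \<otimes>\<^bsub>S\<^esub> w) = q \<otimes>\<^bsub>S\<^esub> w" and \<epsilon>1qw: "\<epsilon>1 \<otimes>\<^bsub>S\<^esub> (q \<otimes>\<^bsub>S\<^esub> w) = \<zero>\<^bsub>S\<^esub>"
    and qqw: "q \<otimes>\<^bsub>S\<^esub> (q \<otimes>\<^bsub>S\<^esub> w) = \<zero>\<^bsub>S\<^esub>"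
    if "w \<in> carrier S" for w
    using that q(1) by (simp_all add: cancel_assoc[OF q(2)] cancel_assoc[OF q(3)] cancel_assoc[OF q(4)]
        cancel_assoc[OF \<epsilon>1q] cancel_assoc[OF qq])
  have \<mu>w: "\<epsilon>1 \<otimes>\<^bsub>S\<^esub> (\<mu> m \<otimes>\<^bsub>S\<^esub> w) = \<mu> m \<otimes>\<^bsub>S\<^esub> w" "\<epsilon>2 \<otimes>\<^bsub>S\<^esub> (\<mu> m \<otimes>\<^bsub>S\<^esub> w) = \<zero>\<^bsub>S\<^esub>"
    if "m \<in> carrier M" "w \<in> carrier S" for m w
    using that by (simp_all add: cancel_assoc[OF \<mu>_products(1)] cancel_assoc[OF \<mu>_products(3)])
  have \<mu>\<mu>w: "\<mu> m \<otimes>\<^bsub>S\<^esub> (\<mu> m' \<otimes>\<^bsub>S\<^esub> w) = \<zero>\<^bsub>S\<^esub>"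
    if "m \<in> carrier M" "m' \<in> carrier M" "w \<in> carrier S" for m m' w
    using that by (simp add: cancel_assoc[OF \<mu>\<mu>])
  note cancel = cancel \<pi>qw q\<pi>w \<epsilon>2qw \<epsilon>1qw qqw \<mu>w \<mu>\<mu>w

  \<comment> \<open>The two summands are the diagonal blocks of \<open>y m\<close>, in the corners
    (1,1) and (2,2).\<close>
  define y where "y = (\<lambda>m. \<mu> m \<otimes>\<^bsub>S\<^esub> q \<oplus>\<^bsub>S\<^esub> q \<otimes>\<^bsub>S\<^esub> \<mu> m)"
  have y_closed: "y m \<in> carrier S" if "m \<in> carrier M" for m
    using that q(1) by (simp add: y_def)
  \<comment> \<open>On \<open>a\<close> times \<open>p\<close> the (1,1) block of \<open>y\<close>
    is \<open>\<alpha> a\<close>, and by \<open>\<mu>\<beta>\<close> below the (2,2) block of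
    \<open>y\<close> on \<open>p\<close> times \<open>b\<close> is \<open>\<beta> b\<close>. These
    values turn the relations of \<open>T\<close> into the bimodule laws for
    \<open>\<mu>\<close>.\<close>
  have \<alpha>\<mu>: "\<mu> (a \<odot>\<^bsub>M\<^esub> p) \<otimes>\<^bsub>S\<^esub> (q \<otimes>\<^bsub>S\<^esub> w) = \<alpha> a \<otimes>\<^bsub>S\<^esub> w" "\<mu> (a \<odot>\<^bsub>M\<^esub> p) \<otimes>\<^bsub>S\<^esub> q = \<alpha> a"
    if "a \<in> carrier A" "w \<in> carrier S" for a w
  proof -
    have *: "\<mu> (a \<odot>\<^bsub>M\<^esub> p) = \<alpha> a \<otimes>\<^bsub>S\<^esub> \<pi>" "\<alpha> a \<otimes>\<^bsub>S\<^esub> \<epsilon>1 = \<alpha> a"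
      using that by (simp_all add: \<psi>_mult)
    show "\<mu> (a \<odot>\<^bsub>M\<^esub> p) \<otimes>\<^bsub>S\<^esub> q = \<alpha> a"
      using that q(1) *(2) by (simp only: *(1)) (simp add: S.m_assoc q(2))
    then show "\<mu> (a \<odot>\<^bsub>M\<^esub> p) \<otimes>\<^bsub>S\<^esub> (q \<otimes>\<^bsub>S\<^esub> w) = \<alpha> a \<otimes>\<^bsub>S\<^esub> w"
      using that q(1) by (intro cancel_assoc) simp_all
  qed
  have \<alpha>qw: "\<alpha> a \<otimes>\<^bsub>S\<^esub> (q \<otimes>\<^bsub>S\<^esub> w) = \<zero>\<^bsub>S\<^esub>" if "a \<in> carrier A" "w \<in> carrier S" for a w
  proof -
    have "\<alpha> a \<otimes>\<^bsub>S\<^esub> q = \<alpha> a \<otimes>\<^bsub>S\<^esub> \<epsilon>2 \<otimes>\<^bsub>S\<^esub> q"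
      using that q(1,4) by (simp add: S.m_assoc)
    also have "\<dots> = \<zero>\<^bsub>S\<^esub>"
      using that q(1) by (simp add: \<psi>_mult \<psi>_zero)
    finally show ?thesis
      using that q(1) by (simp add: S.m_assoc[symmetric])
  qed
  have \<mu>\<beta>: "q \<otimes>\<^bsub>S\<^esub> \<mu> (p \<bullet>\<^bsub>M\<^esub> b) = \<beta> b" if "b \<in> carrier B" for b
  proof -
    have *: "\<mu> (p \<bullet>\<^bsub>M\<^esub> b) = \<pi> \<otimes>\<^bsub>S\<^esub> \<beta> b" "\<epsilon>2 \<otimes>\<^bsub>S\<^esub> \<beta> b = \<beta> b"
      using that by (simp_all add: \<psi>_mult)
    show ?thesis
      using that q(1) *(2) by (simp only: *(1)) (simp add: q\<pi>w)
  qed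
  have \<alpha>_\<mu>: "\<alpha> a \<otimes>\<^bsub>S\<^esub> \<mu> m = \<mu> (a \<odot>\<^bsub>M\<^esub> m)" if "a \<in> carrier A" "m \<in> carrier M" for a m
    using that by (simp add: \<psi>_mult)
  have \<mu>_\<beta>: "\<mu> m \<otimes>\<^bsub>S\<^esub> \<beta> b = \<mu> (m \<bullet>\<^bsub>M\<^esub> b)" if "m \<in> carrier M" "b \<in> carrier B" for m b
    using that by (simp add: \<psi>_mult)
  obtain k where k: "k \<in> ring_hom T S" and k_gen: "\<And>m. m \<in> carrier M \<Longrightarrow> k (x m) = y m"
  proof (rule T_universal[OF ring_S, of y])
    fix m m' assume "m \<in> carrier M" "m' \<in> carrier M"
    then show "y (m \<oplus>\<^bsub>M\<^esub> m') = y m \<oplus>\<^bsub>S\<^esub> y m'"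
      using q(1) by (simp add: y_def \<mu>_add S.l_distr S.r_distr S.a_ac)
  next
    fix a m assume *: "a \<in> carrier A" "m \<in> carrier M"
    have "y (a \<odot>\<^bsub>M\<^esub> p) \<otimes>\<^bsub>S\<^esub> y m = \<alpha> a \<otimes>\<^bsub>S\<^esub> (\<mu> m \<otimes>\<^bsub>S\<^esub> q) \<oplus>\<^bsub>S\<^esub> q \<otimes>\<^bsub>S\<^esub> (\<alpha> a \<otimes>\<^bsub>S\<^esub> \<mu> m)"
      using * q(1) by (simp add: y_def S.l_distr S.r_distr S.m_assoc cancel \<alpha>\<mu> \<alpha>qw)
    also have "\<dots> = y (a \<odot>\<^bsub>M\<^esub> m)"
      using * q(1) by (simp add: y_def S.m_assoc[symmetric] \<alpha>_\<mu>)
    finally show "y (a \<odot>\<^bsub>M\<^esub> p) \<otimes>\<^bsub>S\<^esub> y m = y (a \<odot>\<^bsub>M\<^esub> m)" .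
  next
    fix m b assume *: "m \<in> carrier M" "b \<in> carrier B"
    have "y m \<otimes>\<^bsub>S\<^esub> y (p \<bullet>\<^bsub>M\<^esub> b) = \<mu> m \<otimes>\<^bsub>S\<^esub> (q \<otimes>\<^bsub>S\<^esub> \<mu> (p \<bullet>\<^bsub>M\<^esub> b)) \<otimes>\<^bsub>S\<^esub> q \<oplus>\<^bsub>S\<^esub> q \<otimes>\<^bsub>S\<^esub> (\<mu> m \<otimes>\<^bsub>S\<^esub> (q \<otimes>\<^bsub>S\<^esub> \<mu> (p \<bullet>\<^bsub>M\<^esub> b)))"
      using * q(1) by (simp add: y_def S.l_distr S.r_distr S.m_assoc cancel)
    also have "\<dots> = y (m \<bullet>\<^bsub>M\<^esub> b)"
      using * q(1) by (simp add: y_def \<mu>\<beta> \<mu>_\<beta>)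
    finally show "y m \<otimes>\<^bsub>S\<^esub> y (p \<bullet>\<^bsub>M\<^esub> b) = y (m \<bullet>\<^bsub>M\<^esub> b)" .
  qed (use q(1) in \<open>simp_all add: y_closed y_def q(2,3) \<psi>_one\<close>)
  note k' = ring_hom_memE[OF k]
  \<comment> \<open>The elements whose image commutes with \<open>e\<close> form a subring, so
    generators suffice. There \<open>\<pi>\<close> times \<open>y m\<close> and \<open>y m\<close>
    times \<open>\<pi>\<close> are both \<open>\<mu> m\<close>, and on either side \<open>q\<close>
    gives \<open>q\<close> \<open>\<mu> m\<close> \<open>q\<close>.\<close>
  have commute: "e \<otimes>\<^bsub>S\<^esub> k t = k t \<otimes>\<^bsub>S\<^esub> e" if t: "t \<in> carrier T" and e: "e \<in> {\<epsilon>1, \<pi>, q, \<epsilon>2}" for t e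
    using t
  proof (induction t rule: T_induct)
    case (gen m)
    then show ?case
      using e q(1) by (elim insertE emptyE) (simp_all add: k_gen y_def S.l_distr S.r_distr S.m_assoc cancel)
  next
    case one
    then show ?case using e q(1) by (auto simp: k'(4))
  next
    case (diff s t)
    have "e \<in> carrier S" using e q(1) by auto
    moreover have "k (s \<ominus>\<^bsub>T\<^esub> t) = k s \<ominus>\<^bsub>S\<^esub> k t"
      using diff(1,2) additive_minus[OF T.abelian_group_axioms S.abelian_group_axioms ring_hom_in_hom(2)[OF k]]
      by (simp add: T.minus_eq S.minus_eq k'(3))
    ultimately show ?case
      using diff by (simp add: k'(1) S.minus_eq S.l_distr S.r_distr S.l_minus S.r_minus)
  next
    case (mult s t)
    have "e \<in> carrier S" using e q(1) by auto
    then have "e \<otimes>\<^bsub>S\<^esub> (k s \<otimes>\<^bsub>S\<^esub> k t) = (e \<otimes>\<^bsub>S\<^esub> k s) \<otimes>\<^bsub>S\<^esub> k t"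
      using mult(1,2) by (simp add: S.m_assoc k'(1))
    also have "\<dots> = k s \<otimes>\<^bsub>S\<^esub> (e \<otimes>\<^bsub>S\<^esub> k t)"
      using mult(1,2) \<open>e \<in> carrier S\<close> by (simp only: mult(3)) (simp add: S.m_assoc k'(1))
    also have "\<dots> = k s \<otimes>\<^bsub>S\<^esub> k t \<otimes>\<^bsub>S\<^esub> e"
      using mult(1,2) \<open>e \<in> carrier S\<close> by (simp only: mult(4)) (simp add: S.m_assoc k'(1))
    finally show ?case
      using mult(1,2) by (simp only: k'(2))
  qed
  define H where "H = (\<lambda>((a, b), (c, d)). k a \<otimes>\<^bsub>S\<^esub> \<epsilon>1 \<oplus>\<^bsub>S\<^esub> k b \<otimes>\<^bsub>S\<^esub> \<pi> \<oplus>\<^bsub>S\<^esub> k c \<otimes>\<^bsub>S\<^esub> q \<oplus>\<^bsub>S\<^esub> k d \<otimes>\<^bsub>S\<^esub> \<epsilon>2)"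
  have H: "H \<in> ring_hom (mat2_ring T) S"
    unfolding H_def
    by (rule mat2_ring_hom_matrix_units[OF T.ring_axioms ring_S k]) (use q(1) commute in \<open>auto simp: cancel \<psi>_one\<close>)
  have k_zero: "k \<zero>\<^bsub>T\<^esub> = \<zero>\<^bsub>S\<^esub>"
    by (rule ring_hom_zero[OF k T.ring_axioms ring_S])
  have H_\<phi>: "H (\<phi> r) = \<psi> r" if in_R: "r \<in> carrier R" for r
  proof -
    obtain a m b where r: "r = (a, m, b)" "a \<in> carrier A" "m \<in> carrier M" "b \<in> carrier B"
      using in_R by (cases r) auto
    have "k (x (a \<odot>\<^bsub>M\<^esub> p)) \<otimes>\<^bsub>S\<^esub> \<epsilon>1 = \<alpha> a"
      using r q(1) by (simp add: k_gen y_def S.l_distr S.m_assoc cancel \<alpha>\<mu>) (simp add: \<psi>_mult)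
    moreover have "k (x m) \<otimes>\<^bsub>S\<^esub> \<pi> = \<mu> m"
      using r q(1) by (simp add: k_gen y_def S.l_distr S.m_assoc cancel)
    moreover have "k (x (p \<bullet>\<^bsub>M\<^esub> b)) \<otimes>\<^bsub>S\<^esub> \<epsilon>2 = \<beta> b"
      using r q(1) by (simp add: k_gen y_def S.l_distr S.m_assoc cancel \<mu>\<beta>) (simp add: \<psi>_mult)
    ultimately show ?thesis
      using r q(1) \<psi>_split[of a m b] by (simp add: H_def localization_map_def rho_A_def rho_B_def k_zero)
  qed
  have unique: "h' X = H X" if h': "h' \<in> ring_hom (mat2_ring T) S" and h'_\<phi>: "\<forall>r\<in>carrier R. h' (\<phi> r) = \<psi> r"
    and X: "X \<in> carrier (mat2_ring T)" for h' X
  proof -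
    note h = ring_hom_memE[OF h']
    let ?M = "mat2_ring T"
    let ?z = "\<zero>\<^bsub>T\<^esub>" and ?o = "\<one>\<^bsub>T\<^esub>"
    let ?E11 = "((?o, ?z), (?z, ?z))" and ?E12 = "((?z, ?o), (?z, ?z))"
      and ?E21 = "((?z, ?z), (?o, ?z))" and ?E22 = "((?z, ?z), (?z, ?o))"
    let ?diag = "\<lambda>t. ((t, ?z), (?z, t))"
    have E_closed: "?E11 \<in> carrier ?M" "?E12 \<in> carrier ?M" "?E21 \<in> carrier ?M" "?E22 \<in> carrier ?M"
      and diag_closed: "t \<in> carrier T \<Longrightarrow> ?diag t \<in> carrier ?M" for t
      by (simp_all add: mat2_ring_def)
    have rho_zero: "rho_A A B M p \<zero>\<^bsub>A\<^esub> = ?z" "rho_B A B M p \<zero>\<^bsub>B\<^esub> = ?z"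
      by (simp_all add: rho_A_def rho_B_def gen_zero)
    have E11: "h' ?E11 = \<epsilon>1"
      using bspec[OF h'_\<phi>, of "(\<one>\<^bsub>A\<^esub>, \<zero>\<^bsub>M\<^esub>, \<zero>\<^bsub>B\<^esub>)"]
      by (simp add: localization_map_def rho_zero ring_hom_one[OF rho_A_hom] gen_zero)
    have E22: "h' ?E22 = \<epsilon>2"
      using bspec[OF h'_\<phi>, of "(\<zero>\<^bsub>A\<^esub>, \<zero>\<^bsub>M\<^esub>, \<one>\<^bsub>B\<^esub>)"]
      by (simp add: localization_map_def rho_zero ring_hom_one[OF rho_B_hom] gen_zero)
    have gen: "h' ((?z, x m), (?z, ?z)) = \<mu> m" if "m \<in> carrier M" for m
      using bspec[OF h'_\<phi>, of "(\<zero>\<^bsub>A\<^esub>, m, \<zero>\<^bsub>B\<^esub>)"] that by (simp add: localization_map_def rho_zero)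
    have E12: "h' ?E12 = \<pi>"
      using gen[OF p] by (simp add: gen_one)
    \<comment> \<open>The image of E21 absorbs \<open>\<epsilon>1\<close> on the right, and
      \<open>\<epsilon>1\<close> = \<open>\<pi>\<close> \<open>q\<close>; since E21 times E12 is
      E22, what remains is \<open>\<epsilon>2\<close> \<open>q\<close> = \<open>q\<close>.\<close>
    have E21: "h' ?E21 = q"
    proof -
      have "?E21 \<otimes>\<^bsub>?M\<^esub> ?E11 = ?E21" "?E21 \<otimes>\<^bsub>?M\<^esub> ?E12 = ?E22"
        by (simp_all add: mat2_ring_def)
      then have *: "h' ?E21 \<otimes>\<^bsub>S\<^esub> \<epsilon>1 = h' ?E21" "h' ?E21 \<otimes>\<^bsub>S\<^esub> \<pi> = \<epsilon>2"
        using h(2)[OF E_closed(3,1)] h(2)[OF E_closed(3,2)] by (simp_all add: E11 E12 E22)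
      have "h' ?E21 = h' ?E21 \<otimes>\<^bsub>S\<^esub> (\<pi> \<otimes>\<^bsub>S\<^esub> q)"
        using * by (simp add: q(2))
      also have "\<dots> = h' ?E21 \<otimes>\<^bsub>S\<^esub> \<pi> \<otimes>\<^bsub>S\<^esub> q"
        using h(1)[OF E_closed(3)] q(1) by (simp add: S.m_assoc)
      also have "\<dots> = q"
        by (simp add: * q(4))
      finally show ?thesis .
    qed
    have diag: "h' (?diag t) = k t" if "t \<in> carrier T" for t
      using that
    proof (induction t rule: T_induct)
      case (gen m)
      let ?X = "((?z, x m), (?z, ?z))"
      have X: "?X \<in> carrier ?M"
        using gen by (simp add: mat2_ring_def)
      \<comment> \<open>The definition of \<open>y\<close>, carried out inside the matrix ring with
        E21 in the role of \<open>q\<close>.\<close>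
      have "?diag (x m) = ?X \<otimes>\<^bsub>?M\<^esub> ?E21 \<oplus>\<^bsub>?M\<^esub> ?E21 \<otimes>\<^bsub>?M\<^esub> ?X"
        using gen by (simp add: mat2_ring_def)
      moreover have "?X \<otimes>\<^bsub>?M\<^esub> ?E21 \<in> carrier ?M" "?E21 \<otimes>\<^bsub>?M\<^esub> ?X \<in> carrier ?M"
        using gen by (simp_all add: mat2_ring_def)
      ultimately show ?case
        using gen by (simp add: h(2,3) X E_closed \<open>\<And>m. m \<in> carrier M \<Longrightarrow> h' ((?z, x m), (?z, ?z)) = \<mu> m\<close> E21 k_gen y_def)
    next
      case one
      have "?diag ?o = \<one>\<^bsub>?M\<^esub>" by (simp add: mat2_ring_def)
      then show ?case by (simp only: h(4) k'(4))
    next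
      case (diff s t)
      have st: "s \<ominus>\<^bsub>T\<^esub> t \<in> carrier T" using diff by simp
      have "?diag s = ?diag (s \<ominus>\<^bsub>T\<^esub> t) \<oplus>\<^bsub>?M\<^esub> ?diag t" "s = (s \<ominus>\<^bsub>T\<^esub> t) \<oplus>\<^bsub>T\<^esub> t"
        using diff by (simp_all add: mat2_ring_def T.minus_eq T.a_assoc T.l_neg)
      \<comment> \<open>Only the additivity of \<open>h'\<close> and \<open>k\<close> is used:
        adding \<open>k t\<close> to either side recovers the common value at \<open>s\<close>, and
        \<open>k t\<close> is then cancelled.\<close>
      then have "h' (?diag (s \<ominus>\<^bsub>T\<^esub> t)) \<oplus>\<^bsub>S\<^esub> k t = k (s \<ominus>\<^bsub>T\<^esub> t) \<oplus>\<^bsub>S\<^esub> k t"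
        using diff h(3)[OF diag_closed[OF st] diag_closed[OF diff(2)]] k'(3)[OF st diff(2)] by metis
      then show ?case
        using diff st h(1)[OF diag_closed[OF st]] by (simp add: k'(1))
    next
      case (mult s t)
      have "?diag (s \<otimes>\<^bsub>T\<^esub> t) = ?diag s \<otimes>\<^bsub>?M\<^esub> ?diag t"
        using mult by (simp add: mat2_ring_def)
      then show ?case
        using mult by (simp only: h(2) diag_closed k'(2))
    qed
    obtain a b c d where abcd: "X = ((a, b), (c, d))" "a \<in> carrier T" "b \<in> carrier T" "c \<in> carrier T" "d \<in> carrier T"
      using X by (auto simp: mat2_ring_def)
    \<comment> \<open>Every matrix is a combination of matrix units with scalar matrices as
      coefficients, so the values found so far determine \<open>h'\<close>.\<close>
    have *: "X = ?diag a \<otimes>\<^bsub>?M\<^esub> ?E11 \<oplus>\<^bsub>?M\<^esub> ?diag b \<otimes>\<^bsub>?M\<^esub> ?E12 \<oplus>\<^bsub>?M\<^esub> ?diag c \<otimes>\<^bsub>?M\<^esub> ?E21 \<oplus>\<^bsub>?M\<^esub> ?diag d \<otimes>\<^bsub>?M\<^esub> ?E22"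
      using abcd by (simp add: mat2_ring_def)
    interpret Mat: ring ?M by (rule ring_mat2_ring[OF T.ring_axioms])
    show ?thesis
      unfolding * using abcd
      by (simp add: h(2,3) Mat.m_closed Mat.a_closed diag_closed E_closed diag E11 E12 E21 E22)
         (simp add: H_def mat2_ring_def)
  qed
  show ?thesis
    using H H_\<phi> unique by blast
qed

end

section \<open>The matrix ring as universal localization\<close>

lemma (in localization_data) sigma_inverting_localization_map:
  "sigma_inverting R P Q \<sigma> (mat2_ring T) \<phi>"
proof -
  interpret ring_morphism_data A B M p \<sigma> "mat2_ring T" \<phi>
    by (intro ring_morphism_data.intro localization_data_axioms ring_morphism_data_axioms.intro
        ring_mat2_ring T.ring_axioms localization_map_hom)
  \<comment> \<open>As \<open>x p\<close> = 1, the image of the entry \<open>p\<close> is the matrix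
    unit E12, and E21 inverts it between the diagonal idempotents.\<close>
  let ?q = "((\<zero>\<^bsub>T\<^esub>, \<zero>\<^bsub>T\<^esub>), (\<one>\<^bsub>T\<^esub>, \<zero>\<^bsub>T\<^esub>))"
  show ?thesis
    by (rule sigma_inverting_if[of ?q])
       (simp_all add: localization_map_def mat2_ring_def gen_one gen_zero rho_A_def rho_B_def)
qed

lemma (in localization_data) universal_localization_mat2_ring:
  "universal_localization TYPE('t) R P Q \<sigma> (mat2_ring T) \<phi>"
  unfolding universal_localization_def
proof (intro conjI allI impI sigma_inverting_localization_map)
  fix S :: "'t ring" and \<psi> assume inv: "sigma_inverting R P Q \<sigma> S \<psi>"
  interpret ring_morphism_data A B M p \<sigma> S \<psi>
    by (intro ring_morphism_data.intro localization_data_axioms ring_morphism_data_axioms.intro)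
       (use inv in \<open>simp_all add: sigma_inverting_def\<close>)
  show "\<exists>h \<in> ring_hom (mat2_ring T) S. (\<forall>r\<in>carrier R. h (\<phi> r) = \<psi> r) \<and>
      (\<forall>h' \<in> ring_hom (mat2_ring T) S. (\<forall>r\<in>carrier R. h' (\<phi> r) = \<psi> r) \<longrightarrow>
        (\<forall>X\<in>carrier (mat2_ring T). h' X = h X))"
    by (rule sigma_inverting_imp[OF inv]) (rule localization_factor)
qed

section \<open>The localized module\<close>

text \<open>As a right \<open>R\<close>-module the matrix ring is the direct sum of its two rows,
  and the tensor product respects that sum. Left multiplication by a matrix combines the two rows
  with its entries as coefficients, which is the action on columns. The argument applies to any ring
  morphism \<open>\<phi>\<close> into a matrix ring over \<open>T\<close>.\<close>

lemma tensor_mat2_ring_iso: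
  assumes T: "ring T" and R: "ring R" and \<phi>: "\<phi> \<in> ring_hom R (mat2_ring T)" and N: "left_module R N"
  shows "left_modules_isomorphic (mat2_ring T) (tensor R (ring_bimodule (mat2_ring T) \<phi>) N)
    (mat2_column (tensor R (row_bimodule T \<phi>) N))"
proof -
  let ?Mat = "mat2_ring T" and ?Row = "row_bimodule T \<phi>"
  let ?X = "ring_bimodule ?Mat \<phi>"
  interpret T: ring T by fact
  interpret R: ring R by fact
  interpret Mat: ring ?Mat by (rule ring_mat2_ring[OF T])
  interpret N: left_module R N by fact
  interpret X: bimodule ?Mat R ?X
    by (rule bimodule_ring_bimodule[OF Mat.ring_axioms R \<phi>])
  interpret Row: bimodule T R ?Row
    by (rule bimodule_row_bimodule[OF T R \<phi>])
  interpret XN: bimodule_tensor_product R ?X N ?Mat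
    by (intro bimodule_tensor_product.intro tensor_product.intro bimodule_tensor_product_axioms.intro
        X.right_module_axioms N X.bimodule_axioms)
  interpret RowN: bimodule_tensor_product R ?Row N T
    by (intro bimodule_tensor_product.intro tensor_product.intro bimodule_tensor_product_axioms.intro
        Row.right_module_axioms N Row.bimodule_axioms)
  let ?L = "RowN.XY"
  let ?C = "mat2_column ?L"
  interpret C: left_module ?Mat ?C
    by (rule left_module_mat2_column[OF RowN.left_module_tensor])
  \<comment> \<open>Because matrices are stored as pairs of rows, the operations of
    \<open>?X\<close> are those of two copies of \<open>?Row\<close>.\<close>
  have X_simps: "carrier ?X = carrier ?Row \<times> carrier ?Row"
      "(r, r') \<oplus>\<^bsub>?X\<^esub> (s, s') = (r \<oplus>\<^bsub>?Row\<^esub> s, r' \<oplus>\<^bsub>?Row\<^esub> s')" for r r' s s'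
    by (auto simp: ring_bimodule_def mat2_ring_def row_bimodule_def split: prod.splits)
  have X_rsmult: "(r, r') \<bullet>\<^bsub>?X\<^esub> a = (r \<bullet>\<^bsub>?Row\<^esub> a, r' \<bullet>\<^bsub>?Row\<^esub> a)" for r r' a
    by (auto simp: ring_bimodule_def mat2_ring_def row_bimodule_def split: prod.splits)
  have X_smult: "((a, b), (c, d)) \<odot>\<^bsub>?X\<^esub> (r, r')
      = (a \<odot>\<^bsub>?Row\<^esub> r \<oplus>\<^bsub>?Row\<^esub> b \<odot>\<^bsub>?Row\<^esub> r', c \<odot>\<^bsub>?Row\<^esub> r \<oplus>\<^bsub>?Row\<^esub> d \<odot>\<^bsub>?Row\<^esub> r')" for a b c d r r'
    by (auto simp: ring_bimodule_def mat2_ring_def row_bimodule_def split: prod.splits)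
  have C_simps: "carrier ?C = carrier ?L \<times> carrier ?L" "\<zero>\<^bsub>?C\<^esub> = (\<zero>\<^bsub>?L\<^esub>, \<zero>\<^bsub>?L\<^esub>)"
      "(u, v) \<oplus>\<^bsub>?C\<^esub> (u', v') = (u \<oplus>\<^bsub>?L\<^esub> u', v \<oplus>\<^bsub>?L\<^esub> v')" for u v u' v'
    by (simp_all add: mat2_column_def)
  define \<gamma> where "\<gamma> = (\<lambda>(r, r') n. (RowN.pt r n, RowN.pt r' n))"
  have bal_\<gamma>: "balanced R ?X N ?C \<gamma>"
    by (rule balancedI)
       (auto simp: \<gamma>_def X_simps C_simps X_rsmult RowN.pure_add_left RowN.pure_add_right RowN.pure_balanced)
  let ?F = "tensor_lift R ?X N ?C \<gamma>"
  have F: "?F \<in> left_module_hom ?Mat XN.XY ?C"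
  proof (rule XN.tensor_lift_linear[OF C.left_module_axioms bal_\<gamma>])
    fix m w n assume *: "m \<in> carrier ?Mat" "w \<in> carrier ?X" "n \<in> carrier N"
    obtain a b c d where m: "m = ((a, b), (c, d))" "a \<in> carrier T" "b \<in> carrier T" "c \<in> carrier T" "d \<in> carrier T"
      using *(1) by (auto simp: mat2_ring_def)
    obtain r r' where w: "w = (r, r')" "r \<in> carrier ?Row" "r' \<in> carrier ?Row"
      using *(2) by (auto simp: X_simps)
    show "\<gamma> (m \<odot>\<^bsub>?X\<^esub> w) n = m \<odot>\<^bsub>?C\<^esub> \<gamma> w n"
      unfolding m(1) w(1) X_smult using m w *(3)
      by (simp add: \<gamma>_def mat2_column_def RowN.tensor_smult_pure RowN.pure_add_left)
  qed
  note F_add = left_module_hom_additive[OF F]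
    and F_pure = XN.tensor_lift_pure[OF C.M.abelian_group_axioms bal_\<gamma>]
  have bal_1: "balanced R ?Row N XN.XY (\<lambda>r n. XN.pt (r, \<zero>\<^bsub>?Row\<^esub>) n)"
    by (rule balancedI)
       (auto simp: X_simps XN.pure_add_left[symmetric] XN.pure_add_right XN.pure_balanced[symmetric] X_rsmult)
  have bal_2: "balanced R ?Row N XN.XY (\<lambda>r n. XN.pt (\<zero>\<^bsub>?Row\<^esub>, r) n)"
    by (rule balancedI)
       (auto simp: X_simps XN.pure_add_left[symmetric] XN.pure_add_right XN.pure_balanced[symmetric] X_rsmult)
  let ?i1 = "tensor_lift R ?Row N XN.XY (\<lambda>r n. XN.pt (r, \<zero>\<^bsub>?Row\<^esub>) n)"
  let ?i2 = "tensor_lift R ?Row N XN.XY (\<lambda>r n. XN.pt (\<zero>\<^bsub>?Row\<^esub>, r) n)"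
  note i1_add = RowN.tensor_lift_additive[OF XN.XY.abelian_group_axioms bal_1]
    and i1_pure = RowN.tensor_lift_pure[OF XN.XY.abelian_group_axioms bal_1]
    and i2_add = RowN.tensor_lift_additive[OF XN.XY.abelian_group_axioms bal_2]
    and i2_pure = RowN.tensor_lift_pure[OF XN.XY.abelian_group_axioms bal_2]
  \<comment> \<open>The candidate inverse places the first component in the upper row and the second
    in the lower row, with zeros in the other row.\<close>
  define G where "G = (\<lambda>(u, v). ?i1 u \<oplus>\<^bsub>XN.XY\<^esub> ?i2 v)"
  have G_add: "G \<in> additive ?C XN.XY"
    by (rule additiveI)
       (auto simp: G_def C_simps additive_closed[OF i1_add] additive_closed[OF i2_add] additive_add[OF i1_add]
        additive_add[OF i2_add] XN.XY.a_ac)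
  have "?F \<in> left_module_iso ?Mat XN.XY ?C"
  proof (rule left_module_isoI[OF F])
    show "G \<in> carrier ?C \<rightarrow> carrier XN.XY"
      using additive_closed[OF G_add] by blast
  next
    fix u assume u: "u \<in> carrier XN.XY"
    show "G (?F u) = u"
    proof (rule XN.tensor_hom_eqI[OF additive_comp[OF F_add G_add] _ _ u])
      show "(\<lambda>u. u) \<in> additive XN.XY XN.XY" by (rule additiveI) auto
      fix w n assume *: "w \<in> carrier ?X" "n \<in> carrier N"
      then obtain r r' where w: "w = (r, r')" "r \<in> carrier ?Row" "r' \<in> carrier ?Row"
        by (auto simp: X_simps)
      have "G (?F (XN.pt w n)) = XN.pt (r, \<zero>\<^bsub>?Row\<^esub>) n \<oplus>\<^bsub>XN.XY\<^esub> XN.pt (\<zero>\<^bsub>?Row\<^esub>, r') n"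
        using * w by (simp add: F_pure) (simp add: \<gamma>_def G_def i1_pure i2_pure)
      also have "\<dots> = XN.pt w n"
        using * w by (subst XN.pure_add_left[symmetric]) (simp_all add: X_simps)
      finally show "G (?F (XN.pt w n)) = XN.pt w n" .
    qed
  next
    fix z assume "z \<in> carrier ?C"
    then obtain u v where z: "z = (u, v)" "u \<in> carrier ?L" "v \<in> carrier ?L"
      by (auto simp: C_simps)
    have "?F (?i1 u) = (u, \<zero>\<^bsub>?L\<^esub>)"
    proof (rule RowN.tensor_hom_eqI[OF additive_comp[OF i1_add F_add] _ _ z(2)])
      show "(\<lambda>u. (u, \<zero>\<^bsub>?L\<^esub>)) \<in> additive ?L ?C" by (rule additiveI) (auto simp: C_simps)
      fix r n assume "r \<in> carrier ?Row" "n \<in> carrier N"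
      then show "?F (?i1 (RowN.pt r n)) = (RowN.pt r n, \<zero>\<^bsub>?L\<^esub>)"
        by (simp add: i1_pure F_pure X_simps) (simp add: \<gamma>_def RowN.pure_zero_left)
    qed
    moreover have "?F (?i2 v) = (\<zero>\<^bsub>?L\<^esub>, v)"
    proof (rule RowN.tensor_hom_eqI[OF additive_comp[OF i2_add F_add] _ _ z(3)])
      show "(\<lambda>u. (\<zero>\<^bsub>?L\<^esub>, u)) \<in> additive ?L ?C" by (rule additiveI) (auto simp: C_simps)
      fix r n assume "r \<in> carrier ?Row" "n \<in> carrier N"
      then show "?F (?i2 (RowN.pt r n)) = (\<zero>\<^bsub>?L\<^esub>, RowN.pt r n)"
        by (simp add: i2_pure F_pure X_simps) (simp add: \<gamma>_def RowN.pure_zero_left)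
    qed
    ultimately show "?F (G z) = z"
      using z by (simp add: G_def additive_add[OF F_add] additive_closed[OF i1_add] additive_closed[OF i2_add] C_simps)
  qed
  then show ?thesis
    unfolding left_modules_isomorphic_def using XN.left_module_tensor C.left_module_axioms by blast
qed


section \<open>The cokernel presentation\<close>

text \<open>A map \<open>j\<close> out of \<open>M\<close> replaces an inverse defined on cosets. If
  \<open>F\<close> agrees at j v and j v', then v - v' lies in \<open>K\<close>, which
  \<open>j\<close> kills, so j v = j v'; as \<open>j\<close> is onto, \<open>F\<close> is injective.
  Surjectivity is immediate from \<open>Fj\<close>.\<close>

lemma (in left_module) quotient_isoI:
  assumes K: "subgroup K (add_monoid M)" "\<And>r k. \<lbrakk>r \<in> carrier R; k \<in> K\<rbrakk> \<Longrightarrow> r \<odot>\<^bsub>M\<^esub> k \<in> K"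
    and L: "left_module R L" and F: "F \<in> left_module_hom R L (quotient_module M K)"
    and j: "j \<in> additive M L" "\<And>k. k \<in> K \<Longrightarrow> j k = \<zero>\<^bsub>L\<^esub>" "carrier L \<subseteq> j ` carrier M"
    and Fj: "\<And>v. v \<in> carrier M \<Longrightarrow> F (j v) = K +>\<^bsub>M\<^esub> v"
  shows "F \<in> left_module_iso R L (quotient_module M K)"
proof -
  interpret L: left_module R L by fact
  let ?Q = "quotient_module M K"
  have "inj_on F (carrier L)"
  proof (rule inj_onI)
    fix u u' assume *: "u \<in> carrier L" "u' \<in> carrier L" "F u = F u'"
    obtain v v' where v: "u = j v" "v \<in> carrier M" "u' = j v'" "v' \<in> carrier M"
      using j(3) *(1,2) by blast
    then have "v \<ominus>\<^bsub>M\<^esub> v' \<in> K"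
      using *(3) by (simp add: Fj quotient_eq_iff[OF K])
    then have "j (v \<ominus>\<^bsub>M\<^esub> v') = \<zero>\<^bsub>L\<^esub>"
      by (rule j(2))
    then have 0: "j v \<ominus>\<^bsub>L\<^esub> j v' = \<zero>\<^bsub>L\<^esub>"
      using v by (simp add: M.minus_eq L.M.minus_eq additive_add[OF j(1)]
          additive_minus[OF M.abelian_group_axioms L.M.abelian_group_axioms j(1)])
    have "j v = (j v \<ominus>\<^bsub>L\<^esub> j v') \<oplus>\<^bsub>L\<^esub> j v'"
      using v additive_closed[OF j(1)] by (simp add: L.M.minus_eq L.M.a_assoc L.M.l_neg)
    also have "\<dots> = j v'"
      unfolding 0 using v additive_closed[OF j(1)] by simp
    finally show "u = u'"
      using v by simp
  qed
  moreover have "F ` carrier L = carrier ?Q"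
  proof
    show "F ` carrier L \<subseteq> carrier ?Q"
      using additive_closed[OF left_module_hom_additive[OF F]] by blast
    show "carrier ?Q \<subseteq> F ` carrier L"
    proof
      fix C assume "C \<in> carrier ?Q"
      then obtain v where "v \<in> carrier M" "C = K +>\<^bsub>M\<^esub> v"
        using quotient_cases[OF K] by blast
      then show "C \<in> F ` carrier L"
        using Fj additive_closed[OF j(1)] by (metis imageI)
    qed
  qed
  ultimately show ?thesis
    using F by (simp add: left_module_iso_def bij_betw_def)
qed

section \<open>The maps \<open>g\<close> and \<open>h\<close> attached to a triple\<close>

locale triple_data = T_data A B M p
  for A :: "('a, 'e) ring_scheme" and B :: "('b, 'e2) ring_scheme"
    and M :: "('a, 'b, 'm, 'f) bimodule_scheme" and p +
  fixes NA :: "('a, 'x, 'g) module_scheme" and NB :: "('b, 'y, 'h) module_scheme"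
    and f :: "('m, 'y) tensor \<Rightarrow> 'x"
  assumes NA: "left_module A NA" and NB: "left_module B NB"
    and f_hom: "f \<in> left_module_hom A (tensor B M NB) NA"
begin

abbreviation "R \<equiv> triangular_ring A B M"
abbreviation "N \<equiv> triple_module B M NA NB f"
abbreviation "\<phi> \<equiv> localization_map A B M p"
abbreviation "g \<equiv> g_map A B M p"
abbreviation "h \<equiv> presentation_map A B M p NA NB f"
abbreviation "TA \<equiv> ring_bimodule T (rho_A A B M p)"
abbreviation "TB \<equiv> ring_bimodule T (rho_B A B M p)"
abbreviation "Row \<equiv> row_bimodule T \<phi>"
abbreviation "TAM \<equiv> bimodule_tensor A TA M"
abbreviation "V \<equiv> direct_sum_module (tensor A TA NA) (tensor B TB NB)"

sublocale NA: left_module A NA by (rule NA)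
sublocale NB: left_module B NB by (rule NB)
sublocale R: ring R by (rule ring_triangular_ring[OF ring_A ring_B bimod_M])
sublocale N: left_module R N by (rule left_module_triple_module[OF ring_A ring_B bimod_M NA NB f_hom])
sublocale TA: bimodule T A TA by (rule bimodule_ring_bimodule[OF T.ring_axioms ring_A rho_A_hom])
sublocale TB: bimodule T B TB by (rule bimodule_ring_bimodule[OF T.ring_axioms ring_B rho_B_hom])
sublocale Row: bimodule T R Row
  by (rule bimodule_row_bimodule[OF T.ring_axioms R.ring_axioms localization_map_hom])

sublocale MNB: bimodule_tensor_product B M NB A
  by (intro bimodule_tensor_product.intro tensor_product.intro bimodule_tensor_product_axioms.intro
      M.right_module_axioms NB bimod_M)
sublocale TANA: bimodule_tensor_product A TA NA T
  by (intro bimodule_tensor_product.intro tensor_product.intro bimodule_tensor_product_axioms.intro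
      TA.right_module_axioms NA TA.bimodule_axioms)
sublocale TBNB: bimodule_tensor_product B TB NB T
  by (intro bimodule_tensor_product.intro tensor_product.intro bimodule_tensor_product_axioms.intro
      TB.right_module_axioms NB TB.bimodule_axioms)
sublocale TAM: bitensor_product A TA M T B
  by (intro bitensor_product.intro bitensor_product_axioms.intro bimodule_tensor_product.intro
      tensor_product.intro bimodule_tensor_product_axioms.intro
      TA.right_module_axioms M.left_module_axioms TA.bimodule_axioms bimod_M)
sublocale TAM_bi: bimodule T B TAM
  by (rule TAM.bimodule_bitensor)
sublocale U: bimodule_tensor_product B TAM NB T
  by (intro bimodule_tensor_product.intro tensor_product.intro bimodule_tensor_product_axioms.intro
      TAM_bi.right_module_axioms NB TAM_bi.bimodule_axioms)
sublocale W: bimodule_tensor_product A TA "tensor B M NB" T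
  by (intro bimodule_tensor_product.intro tensor_product.intro bimodule_tensor_product_axioms.intro
      TA.right_module_axioms MNB.left_module_tensor TA.bimodule_axioms)
sublocale L: bimodule_tensor_product R Row N T
  by (intro bimodule_tensor_product.intro tensor_product.intro bimodule_tensor_product_axioms.intro
      Row.right_module_axioms N.left_module_axioms Row.bimodule_axioms)
sublocale V: left_module T V
  by (rule left_module_direct_sum[OF TANA.left_module_tensor TBNB.left_module_tensor])

lemma ring_bimodule_simps [simp]:
  "carrier (ring_bimodule T \<rho>) = carrier T" "t \<oplus>\<^bsub>ring_bimodule T \<rho>\<^esub> t' = t \<oplus>\<^bsub>T\<^esub> t'"
  "\<zero>\<^bsub>ring_bimodule T \<rho>\<^esub> = \<zero>\<^bsub>T\<^esub>"
  "t \<odot>\<^bsub>ring_bimodule T \<rho>\<^esub> t' = t \<otimes>\<^bsub>T\<^esub> t'" "t \<bullet>\<^bsub>ring_bimodule T \<rho>\<^esub> a = t \<otimes>\<^bsub>T\<^esub> \<rho> a"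
  by (simp_all add: ring_bimodule_def)

lemma ring_bimodule_minus [simp]: "\<ominus>\<^bsub>ring_bimodule T \<rho>\<^esub> t = \<ominus>\<^bsub>T\<^esub> t"
  by (simp add: ring_bimodule_def a_inv_def m_inv_def)

lemmas add_left = TANA.pure_add_left[simplified] TBNB.pure_add_left[simplified] W.pure_add_left[simplified]
  TAM.pure_add_left[simplified]
lemmas pure_balanced = TANA.pure_balanced[simplified] TBNB.pure_balanced[simplified] W.pure_balanced[simplified]
lemmas smult_pure = TANA.tensor_smult_pure[simplified] TBNB.tensor_smult_pure[simplified]
  W.tensor_smult_pure[simplified] TAM.tensor_smult_pure[simplified]

lemma rho_closed [simp]:
  "a \<in> carrier A \<Longrightarrow> rho_A A B M p a \<in> carrier T" "b \<in> carrier B \<Longrightarrow> rho_B A B M p b \<in> carrier T"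
  by (simp_all add: rho_A_def rho_B_def)

lemma rho_zero: "rho_A A B M p \<zero>\<^bsub>A\<^esub> = \<zero>\<^bsub>T\<^esub>" "rho_B A B M p \<zero>\<^bsub>B\<^esub> = \<zero>\<^bsub>T\<^esub>"
  by (simp_all add: rho_A_def rho_B_def gen_zero)

text \<open>Balance over \<open>A\<close> is the relation that \<open>rho_A\<close> of
  \<open>a\<close> times \<open>x m\<close> is \<open>x\<close> of \<open>a\<close> times
  \<open>m\<close>.\<close>

lemma g_balanced: "balanced A TA M T (\<lambda>t m. \<ominus>\<^bsub>T\<^esub> (t \<otimes>\<^bsub>T\<^esub> x m))"
  by (rule balancedI) (simp_all add: T.l_distr T.r_distr gen_add T.minus_add T.m_assoc rho_A_gen)

lemma g_pure: "\<lbrakk>t \<in> carrier T; m \<in> carrier M\<rbrakk> \<Longrightarrow> g (TAM.pt t m) = \<ominus>\<^bsub>T\<^esub> (t \<otimes>\<^bsub>T\<^esub> x m)"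
  unfolding g_map_def Let_def by (simp add: TAM.tensor_lift_pure[OF T.abelian_group_axioms g_balanced])

lemma g_additive: "g \<in> additive TAM.XY T"
  unfolding g_map_def Let_def by (rule TAM.tensor_lift_additive[OF T.abelian_group_axioms g_balanced])

text \<open>Both kinds of linearity compare additive maps on the tensor product. On pure tensors the
  left one is associativity in \<open>T\<close>, and the right one is the relation
  \<open>gen_rho_B\<close>.\<close>

lemma g_bimodule_hom: "g \<in> bimodule_hom T B TAM TB"
proof -
  note closed = additive_closed[OF g_additive] and add = additive_add[OF g_additive]
  have smult: "g (t \<odot>\<^bsub>TAM.XY\<^esub> u) = t \<otimes>\<^bsub>T\<^esub> g u" if t: "t \<in> carrier T" and u: "u \<in> carrier TAM.XY" for t u
  proof -
    have "(\<lambda>u. t \<otimes>\<^bsub>T\<^esub> g u) \<in> additive TAM.XY T"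
      using t by (intro additiveI) (simp_all add: closed add T.r_distr)
    from TAM.tensor_hom_eqI[OF additive_comp[OF TAM.tensor_smult_additive[OF t] g_additive] this _ u]
    show ?thesis
      using t by (simp add: smult_pure g_pure T.r_minus T.m_assoc)
  qed
  have rsmult: "g (u \<bullet>\<^bsub>TAM\<^esub> b) = g u \<otimes>\<^bsub>T\<^esub> rho_B A B M p b"
    if b: "b \<in> carrier B" and u: "u \<in> carrier TAM.XY" for b u
  proof -
    have "(\<lambda>u. g u \<otimes>\<^bsub>T\<^esub> rho_B A B M p b) \<in> additive TAM.XY T"
      using b by (intro additiveI) (simp_all add: closed add T.l_distr)
    from TAM.tensor_hom_eqI[OF additive_comp[OF TAM.bitensor_rsmult_additive[OF b] g_additive] this _ u]
    show ?thesis
      using b by (simp add: TAM.bitensor_rsmult_pure g_pure T.l_minus T.m_assoc gen_rho_B)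
  qed
  show ?thesis
    by (simp add: bimodule_hom_def left_module_hom_def Pi_iff closed add smult rsmult)
qed

lemma assoc_inner_balanced:
  "n \<in> carrier NB \<Longrightarrow> balanced A TA M W.XY (\<lambda>t m. W.pt t (MNB.pt m n))"
  by (rule balancedI)
     (simp_all add: add_left W.pure_add_right MNB.pure_add_left MNB.tensor_smult_pure[symmetric]
        pure_balanced[symmetric])

text \<open>The associator is a lift of lifts: for fixed \<open>n\<close> an inner lift in the first
  two factors, called \<open>\<beta>\<close> here. Additivity in \<open>n\<close> and balance over
  \<open>B\<close> are then identities between additive maps in \<open>u\<close>, which the
  universal property of the inner tensor product reduces to pure tensors.\<close>

lemma assoc_lemmas:
  shows assoc_hom: "tensor_assoc A B TA M NB \<in> left_module_hom T U.XY W.XY"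
    and assoc_pure: "\<lbrakk>t \<in> carrier T; m \<in> carrier M; n \<in> carrier NB\<rbrakk>
      \<Longrightarrow> tensor_assoc A B TA M NB (U.pt (TAM.pt t m) n) = W.pt t (MNB.pt m n)"
proof -
  define \<beta> where "\<beta> = (\<lambda>u n. tensor_lift A TA M W.XY (\<lambda>t m. W.pt t (MNB.pt m n)) u)"
  have \<beta>_add: "(\<lambda>u. \<beta> u n) \<in> additive TAM.XY W.XY"
    and \<beta>_pure: "\<And>t m. \<lbrakk>t \<in> carrier T; m \<in> carrier M\<rbrakk> \<Longrightarrow> \<beta> (TAM.pt t m) n = W.pt t (MNB.pt m n)"
    if "n \<in> carrier NB" for n
    unfolding \<beta>_def
    using that TAM.tensor_lift_additive[OF W.XY.abelian_group_axioms assoc_inner_balanced[of n]]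
      TAM.tensor_lift_pure[OF W.XY.abelian_group_axioms assoc_inner_balanced[of n]] by simp_all
  have bal: "balanced B TAM NB W.XY \<beta>"
  proof (rule balancedI; simp only: TAM.bitensor_simps)
    fix u n assume "u \<in> carrier TAM.XY" "n \<in> carrier NB"
    then show "\<beta> u n \<in> carrier W.XY" by (simp add: additive_closed[OF \<beta>_add])
  next
    fix u u' n assume "u \<in> carrier TAM.XY" "u' \<in> carrier TAM.XY" "n \<in> carrier NB"
    then show "\<beta> (u \<oplus>\<^bsub>TAM.XY\<^esub> u') n = \<beta> u n \<oplus>\<^bsub>W.XY\<^esub> \<beta> u' n" by (simp add: additive_add[OF \<beta>_add])
  next
    fix u n n' assume u: "u \<in> carrier TAM.XY" and n: "n \<in> carrier NB" "n' \<in> carrier NB"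
    have "(\<lambda>u. \<beta> u n \<oplus>\<^bsub>W.XY\<^esub> \<beta> u n') \<in> additive TAM.XY W.XY"
      using n by (intro additiveI) (simp_all add: additive_closed[OF \<beta>_add] additive_add[OF \<beta>_add] W.XY.a_ac)
    from TAM.tensor_hom_eqI[OF \<beta>_add this _ u]
    show "\<beta> u (n \<oplus>\<^bsub>NB\<^esub> n') = \<beta> u n \<oplus>\<^bsub>W.XY\<^esub> \<beta> u n'"
      using n by (simp add: \<beta>_pure MNB.pure_add_right W.pure_add_right)
  next
    fix u b n assume u: "u \<in> carrier TAM.XY" and bn: "b \<in> carrier B" "n \<in> carrier NB"
    from TAM.tensor_hom_eqI[OF additive_comp[OF TAM.bitensor_rsmult_additive \<beta>_add] \<beta>_add _ u]
    show "\<beta> (u \<bullet>\<^bsub>TAM\<^esub> b) n = \<beta> u (b \<odot>\<^bsub>NB\<^esub> n)"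
      using bn by (simp add: \<beta>_pure TAM.bitensor_rsmult_pure MNB.pure_balanced)
  qed
  have lift: "tensor_assoc A B TA M NB = tensor_lift B TAM NB W.XY \<beta>"
    by (simp add: tensor_assoc_def \<beta>_def)
  show "tensor_assoc A B TA M NB \<in> left_module_hom T U.XY W.XY"
    unfolding lift
  proof (rule U.tensor_lift_linear[OF W.left_module_tensor bal])
    fix t u n assume "t \<in> carrier T" "u \<in> carrier TAM" "n \<in> carrier NB"
    then show "\<beta> (t \<odot>\<^bsub>TAM\<^esub> u) n = t \<odot>\<^bsub>W.XY\<^esub> \<beta> u n"
      using left_module_hom_smult[OF TAM.tensor_lift_linear[OF W.left_module_tensor assoc_inner_balanced[of n]], of t u]
      by (simp add: \<beta>_def smult_pure)
  qed
  show "\<lbrakk>t \<in> carrier T; m \<in> carrier M; n \<in> carrier NB\<rbrakk>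
      \<Longrightarrow> tensor_assoc A B TA M NB (U.pt (TAM.pt t m) n) = W.pt t (MNB.pt m n)"
    unfolding lift by (simp add: U.tensor_lift_pure[OF W.XY.abelian_group_axioms bal] \<beta>_pure)
qed

lemma id_left_module_hom: "(\<lambda>n. n) \<in> left_module_hom B NB NB"
  by (auto simp: left_module_hom_def)

lemmas one_f_hom = tensor_map_hom[OF W.bimodule_tensor_product_axioms TANA.bimodule_tensor_product_axioms
    bimodule_hom_id f_hom]
lemmas one_f_pure = tensor_map_pure[OF W.bimodule_tensor_product_axioms TANA.bimodule_tensor_product_axioms
    bimodule_hom_id f_hom]
lemmas g_one_hom = tensor_map_hom[OF U.bimodule_tensor_product_axioms TBNB.bimodule_tensor_product_axioms
    g_bimodule_hom id_left_module_hom]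
lemmas g_one_pure = tensor_map_pure[OF U.bimodule_tensor_product_axioms TBNB.bimodule_tensor_product_axioms
    g_bimodule_hom id_left_module_hom]

lemma V_simps:
  "carrier V = carrier TANA.XY \<times> carrier TBNB.XY" "\<zero>\<^bsub>V\<^esub> = (\<zero>\<^bsub>TANA.XY\<^esub>, \<zero>\<^bsub>TBNB.XY\<^esub>)"
  "(v, w) \<oplus>\<^bsub>V\<^esub> (v', w') = (v \<oplus>\<^bsub>TANA.XY\<^esub> v', w \<oplus>\<^bsub>TBNB.XY\<^esub> w')"
  "t \<odot>\<^bsub>V\<^esub> (v, w) = (t \<odot>\<^bsub>TANA.XY\<^esub> v, t \<odot>\<^bsub>TBNB.XY\<^esub> w)"
  by (simp_all add: direct_sum_module_def)

lemma h_eq: "h = (\<lambda>u. (tensor_map A TA MNB.XY TA NA (\<lambda>t. t) f (tensor_assoc A B TA M NB u),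
    tensor_map B TAM NB TB NB g (\<lambda>y. y) u))"
  by (simp add: presentation_map_def Let_def)

lemma h_hom: "h \<in> left_module_hom T U.XY V"
proof -
  note a = left_module_hom_additive[OF assoc_hom] and b = left_module_hom_additive[OF one_f_hom]
    and c = left_module_hom_additive[OF g_one_hom]
  show ?thesis
    by (intro left_module_homI additiveI)
       (simp_all add: h_eq V_simps additive_closed[OF a] additive_closed[OF b] additive_closed[OF c]
        additive_add[OF a] additive_add[OF b] additive_add[OF c] left_module_hom_smult[OF assoc_hom]
        left_module_hom_smult[OF one_f_hom] left_module_hom_smult[OF g_one_hom])
qed

lemma h_pure: "\<lbrakk>t \<in> carrier T; m \<in> carrier M; n \<in> carrier NB\<rbrakk> \<Longrightarrow>
    h (U.pt (TAM.pt t m) n) = (TANA.pt t (f (MNB.pt m n)), TBNB.pt (\<ominus>\<^bsub>T\<^esub> (t \<otimes>\<^bsub>T\<^esub> x m)) n)"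
  by (simp add: h_eq assoc_pure one_f_pure g_one_pure g_pure)

text \<open>For fixed \<open>n\<close> the map from w to w tensor \<open>n\<close> is additive, so
  the inner and the outer uniqueness principle can be chained.\<close>

lemma U_hom_eqI:
  assumes k: "k \<in> additive U.XY G" "k' \<in> additive U.XY G"
    and eq: "\<And>t m n. \<lbrakk>t \<in> carrier T; m \<in> carrier M; n \<in> carrier NB\<rbrakk>
      \<Longrightarrow> k (U.pt (TAM.pt t m) n) = k' (U.pt (TAM.pt t m) n)"
    and u: "u \<in> carrier U.XY"
  shows "k u = k' u"
proof (rule U.tensor_hom_eqI[OF k _ u])
  fix w n assume w: "w \<in> carrier TAM" and n: "n \<in> carrier NB"
  have "(\<lambda>w. U.pt w n) \<in> additive TAM.XY U.XY"
    using U.additive_pure_left[OF n] by (simp add: hom_def)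
  from TAM.tensor_hom_eqI[OF additive_comp[OF this k(1)] additive_comp[OF this k(2)]]
  show "k (U.pt w n) = k' (U.pt w n)"
    using w n eq by simp
qed

section \<open>The row module tensored with a triple, as a cokernel\<close>

lemma Row_simps:
  "(s, t) \<in> carrier Row \<longleftrightarrow> s \<in> carrier T \<and> t \<in> carrier T" "\<zero>\<^bsub>Row\<^esub> = (\<zero>\<^bsub>T\<^esub>, \<zero>\<^bsub>T\<^esub>)"
  "(s, t) \<oplus>\<^bsub>Row\<^esub> (s', t') = (s \<oplus>\<^bsub>T\<^esub> s', t \<oplus>\<^bsub>T\<^esub> t')"
  "r \<odot>\<^bsub>Row\<^esub> (s, t) = (r \<otimes>\<^bsub>T\<^esub> s, r \<otimes>\<^bsub>T\<^esub> t)"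
  "(s, t) \<bullet>\<^bsub>Row\<^esub> (a, m, b) = (s \<otimes>\<^bsub>T\<^esub> rho_A A B M p a \<oplus>\<^bsub>T\<^esub> t \<otimes>\<^bsub>T\<^esub> \<zero>\<^bsub>T\<^esub>, s \<otimes>\<^bsub>T\<^esub> x m \<oplus>\<^bsub>T\<^esub> t \<otimes>\<^bsub>T\<^esub> rho_B A B M p b)"
  by (simp_all add: row_bimodule_def localization_map_def)

lemma N_simps:
  "(n, n') \<in> carrier N \<longleftrightarrow> n \<in> carrier NA \<and> n' \<in> carrier NB" "\<zero>\<^bsub>N\<^esub> = (\<zero>\<^bsub>NA\<^esub>, \<zero>\<^bsub>NB\<^esub>)"
  "(n, n') \<oplus>\<^bsub>N\<^esub> (k, k') = (n \<oplus>\<^bsub>NA\<^esub> k, n' \<oplus>\<^bsub>NB\<^esub> k')"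
  "(a, m, b) \<odot>\<^bsub>N\<^esub> (n, n') = (a \<odot>\<^bsub>NA\<^esub> n \<oplus>\<^bsub>NA\<^esub> f (MNB.pt m n'), b \<odot>\<^bsub>NB\<^esub> n')"
  by (simp_all add: triple_module_def)

lemma R_carrier: "(a, m, b) \<in> carrier R \<longleftrightarrow> a \<in> carrier A \<and> m \<in> carrier M \<and> b \<in> carrier B"
  by (simp add: triangular_ring_def)

lemma f_closed [simp]: "\<lbrakk>m \<in> carrier M; n \<in> carrier NB\<rbrakk> \<Longrightarrow> f (MNB.pt m n) \<in> carrier NA"
  by (simp add: additive_closed[OF left_module_hom_additive[OF f_hom]])

lemma f_zero [simp]: "n \<in> carrier NB \<Longrightarrow> f (MNB.pt \<zero>\<^bsub>M\<^esub> n) = \<zero>\<^bsub>NA\<^esub>"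
  by (simp add: MNB.pure_zero_left additive_zero[OF MNB.XY.abelian_group_axioms NA.M.abelian_group_axioms
        left_module_hom_additive[OF f_hom]])

text \<open>Balance over \<open>R\<close> in terms of entries. It is used with all but one of
  \<open>a\<close>, \<open>m\<close>, \<open>b\<close> equal to zero, which isolates the effect of a
  single matrix entry.\<close>

lemma L_balanced:
  assumes "s \<in> carrier T" "t \<in> carrier T" "a \<in> carrier A" "m \<in> carrier M" "b \<in> carrier B"
    "n \<in> carrier NA" "n' \<in> carrier NB"
  shows "L.pt (s \<otimes>\<^bsub>T\<^esub> rho_A A B M p a, s \<otimes>\<^bsub>T\<^esub> x m \<oplus>\<^bsub>T\<^esub> t \<otimes>\<^bsub>T\<^esub> rho_B A B M p b) (n, n')
    = L.pt (s, t) (a \<odot>\<^bsub>NA\<^esub> n \<oplus>\<^bsub>NA\<^esub> f (MNB.pt m n'), b \<odot>\<^bsub>NB\<^esub> n')"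
  using L.pure_balanced[of "(s, t)" "(a, m, b)" "(n, n')"] assms
  by (simp add: Row_simps N_simps R_carrier)

text \<open>An application of \<open>quotient_isoI\<close>, with \<open>j\<close> mapping the direct
  sum onto the row tensor product. That \<open>j\<close> kills the image of \<open>h\<close> rests
  on balance over the entry \<open>m\<close>, the same relation that required passing to the
  cokernel for the forward map.\<close>

lemma L_iso_cokernel: "left_modules_isomorphic T L.XY (cokernel_module U.XY V h)"
proof -
  let ?K = "h ` carrier U.XY"
  let ?C = "quotient_module V ?K"
  let ?\<pi> = "\<lambda>v. ?K +>\<^bsub>V\<^esub> v"
  note K = image_submodule[OF U.left_module_tensor V.left_module_axioms h_hom]
  have eq_iff: "?\<pi> v = ?\<pi> w \<longleftrightarrow> v \<ominus>\<^bsub>V\<^esub> w \<in> ?K" if "v \<in> carrier V" "w \<in> carrier V" for v w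
    by (rule V.quotient_eq_iff[OF K that])
  have \<pi>_hom: "?\<pi> \<in> left_module_hom T V ?C"
    by (rule V.quotient_proj_hom[OF K])
  note \<pi>_add = left_module_hom_additive[OF \<pi>_hom]
  interpret C: left_module T ?C by (rule V.left_module_quotient[OF K])
  define \<gamma> where "\<gamma> = (\<lambda>(s, t) (n, n'). ?\<pi> (TANA.pt s n, TBNB.pt t n'))"
  have bal: "balanced R Row N ?C \<gamma>"
  proof (rule balancedI)
    fix r n assume "r \<in> carrier Row" "n \<in> carrier N"
    then show "\<gamma> r n \<in> carrier ?C"
      by (cases r; cases n) (simp add: \<gamma>_def Row_simps N_simps V_simps additive_closed[OF \<pi>_add])
  next
    fix r r' n assume "r \<in> carrier Row" "r' \<in> carrier Row" "n \<in> carrier N"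
    then show "\<gamma> (r \<oplus>\<^bsub>Row\<^esub> r') n = \<gamma> r n \<oplus>\<^bsub>?C\<^esub> \<gamma> r' n"
      by (cases r; cases r'; cases n)
         (simp add: \<gamma>_def Row_simps N_simps V_simps additive_add[OF \<pi>_add, symmetric] add_left)
  next
    fix r n k assume "r \<in> carrier Row" "n \<in> carrier N" "k \<in> carrier N"
    then show "\<gamma> r (n \<oplus>\<^bsub>N\<^esub> k) = \<gamma> r n \<oplus>\<^bsub>?C\<^esub> \<gamma> r k"
      by (cases r; cases n; cases k)
         (simp add: \<gamma>_def Row_simps N_simps V_simps additive_add[OF \<pi>_add, symmetric] TANA.pure_add_right TBNB.pure_add_right)
  next
    fix r z n assume *: "r \<in> carrier Row" "z \<in> carrier R" "n \<in> carrier N"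
    obtain s t where r: "r = (s, t)" "s \<in> carrier T" "t \<in> carrier T"
      using *(1) by (cases r) (simp add: Row_simps)
    obtain a m b where z: "z = (a, m, b)" "a \<in> carrier A" "m \<in> carrier M" "b \<in> carrier B"
      using *(2) by (cases z) (simp add: R_carrier)
    obtain y y' where n: "n = (y, y')" "y \<in> carrier NA" "y' \<in> carrier NB"
      using *(3) by (cases n) (simp add: N_simps)
    note mem = r(2,3) z(2-4) n(2,3)
    \<comment> \<open>\<open>?v\<close> and \<open>?w\<close> represent the results of letting
      \<open>z\<close> act on the row and on the module. They differ by the value of
      \<open>h\<close> at s, m, y': its first component supplies the term with \<open>f\<close>, and
      the minus sign in \<open>g\<close> removes the term with \<open>x m\<close>.\<close>
    let ?v = "(TANA.pt s (a \<odot>\<^bsub>NA\<^esub> y), TBNB.pt (s \<otimes>\<^bsub>T\<^esub> x m) y' \<oplus>\<^bsub>TBNB.XY\<^esub> TBNB.pt t (b \<odot>\<^bsub>NB\<^esub> y'))"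
    let ?w = "(TANA.pt s (a \<odot>\<^bsub>NA\<^esub> y) \<oplus>\<^bsub>TANA.XY\<^esub> TANA.pt s (f (MNB.pt m y')), TBNB.pt t (b \<odot>\<^bsub>NB\<^esub> y'))"
    let ?k = "h (U.pt (TAM.pt s m) y')"
    have v: "?v \<in> carrier V" and w: "?w \<in> carrier V"
      using mem by (simp_all add: V_simps)
    have k_in: "?k \<in> ?K" using mem by simp
    have k: "?k \<in> carrier V"
      using additive_closed[OF left_module_hom_additive[OF h_hom], of "U.pt (TAM.pt s m) y'"] mem by simp
    have kv: "?w = ?k \<oplus>\<^bsub>V\<^esub> ?v"
      using mem by (simp add: h_pure V_simps TANA.XY.a_comm TBNB.pure_minus_left[simplified] TBNB.XY.a_assoc[symmetric] TBNB.XY.l_neg)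
    have "?w \<ominus>\<^bsub>V\<^esub> ?v = ?k"
      unfolding kv using k v by (simp add: V.M.minus_eq V.M.a_assoc V.M.r_neg)
    then have "?\<pi> ?w = ?\<pi> ?v"
      using eq_iff[OF w v] k_in by metis
    moreover have "\<gamma> (r \<bullet>\<^bsub>Row\<^esub> z) n = ?\<pi> ?v"
      using mem TANA.pure_balanced[of s a y] TBNB.pure_balanced[of t b y']
      by (simp add: \<gamma>_def r(1) z(1) n(1) Row_simps add_left)
    moreover have "\<gamma> r (z \<odot>\<^bsub>N\<^esub> n) = ?\<pi> ?w"
      using mem by (simp add: \<gamma>_def r(1) z(1) n(1) N_simps TANA.pure_add_right)
    ultimately show "\<gamma> (r \<bullet>\<^bsub>Row\<^esub> z) n = \<gamma> r (z \<odot>\<^bsub>N\<^esub> n)" by simp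
  qed
  let ?F = "tensor_lift R Row N ?C \<gamma>"
  have F: "?F \<in> left_module_hom T L.XY ?C"
  proof (rule L.tensor_lift_linear[OF C.left_module_axioms bal])
    fix u r n assume "u \<in> carrier T" "r \<in> carrier Row" "n \<in> carrier N"
    then show "\<gamma> (u \<odot>\<^bsub>Row\<^esub> r) n = u \<odot>\<^bsub>?C\<^esub> \<gamma> r n"
      by (cases r; cases n)
         (simp add: \<gamma>_def Row_simps N_simps V_simps left_module_hom_smult[OF \<pi>_hom, symmetric]
          smult_pure)
  qed
  note F_add = left_module_hom_additive[OF F] and F_pure = L.tensor_lift_pure[OF C.M.abelian_group_axioms bal]
  have bal_A: "balanced A TA NA L.XY (\<lambda>s n. L.pt (s, \<zero>\<^bsub>T\<^esub>) (n, \<zero>\<^bsub>NB\<^esub>))"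
  proof (rule balancedI; simp only: ring_bimodule_simps)
    fix s a n assume "s \<in> carrier T" "a \<in> carrier A" "n \<in> carrier NA"
    then show "L.pt (s \<otimes>\<^bsub>T\<^esub> rho_A A B M p a, \<zero>\<^bsub>T\<^esub>) (n, \<zero>\<^bsub>NB\<^esub>) = L.pt (s, \<zero>\<^bsub>T\<^esub>) (a \<odot>\<^bsub>NA\<^esub> n, \<zero>\<^bsub>NB\<^esub>)"
      using L_balanced[of s "\<zero>\<^bsub>T\<^esub>" a "\<zero>\<^bsub>M\<^esub>" "\<zero>\<^bsub>B\<^esub>" n "\<zero>\<^bsub>NB\<^esub>"] by (simp add: gen_zero)
  qed (simp_all add: Row_simps N_simps L.pure_add_left[symmetric] L.pure_add_right[symmetric])
  have bal_B: "balanced B TB NB L.XY (\<lambda>t n. L.pt (\<zero>\<^bsub>T\<^esub>, t) (\<zero>\<^bsub>NA\<^esub>, n))"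
  proof (rule balancedI; simp only: ring_bimodule_simps)
    fix t b n assume "t \<in> carrier T" "b \<in> carrier B" "n \<in> carrier NB"
    then show "L.pt (\<zero>\<^bsub>T\<^esub>, t \<otimes>\<^bsub>T\<^esub> rho_B A B M p b) (\<zero>\<^bsub>NA\<^esub>, n) = L.pt (\<zero>\<^bsub>T\<^esub>, t) (\<zero>\<^bsub>NA\<^esub>, b \<odot>\<^bsub>NB\<^esub> n)"
      using L_balanced[of "\<zero>\<^bsub>T\<^esub>" t "\<zero>\<^bsub>A\<^esub>" "\<zero>\<^bsub>M\<^esub>" b "\<zero>\<^bsub>NA\<^esub>" n] by (simp add: gen_zero rho_zero)
  qed (simp_all add: Row_simps N_simps L.pure_add_left[symmetric] L.pure_add_right[symmetric])
  let ?jA = "tensor_lift A TA NA L.XY (\<lambda>s n. L.pt (s, \<zero>\<^bsub>T\<^esub>) (n, \<zero>\<^bsub>NB\<^esub>))"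
  let ?jB = "tensor_lift B TB NB L.XY (\<lambda>t n. L.pt (\<zero>\<^bsub>T\<^esub>, t) (\<zero>\<^bsub>NA\<^esub>, n))"
  note jA_add = TANA.tensor_lift_additive[OF L.XY.abelian_group_axioms bal_A]
    and jA_pure = TANA.tensor_lift_pure[OF L.XY.abelian_group_axioms bal_A]
    and jB_add = TBNB.tensor_lift_additive[OF L.XY.abelian_group_axioms bal_B]
    and jB_pure = TBNB.tensor_lift_pure[OF L.XY.abelian_group_axioms bal_B]
  define j where "j = (\<lambda>(v, w). ?jA v \<oplus>\<^bsub>L.XY\<^esub> ?jB w)"
  have j_add: "j \<in> additive V L.XY"
    by (rule additiveI)
       (auto simp: j_def V_simps additive_closed[OF jA_add] additive_closed[OF jB_add] additive_add[OF jA_add]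
        additive_add[OF jB_add] L.XY.a_ac)
  have j_pure: "j (TANA.pt s n, TBNB.pt t n') = L.pt (s, t) (n, n')"
    if "s \<in> carrier T" "t \<in> carrier T" "n \<in> carrier NA" "n' \<in> carrier NB" for s t n n'
  proof -
    \<comment> \<open>The idempotent of \<open>R\<close> with the unit of \<open>B\<close> as its
      only entry annihilates (s, 0) and fixes (0, n'), so moving it across makes this tensor vanish.
      The other mixed tensor below vanishes by the idempotent coming from \<open>A\<close>.\<close>
    have "L.pt (s, \<zero>\<^bsub>T\<^esub>) (\<zero>\<^bsub>NA\<^esub>, n') = L.pt \<zero>\<^bsub>Row\<^esub> (\<zero>\<^bsub>NA\<^esub>, n')"
      using that L_balanced[of s "\<zero>\<^bsub>T\<^esub>" "\<zero>\<^bsub>A\<^esub>" "\<zero>\<^bsub>M\<^esub>" "\<one>\<^bsub>B\<^esub>" "\<zero>\<^bsub>NA\<^esub>" n']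
      by (simp add: gen_zero rho_zero Row_simps)
    then have 1: "L.pt (s, \<zero>\<^bsub>T\<^esub>) (\<zero>\<^bsub>NA\<^esub>, n') = \<zero>\<^bsub>L.XY\<^esub>"
      using that by (simp add: L.pure_zero_left N_simps)
    have "L.pt (\<zero>\<^bsub>T\<^esub>, t) (n, \<zero>\<^bsub>NB\<^esub>) = L.pt \<zero>\<^bsub>Row\<^esub> (n, \<zero>\<^bsub>NB\<^esub>)"
      using that L_balanced[of "\<zero>\<^bsub>T\<^esub>" t "\<one>\<^bsub>A\<^esub>" "\<zero>\<^bsub>M\<^esub>" "\<zero>\<^bsub>B\<^esub>" n "\<zero>\<^bsub>NB\<^esub>"]
      by (simp add: gen_zero rho_zero Row_simps)
    then have 2: "L.pt (\<zero>\<^bsub>T\<^esub>, t) (n, \<zero>\<^bsub>NB\<^esub>) = \<zero>\<^bsub>L.XY\<^esub>"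
      using that by (simp add: L.pure_zero_left N_simps)
    have n: "L.pt (s', t') (n, n') = L.pt (s', t') (n, \<zero>\<^bsub>NB\<^esub>) \<oplus>\<^bsub>L.XY\<^esub> L.pt (s', t') (\<zero>\<^bsub>NA\<^esub>, n')"
      if "s' \<in> carrier T" "t' \<in> carrier T" for s' t'
      using that \<open>n \<in> carrier NA\<close> \<open>n' \<in> carrier NB\<close>
      by (subst L.pure_add_right[symmetric]) (simp_all add: Row_simps N_simps)
    have "L.pt (s, t) (n, n') = L.pt (s, \<zero>\<^bsub>T\<^esub>) (n, n') \<oplus>\<^bsub>L.XY\<^esub> L.pt (\<zero>\<^bsub>T\<^esub>, t) (n, n')"
      using that by (subst L.pure_add_left[symmetric]) (simp_all add: Row_simps N_simps)
    also have "\<dots> = L.pt (s, \<zero>\<^bsub>T\<^esub>) (n, \<zero>\<^bsub>NB\<^esub>) \<oplus>\<^bsub>L.XY\<^esub> L.pt (\<zero>\<^bsub>T\<^esub>, t) (\<zero>\<^bsub>NA\<^esub>, n')"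
      using that by (simp add: n 1 2 Row_simps N_simps)
    finally show ?thesis
      using that by (simp add: j_def jA_pure jB_pure)
  qed
  have j_h: "j (h u) = \<zero>\<^bsub>L.XY\<^esub>" if u: "u \<in> carrier U.XY" for u
  proof (rule U_hom_eqI[OF additive_comp[OF left_module_hom_additive[OF h_hom] j_add] _ _ u])
    show "(\<lambda>u. \<zero>\<^bsub>L.XY\<^esub>) \<in> additive U.XY L.XY" by (rule additiveI) simp_all
    fix t m n assume *: "t \<in> carrier T" "m \<in> carrier M" "n \<in> carrier NB"
    have "L.pt (t, \<ominus>\<^bsub>T\<^esub> (t \<otimes>\<^bsub>T\<^esub> x m)) (f (MNB.pt m n), n)
      = L.pt (t, \<zero>\<^bsub>T\<^esub>) (f (MNB.pt m n), \<zero>\<^bsub>NB\<^esub>) \<oplus>\<^bsub>L.XY\<^esub> L.pt (\<zero>\<^bsub>T\<^esub>, \<ominus>\<^bsub>T\<^esub> (t \<otimes>\<^bsub>T\<^esub> x m)) (\<zero>\<^bsub>NA\<^esub>, n)"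
      using * j_pure[of t "\<ominus>\<^bsub>T\<^esub> (t \<otimes>\<^bsub>T\<^esub> x m)" "f (MNB.pt m n)" n] by (simp add: j_def jA_pure jB_pure)
    \<comment> \<open>Moving the matrix with single entry \<open>m\<close> across the tensor sign;
      the result is the opposite of the second summand.\<close>
    also have "L.pt (t, \<zero>\<^bsub>T\<^esub>) (f (MNB.pt m n), \<zero>\<^bsub>NB\<^esub>) = L.pt (\<zero>\<^bsub>T\<^esub>, t \<otimes>\<^bsub>T\<^esub> x m) (\<zero>\<^bsub>NA\<^esub>, n)"
      using * L_balanced[of t "\<zero>\<^bsub>T\<^esub>" "\<zero>\<^bsub>A\<^esub>" m "\<zero>\<^bsub>B\<^esub>" "\<zero>\<^bsub>NA\<^esub>" n] by (simp add: rho_zero)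
    also have "L.pt (\<zero>\<^bsub>T\<^esub>, t \<otimes>\<^bsub>T\<^esub> x m) (\<zero>\<^bsub>NA\<^esub>, n) \<oplus>\<^bsub>L.XY\<^esub> L.pt (\<zero>\<^bsub>T\<^esub>, \<ominus>\<^bsub>T\<^esub> (t \<otimes>\<^bsub>T\<^esub> x m)) (\<zero>\<^bsub>NA\<^esub>, n)
      = L.pt \<zero>\<^bsub>Row\<^esub> (\<zero>\<^bsub>NA\<^esub>, n)"
      using * by (subst L.pure_add_left[symmetric]) (simp_all add: Row_simps N_simps T.r_neg)
    also have "\<dots> = \<zero>\<^bsub>L.XY\<^esub>"
      using * by (simp add: L.pure_zero_left N_simps)
    finally show "j (h (U.pt (TAM.pt t m) n)) = \<zero>\<^bsub>L.XY\<^esub>"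
      using * by (simp add: h_pure j_pure)
  qed
  \<comment> \<open>The image of \<open>j\<close> contains the pure tensors by \<open>j_pure\<close>
    and is closed under sums by additivity.\<close>
  have j_surj: "u \<in> j ` carrier V" if "u \<in> carrier L.XY" for u
    using that
  proof (induction u rule: L.tensor_induct)
    case (pure r n)
    then obtain s t y y' where "r = (s, t)" "s \<in> carrier T" "t \<in> carrier T"
        "n = (y, y')" "y \<in> carrier NA" "y' \<in> carrier NB"
      by (cases r; cases n) (simp add: Row_simps N_simps)
    then show ?case
      using j_pure[of s t y y'] by (intro image_eqI[of _ j "(TANA.pt s y, TBNB.pt t y')"]) (simp_all add: V_simps)
  next
    case (add u v)
    then obtain v1 v2 where "u = j v1" "v1 \<in> carrier V" "v = j v2" "v2 \<in> carrier V" by blast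
    then show ?case
      using additive_add[OF j_add, of v1 v2] by (intro image_eqI[of _ j "v1 \<oplus>\<^bsub>V\<^esub> v2"]) simp_all
  qed
  \<comment> \<open>The direct sum is not itself a tensor product, so the two summands are treated
    separately, each by uniqueness on its own pure tensors, and then added.\<close>
  have Fj: "?F (j v) = ?\<pi> v" if "v \<in> carrier V" for v
  proof -
    obtain v1 v2 where v: "v = (v1, v2)" "v1 \<in> carrier TANA.XY" "v2 \<in> carrier TBNB.XY"
      using \<open>v \<in> carrier V\<close> by (auto simp: V_simps)
    have "?F (?jA v1) = ?\<pi> (v1, \<zero>\<^bsub>TBNB.XY\<^esub>)"
    proof (rule TANA.tensor_hom_eqI[OF additive_comp[OF jA_add F_add] _ _ v(2)])
      show "(\<lambda>v. ?\<pi> (v, \<zero>\<^bsub>TBNB.XY\<^esub>)) \<in> additive TANA.XY ?C"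
        by (rule additive_comp[OF _ \<pi>_add]) (rule additiveI, simp_all add: V_simps)
      fix s n assume "s \<in> carrier TA" "n \<in> carrier NA"
      then show "?F (?jA (TANA.pt s n)) = ?\<pi> (TANA.pt s n, \<zero>\<^bsub>TBNB.XY\<^esub>)"
        by (simp add: jA_pure F_pure Row_simps N_simps) (simp add: \<gamma>_def TBNB.pure_zero_left[simplified])
    qed
    moreover have "?F (?jB v2) = ?\<pi> (\<zero>\<^bsub>TANA.XY\<^esub>, v2)"
    proof (rule TBNB.tensor_hom_eqI[OF additive_comp[OF jB_add F_add] _ _ v(3)])
      show "(\<lambda>v. ?\<pi> (\<zero>\<^bsub>TANA.XY\<^esub>, v)) \<in> additive TBNB.XY ?C"
        by (rule additive_comp[OF _ \<pi>_add]) (rule additiveI, simp_all add: V_simps)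
      fix t n assume "t \<in> carrier TB" "n \<in> carrier NB"
      then show "?F (?jB (TBNB.pt t n)) = ?\<pi> (\<zero>\<^bsub>TANA.XY\<^esub>, TBNB.pt t n)"
        by (simp add: jB_pure F_pure Row_simps N_simps) (simp add: \<gamma>_def TANA.pure_zero_left[simplified])
    qed
    ultimately show ?thesis
      using v by (simp add: j_def additive_add[OF F_add] additive_closed[OF jA_add] additive_closed[OF jB_add]
          additive_add[OF \<pi>_add, symmetric] V_simps)
  qed
  have "?F \<in> left_module_iso T L.XY ?C"
    by (rule V.quotient_isoI[OF K(1) _ L.left_module_tensor F j_add]) (use K(2) j_h j_surj Fj in auto)
  then show ?thesis
    unfolding left_modules_isomorphic_def cokernel_module_def
    using L.left_module_tensor C.left_module_axioms by blast
qed

end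

text \<open>Pure tensors generate, so the stated values on them determine the additive maps
  \<open>g\<close> and \<open>h\<close> on their domains; they certify that the cokernel is taken of
  the intended map.\<close>

theorem theorem2p12:
  fixes A :: "'a ring" and B :: "'b ring" and M :: "('a, 'b, 'm) bimodule"
    and \<sigma> :: "'a \<times> 'b \<Rightarrow> 'm \<times> 'b" and p :: 'm
    and NA :: "('a, 'x) module" and NB :: "('b, 'y) module" and f :: "('m, 'y) tensor \<Rightarrow> 'x"
  defines "R \<equiv> triangular_ring A B M"
    and "P \<equiv> first_column A B"
    and "Q \<equiv> second_column B M"
    and "N \<equiv> triple_module B M NA NB f"
    and "T \<equiv> T_ring A B M p"
    and "x \<equiv> T_gen A B M p"
    and "\<phi> \<equiv> localization_map A B M p"
    and "g \<equiv> g_map A B M p"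
    and "h \<equiv> presentation_map A B M p NA NB f"
  defines "TA \<equiv> ring_bimodule T (rho_A A B M p)"
    and "TB \<equiv> ring_bimodule T (rho_B A B M p)"
    and "\<sigma>R \<equiv> mat2_ring T"
  defines "\<sigma>N \<equiv> tensor R (ring_bimodule \<sigma>R \<phi>) N"
    and "L \<equiv> tensor R (row_bimodule T \<phi>) N"
    and "TAM \<equiv> bimodule_tensor A TA M"
  defines "U \<equiv> tensor B TAM NB"
    and "V \<equiv> direct_sum_module (tensor A TA NA) (tensor B TB NB)"
  assumes "ring A" and "ring B" and "bimodule A B M"
    and "\<sigma> \<in> left_module_hom R P Q"
    and "p \<in> carrier M" and "\<sigma> (\<one>\<^bsub>A\<^esub>, \<zero>\<^bsub>B\<^esub>) = (p, \<zero>\<^bsub>B\<^esub>)"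
    and "left_module A NA" and "left_module B NB"
    and "f \<in> left_module_hom A (tensor B M NB) NA"
  shows "universal_localization TYPE('s) R P Q \<sigma> \<sigma>R \<phi> \<and>
    left_modules_isomorphic \<sigma>R \<sigma>N (mat2_column L) \<and>
    g \<in> bimodule_hom T B TAM TB \<and>
    (\<forall>t\<in>carrier T. \<forall>m\<in>carrier M. g (pure_tensor A TA M t m) = \<ominus>\<^bsub>T\<^esub> (t \<otimes>\<^bsub>T\<^esub> x m)) \<and>
    h \<in> left_module_hom T U V \<and>
    (\<forall>t\<in>carrier T. \<forall>m\<in>carrier M. \<forall>n\<in>carrier NB.
      h (pure_tensor B TAM NB (pure_tensor A TA M t m) n) =
        (pure_tensor A TA NA t (f (pure_tensor B M NB m n)),
         pure_tensor B TB NB (\<ominus>\<^bsub>T\<^esub> (t \<otimes>\<^bsub>T\<^esub> x m)) n)) \<and>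
    left_modules_isomorphic T L (cokernel_module U V h)"
proof -
  \<comment> \<open>The first seventeen assumptions are the defining equations of the abbreviations;
    the mathematical hypotheses come after them.\<close>
  note hyps = assms(18-26)
  interpret localization_data A B M p \<sigma>
    using hyps unfolding R_def P_def Q_def
    by (intro localization_data.intro T_data.intro localization_data_axioms.intro)
  interpret D: triple_data A B M p NA NB f
    using hyps by (intro triple_data.intro T_data_axioms triple_data_axioms.intro)
  show ?thesis
    unfolding \<sigma>N_def L_def U_def V_def TAM_def TA_def TB_def \<sigma>R_def R_def P_def Q_def N_def T_def x_def
      \<phi>_def g_def h_def
    using universal_localization_mat2_ring D.g_bimodule_hom D.g_pure D.h_hom D.h_pure D.L_iso_cokernel
      tensor_mat2_ring_iso[OF T.ring_axioms R.ring_axioms localization_map_hom D.N.left_module_axioms]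
    by auto
qed

end
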